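(* Let $E$ be a finite nonempty set. For every matroid $\mathsf{M}$ on $E$, there exists a well-defined additive map $\widetilde\chi_{\mathsf{M}}:K(\mathsf{M})\to\mathbb{Z}$ determined by $$\widetilde\chi_{\mathsf{M}}(\varphi_{\mathsf{M}}(f))=Q_{\mathsf{M}}(f)|_{x=1}\qquad\text{for all } f\in\mathrm{PLaur}(\Sigma_E),$$ where $|_{x=1}$ means evaluation of the Laurent polynomial at $x_i=1$ for all $i\in E$. If $\mathsf{M}$ has loops, then $\widetilde\chi_{\mathsf{M}}=0$. If $\mathsf{M}$ is loopless, then the composition $\widetilde\chi_{\mathsf{M}}^*=\widetilde\chi_{\mathsf{M}}\circ\psi_{\mathsf{M}}:\mathrm{PLin}(\Sigma_E)\to\mathbb{Z}$ satisfies (1) $\widetilde\chi_{\mathsf{M}}^*(0)=1$, and (2) for any nonempty proper flat $F$ of $\mathsf{M}$ and any $f\in\mathrm{PLin}(\Sigma_E)$, $$\widetilde\chi_{\mathsf{M}}^*(f)=\widetilde\chi_{\mathsf{M}}^*(f-\delta_F)+\widetilde\chi_{\mathsf{M}|F}^*(f|F)\,\widetilde\chi_{\mathsf{M}/F}^*(f/F).$$ In particular, if $\mathsf{M}$ is loopless, then $\widetilde\chi_{\mathsf{M}}=\chi_{\mathsf{M}}$, where $\chi_{\mathsf{M}}$ is the matroid Euler characteristic introduced by Larson, Li, Payne, and Proudfoot.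
   Context: Braid fan and piecewise functions. Let $|E|=n$, let $S_E$ be the set of bijections $\sigma:[n]\to E$, and $\tau_i\in S_n$ the transposition swapping $i,i+1$. For $T\subseteq E$ let $e_T=\sum_{i\in T}e_i\in\mathbb{R}^E$. The braid fan $\Sigma_E$ is the fan in $\mathbb{R}^E$ cut out by the hyperplanes $b_i=b_j$; its maximal cones are $\widetilde C_\sigma=\{b\in\mathbb{R}^E:b_{\sigma(1)}\ge\dots\ge b_{\sigma(n)}\}$, $\sigma\in S_E$. An integral linear function is a linear function $\mathbb{R}^E\to\mathbb{R}$ sending $\mathbb{Z}^E$ to $\mathbb{Z}$. $\mathrm{PLin}(\Sigma_E)$ is the additive group of functions $\mathbb{R}^E\to\mathbb{R}$ whose restriction to each cone of $\Sigma_E$ is the restriction of an integral linear function. It is freely generated by $\{\delta_T:\emptyset\ne T\subseteq E\}$, where $\delta_T(e_T)=1$ and $\delta_T(e_{S})=0$ for nonempty $S\ne T$. $\mathrm{PLaur}(\Sigma_E)$ is the ring (componentwise operations) of collections $f=\{f_\sigma:\sigma\in S_E\}$, $f_\sigma\in\mathbb{Z}[x_e^{\pm1}:e\in E]$, such that for all $\sigma\in S_E$, $i\in[n-1]$, $f_\sigma-f_{\sigma\circ\tau_i}$ is divisible by $x_{\sigma(i)}-x_{\sigma(i+1)}$ in $\mathbb{Z}[x_e^{\pm1}:e\in E]$. The function $Q_{\mathsf{M}}$. For a matroid $\mathsf{M}$ on $E$, $B_{\mathsf{M}}(\sigma)=\{\sigma(i): \mathrm{rk}_{\mathsf{M}}\{\sigma(1),\dots,\sigma(i)\}>\mathrm{rk}_{\mathsf{M}}\{\sigma(1),\dots,\sigma(i-1)\}\}$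 and $$Q_{\mathsf{M}}(f)=\sum_{\sigma\in S_E}f_\sigma\,\frac{1}{\prod_{i=1}^{n-1}\left(1-\frac{x_{\sigma(i+1)}}{x_{\sigma(i)}}\right)}\prod_{i\in E\setminus B_{\mathsf{M}}(\sigma)}(1-x_i),$$ which is a Laurent polynomial in $\mathbb{Z}[x_e^{\pm1}:e\in E]$ for every $f\in\mathrm{PLaur}(\Sigma_E)$. The ring $K(\mathsf{M})$. A flat of $\mathsf{M}$ is a subset $F\subseteq E$ with $\mathrm{rk}_{\mathsf{M}}(F)<\mathrm{rk}_{\mathsf{M}}(F\cup\{i\})$ for all $i\in E\setminus F$. $\Sigma_{\mathsf{M}}$ is the fan in $\mathbb{R}^E$ of cones $\mathbb{R}_{\ge0}(e_{F_1},\dots,e_{F_k})$ for chains $\emptyset\subsetneq F_1\subsetneq\dots\subsetneq F_k\subseteq E$ of nonempty flats, and $|\Sigma_{\mathsf{M}}|$ is its support. $\mathrm{Lin}(\Sigma_{\mathsf{M}})$ is the group of restrictions to $|\Sigma_{\mathsf{M}}|$ of integral linear functions on $\mathbb{R}^E$. $\mathrm{PExp}(\Sigma_{\mathsf{M}})$ is the ring of functions $f:|\Sigma_{\mathsf{M}}|\to\mathbb{R}$ such that for each cone $C\in\Sigma_{\mathsf{M}}$, $f|_C=(a_1e^{m_1}+\dots+a_ke^{m_k})|_C$ for some $a_j\in\mathbb{Z}$ and integral linear functions $m_j$. The $K$-ring of $\mathsf{M}$ is $$K(\mathsf{M})=\mathrm{PExp}(\Sigma_{\mathsf{M}})/\langle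 e^f-1: f\in\mathrm{Lin}(\Sigma_{\mathsf{M}})\rangle.$$ Maps. $\varphi_{\mathsf{M}}:\mathrm{PLaur}(\Sigma_E)\to K(\mathsf{M})$ is the surjective ring homomorphism which replaces each monomial $x^m$ by the exponential function $e^m$ (so $f$ becomes the function on $\mathbb{R}^E$ given on $\widetilde C_\sigma$ by $f_\sigma$ with $x_i=e^{b_i}$ at the point $b$), restricts the resulting function to $|\Sigma_{\mathsf{M}}|$, and takes its class in $K(\mathsf{M})$. $\psi_{\mathsf{M}}:\mathrm{PLin}(\Sigma_E)\to K(\mathsf{M})$ is $f\mapsto[e^f|_{|\Sigma_{\mathsf{M}}|}]$ (a homomorphism from the additive group to the multiplicative group of units). Restriction and contraction. For $f=\sum_{\emptyset\ne T\subseteq E}a_T\delta_T\in\mathrm{PLin}(\Sigma_E)$ and a nonempty proper subset $F\subset E$ with $F^c=E\setminus F$, put $$f|F=\sum_{\emptyset\ne T\subseteq F}a_T\delta_T\in\mathrm{PLin}(\Sigma_F),\qquad f/F=\sum_{\emptyset\ne T\subseteq F^c}(a_{F\cup T}-a_F)\delta_T\in\mathrm{PLin}(\Sigma_{F^c}).$$ $\mathsf{M}|F$ and $\mathsf{M}/F$ are the matroid restriction (on $F$) and contraction (on $F^c$). Euler characteristics. The matroid Euler characteristics of Larson, Li, Payne, and Proudfoot are characterized as the unique collection of additive functions $\{\chi_{\mathsf{M}}:K(\mathsf{M})\to\mathbb{Z}\}$, indexed by loopless matroids $\mathsf{M}$ on finite nonempty sets $E$, such that each $\chi_{\mathsf{M}}^*=\chi_{\mathsf{M}}\circ\psi_{\mathsf{M}}$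 satisfies $\chi_{\mathsf{M}}^*(0)=1$ and, for every nonempty proper flat $F$ of $\mathsf{M}$ and every $f\in\mathrm{PLin}(\Sigma_E)$, $\chi_{\mathsf{M}}^*(f)=\chi_{\mathsf{M}}^*(f-\delta_F)+\chi_{\mathsf{M}|F}^*(f|F)\,\chi_{\mathsf{M}/F}^*(f/F)$. *)

theory Defs
  imports
    Complex_Main
    "HOL-Library.FuncSet"
    "HOL-Library.Poly_Mapping"
    "HOL-Combinatorics.Transposition"
    "HOL-Computational_Algebra.Fraction_Field"
    "HOL-Algebra.QuotRing"
begin

text \<open>Ground sets are finite subsets \<open>E\<close> of an arbitrary type \<open>'a\<close>. Functions defined only on
  part of a type (points of \<open>\<real>\<^sup>E\<close>, piecewise functions, rank functions, families indexed by
  bijections) are extensional in the sense of \<^theory>\<open>HOL-Library.FuncSet\<close>.\<close>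

section \<open>Points and integral linear functions\<close>

definition RR :: "'a set \<Rightarrow> ('a \<Rightarrow> real) set" where
  "RR E = E \<rightarrow>\<^sub>E UNIV"

definition ZZ :: "'a set \<Rightarrow> ('a \<Rightarrow> real) set" where
  "ZZ E = E \<rightarrow>\<^sub>E \<int>"

definition evec :: "'a set \<Rightarrow> 'a set \<Rightarrow> ('a \<Rightarrow> real)" where
  "evec E T = (\<lambda>i\<in>E. if i \<in> T then 1 else 0)"

definition int_linear :: "'a set \<Rightarrow> (('a \<Rightarrow> real) \<Rightarrow> real) set" where
  "int_linear E = {m \<in> RR E \<rightarrow>\<^sub>E UNIV.
     (\<forall>a\<in>RR E. \<forall>b\<in>RR E. m (\<lambda>i\<in>E. a i + b i) = m a + m b) \<and>
     (\<forall>c. \<forall>b\<in>RR E. m (\<lambda>i\<in>E. c * b i) = c * m b) \<and>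
     (\<forall>b\<in>ZZ E. m b \<in> \<int>)}"

section \<open>The braid fan and piecewise linear functions\<close>

text \<open>The bijections \<open>[n] \<rightarrow> E\<close>, where \<open>n = |E|\<close> and \<open>[n] = {1..n}\<close>.\<close>

definition bijs :: "'a set \<Rightarrow> (nat \<Rightarrow> 'a) set" where
  "bijs E = {\<sigma> \<in> {1..card E} \<rightarrow>\<^sub>E E. bij_betw \<sigma> {1..card E} E}"

definition braid_max_cone :: "'a set \<Rightarrow> (nat \<Rightarrow> 'a) \<Rightarrow> ('a \<Rightarrow> real) set" where
  "braid_max_cone E \<sigma> = {b \<in> RR E. \<forall>i\<in>{1..<card E}. b (\<sigma> i) \<ge> b (\<sigma> (Suc i))}"

text \<open>The cones of the fan are the faces of the maximal cones, obtained by turning some of the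
  defining inequalities into equalities.\<close>

definition braid_fan :: "'a set \<Rightarrow> ('a \<Rightarrow> real) set set" where
  "braid_fan E = {{b \<in> braid_max_cone E \<sigma>. \<forall>i\<in>J. b (\<sigma> i) = b (\<sigma> (Suc i))} |
     \<sigma> J. \<sigma> \<in> bijs E \<and> J \<subseteq> {1..<card E}}"

definition PLin :: "'a set \<Rightarrow> (('a \<Rightarrow> real) \<Rightarrow> real) set" where
  "PLin E = {f \<in> RR E \<rightarrow>\<^sub>E UNIV. \<forall>C\<in>braid_fan E. \<exists>m\<in>int_linear E. \<forall>b\<in>C. f b = m b}"

definition plin_zero :: "'a set \<Rightarrow> (('a \<Rightarrow> real) \<Rightarrow> real)" where
  "plin_zero E = (\<lambda>b\<in>RR E. 0)"

definition plin_diff ::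
  "'a set \<Rightarrow> (('a \<Rightarrow> real) \<Rightarrow> real) \<Rightarrow> (('a \<Rightarrow> real) \<Rightarrow> real) \<Rightarrow> (('a \<Rightarrow> real) \<Rightarrow> real)" where
  "plin_diff E f g = (\<lambda>b\<in>RR E. f b - g b)"

definition nonempty_subsets :: "'a set \<Rightarrow> 'a set set" where
  "nonempty_subsets E = {T. T \<noteq> {} \<and> T \<subseteq> E}"

definition pdelta :: "'a set \<Rightarrow> 'a set \<Rightarrow> (('a \<Rightarrow> real) \<Rightarrow> real)" where
  "pdelta E T = (THE d. d \<in> PLin E \<and> d (evec E T) = 1 \<and>
     (\<forall>S\<in>nonempty_subsets E. S \<noteq> T \<longrightarrow> d (evec E S) = 0))"

definition plin_of_coeffs :: "'a set \<Rightarrow> ('a set \<Rightarrow> int) \<Rightarrow> (('a \<Rightarrow> real) \<Rightarrow> real)" where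
  "plin_of_coeffs E a = (\<lambda>b\<in>RR E. \<Sum>T\<in>nonempty_subsets E. of_int (a T) * pdelta E T b)"

text \<open>The coefficients \<open>a\<^sub>T\<close> of \<open>f = \<Sum>\<^sub>T a\<^sub>T \<delta>\<^sub>T\<close>.\<close>

definition plin_coeffs :: "'a set \<Rightarrow> (('a \<Rightarrow> real) \<Rightarrow> real) \<Rightarrow> ('a set \<Rightarrow> int)" where
  "plin_coeffs E f = (THE a. a \<in> nonempty_subsets E \<rightarrow>\<^sub>E UNIV \<and> f = plin_of_coeffs E a)"

definition plin_restrict ::
  "'a set \<Rightarrow> (('a \<Rightarrow> real) \<Rightarrow> real) \<Rightarrow> 'a set \<Rightarrow> (('a \<Rightarrow> real) \<Rightarrow> real)" where
  "plin_restrict E f F = plin_of_coeffs F (plin_coeffs E f)"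

definition plin_contract ::
  "'a set \<Rightarrow> (('a \<Rightarrow> real) \<Rightarrow> real) \<Rightarrow> 'a set \<Rightarrow> (('a \<Rightarrow> real) \<Rightarrow> real)" where
  "plin_contract E f F =
     plin_of_coeffs (E - F) (\<lambda>T. plin_coeffs E f (F \<union> T) - plin_coeffs E f F)"

section \<open>Laurent polynomials\<close>

text \<open>A Laurent polynomial is an element of the group ring of the free abelian group of exponent
  vectors. The library proves that this ring is an integral domain (as is needed to form its
  field of fractions) when the variables are linearly ordered. Wrapping the elements of \<open>'a\<close>
  in a type of variables, which is ordered by some chosen well-ordering, makes this
  available for every \<open>'a\<close>; the order plays no other role.\<close>

datatype 'a var = Var 'a

definition var_order :: "'a var rel" where
  "var_order = (SOME r. well_order_on UNIV r)"

lemma well_order_var_order: "well_order_on UNIV var_order"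
  unfolding var_order_def by (rule someI_ex) (rule well_order_on)

instantiation var :: (type) linorder
begin

definition less_eq_var :: "'a var \<Rightarrow> 'a var \<Rightarrow> bool" where
  "(x::'a var) \<le> y \<longleftrightarrow> (x, y) \<in> var_order"

definition less_var :: "'a var \<Rightarrow> 'a var \<Rightarrow> bool" where
  "(x::'a var) < y \<longleftrightarrow> x \<le> y \<and> \<not> y \<le> x"

instance
proof
  have lin: "linear_order_on UNIV (var_order :: 'a var rel)"
    using well_order_var_order[where 'a = 'a] by (simp add: well_order_on_def)
  then have r: "refl (var_order :: 'a var rel)" and t: "trans (var_order :: 'a var rel)"
    and a: "antisym (var_order :: 'a var rel)" and tot: "total (var_order :: 'a var rel)"
    by (auto simp: linear_order_on_def partial_order_on_def preorder_on_def)
  fix x y z :: "'a var"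
  show "x < y \<longleftrightarrow> x \<le> y \<and> \<not> y \<le> x" by (rule less_var_def)
  show "x \<le> x" using r by (simp add: less_eq_var_def refl_onD)
  show "x \<le> y \<Longrightarrow> y \<le> z \<Longrightarrow> x \<le> z"
    using t unfolding less_eq_var_def by (rule transD)
  show "x \<le> y \<Longrightarrow> y \<le> x \<Longrightarrow> x = y"
    using a unfolding less_eq_var_def by (rule antisymD)
  show "x \<le> y \<or> y \<le> x"
    using tot r unfolding less_eq_var_def total_on_def
    by (metis UNIV_I refl_onD)
qed

end

type_synonym 'a laurent = "('a var \<Rightarrow>\<^sub>0 int) \<Rightarrow>\<^sub>0 int"

text \<open>The Laurent polynomials \<open>\<int>[x\<^sub>e\<^sup>\<plusminus>\<^sup>1 : e \<in> E]\<close>.\<close>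

definition Laur :: "'a set \<Rightarrow> 'a laurent set" where
  "Laur E = {p. \<forall>m\<in>Poly_Mapping.keys p. Poly_Mapping.keys m \<subseteq> Var ` E}"

definition lvar :: "'a \<Rightarrow> 'a laurent" where
  "lvar e = Poly_Mapping.single (Poly_Mapping.single (Var e) 1) 1"

text \<open>Evaluation at \<open>x\<^sub>e = t e\<close>, for nonzero real numbers \<open>t e\<close>.\<close>

definition leval :: "('a \<Rightarrow> real) \<Rightarrow> 'a laurent \<Rightarrow> real" where
  "leval t p = (\<Sum>m\<in>Poly_Mapping.keys p. of_int (Poly_Mapping.lookup p m) *
     (\<Prod>v\<in>Poly_Mapping.keys m. (case v of Var e \<Rightarrow> t e) powi Poly_Mapping.lookup m v))"

definition PLaur :: "'a set \<Rightarrow> ((nat \<Rightarrow> 'a) \<Rightarrow> 'a laurent) set" where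
  "PLaur E = {f \<in> bijs E \<rightarrow>\<^sub>E Laur E.
     \<forall>\<sigma>\<in>bijs E. \<forall>i\<in>{1..<card E}. \<exists>g\<in>Laur E.
       f \<sigma> - f (\<sigma> \<circ> transpose i (Suc i)) = (lvar (\<sigma> i) - lvar (\<sigma> (Suc i))) * g}"

section \<open>Matroids\<close>

record 'a matroid =
  ground :: "'a set"
  rk :: "'a set \<Rightarrow> nat"

definition matroid :: "'a matroid \<Rightarrow> bool" where
  "matroid M \<longleftrightarrow> finite (ground M) \<and> rk M \<in> Pow (ground M) \<rightarrow>\<^sub>E UNIV \<and>
     (\<forall>A. A \<subseteq> ground M \<longrightarrow> rk M A \<le> card A) \<and>
     (\<forall>A B. A \<subseteq> B \<and> B \<subseteq> ground M \<longrightarrow> rk M A \<le> rk M B) \<and>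
     (\<forall>A B. A \<subseteq> ground M \<and> B \<subseteq> ground M \<longrightarrow>
        rk M (A \<union> B) + rk M (A \<inter> B) \<le> rk M A + rk M B)"

definition loopless :: "'a matroid \<Rightarrow> bool" where
  "loopless M \<longleftrightarrow> (\<forall>i\<in>ground M. rk M {i} \<noteq> 0)"

definition flat :: "'a matroid \<Rightarrow> 'a set \<Rightarrow> bool" where
  "flat M F \<longleftrightarrow> F \<subseteq> ground M \<and> (\<forall>i\<in>ground M - F. rk M F < rk M (F \<union> {i}))"

definition matroid_restrict :: "'a matroid \<Rightarrow> 'a set \<Rightarrow> 'a matroid" where
  "matroid_restrict M F = \<lparr>ground = F, rk = (\<lambda>A\<in>Pow F. rk M A)\<rparr>"

definition matroid_contract :: "'a matroid \<Rightarrow> 'a set \<Rightarrow> 'a matroid" where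
  "matroid_contract M F =
     \<lparr>ground = ground M - F, rk = (\<lambda>A\<in>Pow (ground M - F). rk M (A \<union> F) - rk M F)\<rparr>"

section \<open>The function Q\<close>

definition greedy_basis :: "'a matroid \<Rightarrow> (nat \<Rightarrow> 'a) \<Rightarrow> 'a set" where
  "greedy_basis M \<sigma> =
     {\<sigma> i | i. i \<in> {1..card (ground M)} \<and> rk M (\<sigma> ` {1..i}) > rk M (\<sigma> ` {1..<i})}"

definition to_frac :: "'a laurent \<Rightarrow> 'a laurent fract" where
  "to_frac p = Fract p 1"

definition Q_frac :: "'a matroid \<Rightarrow> ((nat \<Rightarrow> 'a) \<Rightarrow> 'a laurent) \<Rightarrow> 'a laurent fract" where
  "Q_frac M f = (\<Sum>\<sigma>\<in>bijs (ground M).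
     to_frac (f \<sigma>) *
     (1 / (\<Prod>i\<in>{1..<card (ground M)}. (1 - to_frac (lvar (\<sigma> (Suc i))) / to_frac (lvar (\<sigma> i))))) *
     (\<Prod>i\<in>ground M - greedy_basis M \<sigma>. (1 - to_frac (lvar i))))"

text \<open>\<^term>\<open>Q_frac M f\<close> as a Laurent polynomial.\<close>

definition Q :: "'a matroid \<Rightarrow> ((nat \<Rightarrow> 'a) \<Rightarrow> 'a laurent) \<Rightarrow> 'a laurent" where
  "Q M f = (THE q. q \<in> Laur (ground M) \<and> to_frac q = Q_frac M f)"

section \<open>The K-ring of a matroid\<close>

text \<open>A chain of nonempty flats is given by the set of its members; the empty chain yields
  the cone \<open>{0}\<close>.\<close>

definition flat_chains :: "'a matroid \<Rightarrow> 'a set set set" where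
  "flat_chains M = {\<C>. \<C> \<subseteq> {F. flat M F \<and> F \<noteq> {}} \<and> chain\<^sub>\<subseteq> \<C>}"

definition chain_cone :: "'a set \<Rightarrow> 'a set set \<Rightarrow> ('a \<Rightarrow> real) set" where
  "chain_cone E \<C> = {\<lambda>i\<in>E. \<Sum>F\<in>\<C>. c F * evec E F i | c. \<forall>F\<in>\<C>. c F \<ge> 0}"

definition matroid_fan :: "'a matroid \<Rightarrow> ('a \<Rightarrow> real) set set" where
  "matroid_fan M = chain_cone (ground M) ` flat_chains M"

definition fan_support :: "'a matroid \<Rightarrow> ('a \<Rightarrow> real) set" where
  "fan_support M = \<Union> (matroid_fan M)"

definition Lin_fan :: "'a matroid \<Rightarrow> (('a \<Rightarrow> real) \<Rightarrow> real) set" where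
  "Lin_fan M = (\<lambda>m. restrict m (fan_support M)) ` int_linear (ground M)"

definition PExp :: "'a matroid \<Rightarrow> (('a \<Rightarrow> real) \<Rightarrow> real) ring" where
  "PExp M = \<lparr>
     carrier = {f \<in> fan_support M \<rightarrow>\<^sub>E UNIV. \<forall>C\<in>matroid_fan M.
       \<exists>(k::nat) (a :: nat \<Rightarrow> int) m. (\<forall>j\<in>{1..k}. m j \<in> int_linear (ground M)) \<and>
         (\<forall>b\<in>C. f b = (\<Sum>j\<in>{1..k}. of_int (a j) * exp (m j b)))},
     mult = (\<lambda>f g. \<lambda>b\<in>fan_support M. f b * g b),
     one = (\<lambda>b\<in>fan_support M. 1),
     zero = (\<lambda>b\<in>fan_support M. 0),
     add = (\<lambda>f g. \<lambda>b\<in>fan_support M. f b + g b)\<rparr>"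

definition K_ideal :: "'a matroid \<Rightarrow> (('a \<Rightarrow> real) \<Rightarrow> real) set" where
  "K_ideal M = Idl\<^bsub>PExp M\<^esub> {\<lambda>b\<in>fan_support M. exp (f b) - 1 | f. f \<in> Lin_fan M}"

definition K :: "'a matroid \<Rightarrow> (('a \<Rightarrow> real) \<Rightarrow> real) set ring" where
  "K M = PExp M Quot K_ideal M"

definition K_class :: "'a matroid \<Rightarrow> (('a \<Rightarrow> real) \<Rightarrow> real) \<Rightarrow> (('a \<Rightarrow> real) \<Rightarrow> real) set" where
  "K_class M f = K_ideal M +>\<^bsub>PExp M\<^esub> f"

text \<open>The function on \<open>\<real>\<^sup>E\<close> given on each maximal cone by the corresponding Laurent polynomial
  at \<open>x\<^sub>i = exp (b i)\<close>; the values on overlaps agree for members of \<^term>\<open>PLaur E\<close>.\<close>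

definition plaur_fun ::
  "'a set \<Rightarrow> ((nat \<Rightarrow> 'a) \<Rightarrow> 'a laurent) \<Rightarrow> (('a \<Rightarrow> real) \<Rightarrow> real)" where
  "plaur_fun E f = (\<lambda>b\<in>RR E. THE y. \<forall>\<sigma>\<in>bijs E. b \<in> braid_max_cone E \<sigma> \<longrightarrow>
     y = leval (\<lambda>i. exp (b i)) (f \<sigma>))"

definition phi ::
  "'a matroid \<Rightarrow> ((nat \<Rightarrow> 'a) \<Rightarrow> 'a laurent) \<Rightarrow> (('a \<Rightarrow> real) \<Rightarrow> real) set" where
  "phi M f = K_class M (restrict (plaur_fun (ground M) f) (fan_support M))"

definition psi ::
  "'a matroid \<Rightarrow> (('a \<Rightarrow> real) \<Rightarrow> real) \<Rightarrow> (('a \<Rightarrow> real) \<Rightarrow> real) set" where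
  "psi M f = K_class M (\<lambda>b\<in>fan_support M. exp (f b))"

section \<open>Euler characteristics\<close>

definition K_additive :: "'a matroid \<Rightarrow> ((('a \<Rightarrow> real) \<Rightarrow> real) set \<Rightarrow> int) set" where
  "K_additive M = {\<chi> \<in> carrier (K M) \<rightarrow>\<^sub>E UNIV.
     \<forall>x\<in>carrier (K M). \<forall>y\<in>carrier (K M). \<chi> (x \<oplus>\<^bsub>K M\<^esub> y) = \<chi> x + \<chi> y}"

definition represents_Q ::
  "'a matroid \<Rightarrow> ((('a \<Rightarrow> real) \<Rightarrow> real) set \<Rightarrow> int) \<Rightarrow> bool" where
  "represents_Q M \<chi> \<longleftrightarrow> \<chi> \<in> K_additive M \<and>
     (\<forall>f\<in>PLaur (ground M). of_int (\<chi> (phi M f)) = leval (\<lambda>_. 1) (Q M f))"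

definition chi_tilde :: "'a matroid \<Rightarrow> (('a \<Rightarrow> real) \<Rightarrow> real) set \<Rightarrow> int" where
  "chi_tilde M = (THE \<chi>. represents_Q M \<chi>)"

definition loopless_matroids :: "'a matroid set" where
  "loopless_matroids = {M. matroid M \<and> loopless M \<and> ground M \<noteq> {}}"

text \<open>The defining properties of the matroid Euler characteristics, for a family \<open>\<chi>\<close> of
  functions on K-rings, at the matroid \<open>M\<close>.\<close>

definition chi_star ::
  "('a matroid \<Rightarrow> (('a \<Rightarrow> real) \<Rightarrow> real) set \<Rightarrow> int) \<Rightarrow> 'a matroid \<Rightarrow> (('a \<Rightarrow> real) \<Rightarrow> real) \<Rightarrow> int"
  where "chi_star \<chi> M f = \<chi> M (psi M f)"

definition euler_recursion ::
  "('a matroid \<Rightarrow> (('a \<Rightarrow> real) \<Rightarrow> real) set \<Rightarrow> int) \<Rightarrow> 'a matroid \<Rightarrow> bool" where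
  "euler_recursion \<chi> M \<longleftrightarrow>
     (\<forall>F. flat M F \<and> F \<noteq> {} \<and> F \<noteq> ground M \<longrightarrow> (\<forall>f\<in>PLin (ground M).
        chi_star \<chi> M f = chi_star \<chi> M (plin_diff (ground M) f (pdelta (ground M) F)) +
          chi_star \<chi> (matroid_restrict M F) (plin_restrict (ground M) f F) *
          chi_star \<chi> (matroid_contract M F) (plin_contract (ground M) f F)))"

definition is_euler_family ::
  "('a matroid \<Rightarrow> (('a \<Rightarrow> real) \<Rightarrow> real) set \<Rightarrow> int) \<Rightarrow> bool" where
  "is_euler_family \<chi> \<longleftrightarrow> \<chi> \<in> extensional loopless_matroids \<and>
     (\<forall>M\<in>loopless_matroids. \<chi> M \<in> K_additive M \<and>
        chi_star \<chi> M (plin_zero (ground M)) = 1 \<and> euler_recursion \<chi> M)"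

text \<open>The matroid Euler characteristics of Larson, Li, Payne and Proudfoot.\<close>

definition matroid_euler :: "'a matroid \<Rightarrow> (('a \<Rightarrow> real) \<Rightarrow> real) set \<Rightarrow> int" where
  "matroid_euler = (THE \<chi>. is_euler_family \<chi>)"

end

theory Submission
  imports
    Defs
    "HOL-Combinatorics.Multiset_Permutations"
    "HOL-Computational_Algebra.Polynomial"
begin

text \<open>Every piecewise Laurent polynomial is an integral combination of exponentials of
  \<open>f = \<Sum>\<^sub>T a\<^sub>T \<delta>\<^sub>T\<close>, so \<open>Q\<close> only has to be understood on these. Lowering one coefficient \<open>a\<^sub>T\<close> multiplies
  the summands of \<open>Q\<close> in which \<open>T\<close> comes first by \<open>x\<^sub>h / x\<^sub>l\<close>, where \<open>l\<close> and \<open>h\<close> are the entries around the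
  end of \<open>T\<close>. The factor \<open>1 - x\<^sub>h / x\<^sub>l\<close> in the difference cancels against the denominator, and the sum
  splits into the product of the \<open>Q\<close> of the restriction to \<open>T\<close> and of the contraction by \<open>T\<close>. Thus every
  \<open>f\<close> can be reduced to a linear function, for which \<open>Q\<close> is a monomial times the product of \<open>1 - x\<^sub>i\<close> over
  the loops \<open>i\<close>. By induction on the ground set this yields that \<open>Q\<close> is a Laurent polynomial, that its value at
  \<open>1\<close> vanishes if there are loops, and hence, since the contraction by a nonflat has loops, that
  the value only depends on the coefficients at flats, that is, on the class in the K-ring.\<close>

section \<open>Laurent polynomials\<close>

text \<open>The linear case rests on an identity in the fraction field: for a fixed prefix S, the
  total weight of all orderings of A is the product over y in A of 1 or 1 - x_y, according to
  whether y raises the rank of S. Removing one element from all orderings proves it, by partial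
  fractions and submodularity. All sums carry such a prefix, so both factors of the recursion are
  sums for the same rank function, and minors appear only at the end. Exponentials span because b is
  the sum of the delta_T(b) e_T, where the T that occur are nested: inclusion-exclusion over
  incomparable pairs reduces any piecewise function to chains, where it is one Laurent polynomial.
  Using flats alone, the same argument lifts functions from the matroid fan to all of R^E. The ideal
  is killed because multiplication by e^m - 1 lifts to multiplication by x^m - 1, which vanishes at
  1. One asymmetry recurs: delta_E can be negative on R^E but not on the support of the matroid fan.
  Equality in PLaur is therefore tested on nonnegative points only.\<close>

definition lmon :: "('a var \<Rightarrow>\<^sub>0 int) \<Rightarrow> 'a laurent" where
  "lmon m = Poly_Mapping.single m 1"

definition mon_eval :: "('a \<Rightarrow> real) \<Rightarrow> ('a var \<Rightarrow>\<^sub>0 int) \<Rightarrow> real" where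
  "mon_eval t m = (\<Prod>v\<in>Poly_Mapping.keys m. (case v of Var e \<Rightarrow> t e) powi Poly_Mapping.lookup m v)"

lemma lmon_add: "lmon (m + m') = lmon m * lmon m'"
  by (simp add: lmon_def mult_single)

lemma lmon_zero: "lmon 0 = 1"
  by (simp add: lmon_def)

lemma lvar_eq_lmon: "lvar e = lmon (Poly_Mapping.single (Var e) 1)"
  by (simp add: lvar_def lmon_def)

lemma of_int_eq_single: "(of_int c :: 'a laurent) = Poly_Mapping.single 0 c"
  by (metis single_of_int of_int_eq_id id_apply)

lemma mon_eval_superset:
  assumes "finite A" "Poly_Mapping.keys m \<subseteq> A"
  shows "mon_eval t m = (\<Prod>v\<in>A. (case v of Var e \<Rightarrow> t e) powi Poly_Mapping.lookup m v)"
  unfolding mon_eval_def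
  by (rule prod.mono_neutral_left) (use assms in \<open>auto simp: in_keys_iff\<close>)

lemma mon_eval_add:
  assumes "\<And>e. t e \<noteq> 0"
  shows "mon_eval t (m + m') = mon_eval t m * mon_eval t m'"
proof -
  let ?A = "Poly_Mapping.keys m \<union> Poly_Mapping.keys m'"
  have nz: "(case v of Var e \<Rightarrow> t e) \<noteq> 0" for v
    using assms by (cases v) auto
  have "finite ?A" "Poly_Mapping.keys (m + m') \<subseteq> ?A"
    by (auto simp: Poly_Mapping.keys_add)
  then show ?thesis
    by (simp add: mon_eval_superset[where A = ?A] lookup_add power_int_add nz prod.distrib)
qed

lemma mon_eval_zero [simp]: "mon_eval t 0 = 1"
  by (simp add: mon_eval_def)

lemma mon_eval_ones [simp]: "mon_eval (\<lambda>_. 1) m = 1"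
  unfolding mon_eval_def by (rule prod.neutral) (auto split: var.splits)

lemma mon_eval_single: "mon_eval t (Poly_Mapping.single (Var e) k) = t e powi k"
  by (cases "k = 0") (simp_all add: mon_eval_def)

lemma mon_eval_exp:
  assumes "finite E" "Poly_Mapping.keys m \<subseteq> Var ` E"
  shows "mon_eval (\<lambda>i. exp (b i)) m = exp (\<Sum>i\<in>E. of_int (Poly_Mapping.lookup m (Var i)) * b i)"
proof -
  have "mon_eval (\<lambda>i. exp (b i)) m = (\<Prod>v\<in>Var ` E. (case v of Var e \<Rightarrow> exp (b e)) powi Poly_Mapping.lookup m v)"
    using assms by (intro mon_eval_superset) auto
  also have "\<dots> = (\<Prod>i\<in>E. exp (b i) powi Poly_Mapping.lookup m (Var i))"
    by (subst prod.reindex) (auto simp: inj_on_def)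
  also have "\<dots> = (\<Prod>i\<in>E. exp (of_int (Poly_Mapping.lookup m (Var i)) * b i))"
    by (simp add: exp_power_int mult.commute)
  finally show ?thesis
    using assms by (simp add: exp_sum)
qed

lemma leval_alt: "leval t p = (\<Sum>m\<in>Poly_Mapping.keys p. of_int (Poly_Mapping.lookup p m) * mon_eval t m)"
  by (simp add: leval_def mon_eval_def)

lemma leval_superset:
  assumes "finite A" "Poly_Mapping.keys p \<subseteq> A"
  shows "leval t p = (\<Sum>m\<in>A. of_int (Poly_Mapping.lookup p m) * mon_eval t m)"
  unfolding leval_alt
  by (rule sum.mono_neutral_left) (use assms in \<open>auto simp: in_keys_iff\<close>)

lemma leval_zero [simp]: "leval t 0 = 0"
  by (simp add: leval_alt)

lemma leval_add: "leval t (p + q) = leval t p + leval t q"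
proof -
  let ?A = "Poly_Mapping.keys p \<union> Poly_Mapping.keys q"
  have "finite ?A" "Poly_Mapping.keys (p + q) \<subseteq> ?A"
    by (auto simp: Poly_Mapping.keys_add)
  then show ?thesis
    by (simp add: leval_superset[where A = ?A] lookup_add algebra_simps sum.distrib)
qed

lemma leval_uminus: "leval t (- p) = - leval t p"
  using leval_add[of t p "- p"] by simp

lemma leval_diff: "leval t (p - q) = leval t p - leval t q"
  using leval_add[of t p "- q"] by (simp add: leval_uminus)

lemma leval_sum: "leval t (\<Sum>i\<in>A. f i) = (\<Sum>i\<in>A. leval t (f i))"
  by (induction A rule: infinite_finite_induct) (auto simp: leval_add)

lemma leval_single: "leval t (Poly_Mapping.single m c) = of_int c * mon_eval t m"
  by (cases "c = 0") (auto simp: leval_alt)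

lemma leval_mult:
  assumes "\<And>e. t e \<noteq> 0"
  shows "leval t (p * q) = leval t p * leval t q"
proof -
  have *: "p = (\<Sum>m\<in>Poly_Mapping.keys p. Poly_Mapping.single m (Poly_Mapping.lookup p m))" for p :: "'a laurent"
    by (rule poly_mapping_eqI) (simp add: lookup_sum lookup_single when_def in_keys_iff)
  have "leval t (p * q) = leval t (\<Sum>m\<in>Poly_Mapping.keys p. \<Sum>m'\<in>Poly_Mapping.keys q.
      Poly_Mapping.single (m + m') (Poly_Mapping.lookup p m * Poly_Mapping.lookup q m'))"
    by (subst *[of p], subst *[of q], subst sum_product) (simp add: mult_single)
  also have "\<dots> = leval t p * leval t q"
    unfolding leval_alt[of t p] leval_alt[of t q]
    by (simp add: leval_sum leval_single mon_eval_add assms sum_product algebra_simps)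
  finally show ?thesis .
qed

lemma leval_lmon: "leval t (lmon m) = mon_eval t m"
  by (simp add: lmon_def leval_single)

lemma leval_one [simp]: "leval t 1 = 1"
  using leval_lmon[of t 0] by (simp add: lmon_zero)

lemma leval_of_int: "leval t (of_int c) = of_int c"
proof -
  have "leval t (Poly_Mapping.single 0 c) = of_int c"
    by (subst leval_single) simp
  then show ?thesis by (simp add: of_int_eq_single)
qed

lemma leval_lvar: "leval t (lvar e) = t e"
  by (simp add: lvar_eq_lmon leval_lmon mon_eval_single)

lemma leval_int: "\<exists>k::int. leval (\<lambda>_. 1) p = of_int k"
proof -
  have "leval (\<lambda>_. 1) p = of_int (\<Sum>m\<in>Poly_Mapping.keys p. Poly_Mapping.lookup p m)"
    by (simp add: leval_alt)
  then show ?thesis by blast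
qed

lemma Laur_zero [simp]: "0 \<in> Laur E"
  and Laur_one [simp]: "1 \<in> Laur E"
  by (auto simp: Laur_def)

lemma Laur_add: "p \<in> Laur E \<Longrightarrow> q \<in> Laur E \<Longrightarrow> p + q \<in> Laur E"
  unfolding Laur_def using Poly_Mapping.keys_add[of p q] by blast

lemma Laur_uminus: "p \<in> Laur E \<Longrightarrow> - p \<in> Laur E"
  by (simp add: Laur_def)

lemma Laur_diff: "p \<in> Laur E \<Longrightarrow> q \<in> Laur E \<Longrightarrow> p - q \<in> Laur E"
  using Laur_add[of p E "- q"] Laur_uminus by auto

lemma Laur_mult:
  assumes "p \<in> Laur E" "q \<in> Laur E"
  shows "p * q \<in> Laur E"
  unfolding Laur_def
proof safe
  fix m v assume m: "m \<in> Poly_Mapping.keys (p * q)" and v: "v \<in> Poly_Mapping.keys m"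
  from m obtain k l where "m = k + l" "k \<in> Poly_Mapping.keys p" "l \<in> Poly_Mapping.keys q"
    using keys_mult[of p q] by blast
  with v Poly_Mapping.keys_add[of k l] assms show "v \<in> Var ` E"
    unfolding Laur_def by blast
qed

lemma Laur_sum: "(\<And>i. i \<in> A \<Longrightarrow> f i \<in> Laur E) \<Longrightarrow> (\<Sum>i\<in>A. f i) \<in> Laur E"
  by (induction A rule: infinite_finite_induct) (auto simp: Laur_add)

lemma Laur_prod: "(\<And>i. i \<in> A \<Longrightarrow> f i \<in> Laur E) \<Longrightarrow> (\<Prod>i\<in>A. f i) \<in> Laur E"
  by (induction A rule: infinite_finite_induct) (auto simp: Laur_mult)

lemma Laur_mono: "p \<in> Laur E \<Longrightarrow> E \<subseteq> E' \<Longrightarrow> p \<in> Laur E'"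
  unfolding Laur_def by blast

lemma Laur_of_int: "of_int c \<in> Laur E"
  unfolding Laur_def of_int_eq_single by simp

lemma Laur_lmon: "Poly_Mapping.keys m \<subseteq> Var ` E \<Longrightarrow> lmon m \<in> Laur E"
  by (auto simp: Laur_def lmon_def)

lemma Laur_lvar: "e \<in> E \<Longrightarrow> lvar e \<in> Laur E"
  by (simp add: lvar_eq_lmon Laur_lmon)

section \<open>Weighted sums over orderings\<close>

text \<open>The matroid rank axioms without extensionality. A pair of disjoint sets S and A stands
  for the minor on A of the contraction by S, so one function r serves throughout an
  induction.\<close>

definition rank_fun :: "'a set \<Rightarrow> ('a set \<Rightarrow> nat) \<Rightarrow> bool" where
  "rank_fun G r \<longleftrightarrow> finite G \<and>
     (\<forall>A. A \<subseteq> G \<longrightarrow> r A \<le> card A) \<and>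
     (\<forall>A B. A \<subseteq> B \<and> B \<subseteq> G \<longrightarrow> r A \<le> r B) \<and>
     (\<forall>A B. A \<subseteq> G \<and> B \<subseteq> G \<longrightarrow> r (A \<union> B) + r (A \<inter> B) \<le> r A + r B)"

lemma rank_fun_matroid: "matroid M \<Longrightarrow> rank_fun (ground M) (rk M)"
  by (simp add: rank_fun_def matroid_def)

lemma rank_fun_mono: "rank_fun G r \<Longrightarrow> A \<subseteq> B \<Longrightarrow> B \<subseteq> G \<Longrightarrow> r A \<le> r B"
  by (simp add: rank_fun_def)

lemma rank_fun_le_card: "rank_fun G r \<Longrightarrow> A \<subseteq> G \<Longrightarrow> r A \<le> card A"
  by (simp add: rank_fun_def)

lemma rank_fun_submodular:
  "rank_fun G r \<Longrightarrow> A \<subseteq> G \<Longrightarrow> B \<subseteq> G \<Longrightarrow> r (A \<union> B) + r (A \<inter> B) \<le> r A + r B"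
  by (simp add: rank_fun_def)

lemma rank_fun_insert_le:
  assumes "rank_fun G r" "insert y A \<subseteq> G"
  shows "r (insert y A) \<le> Suc (r A)"
proof -
  have "r (A \<union> {y}) + r (A \<inter> {y}) \<le> r A + r {y}" "r {y} \<le> card {y}"
    using rank_fun_submodular[OF assms(1), of A "{y}"] rank_fun_le_card[OF assms(1), of "{y}"] assms(2)
    by auto
  then show ?thesis by simp
qed

lemma rank_fun_diminishing:
  assumes "rank_fun G r" "A \<subseteq> B" "insert y B \<subseteq> G"
  shows "r (insert y B) + r A \<le> r (insert y A) + r B"
proof (cases "y \<in> B")
  case True
  then have "insert y B = B" by auto
  moreover have "r A \<le> r (insert y A)"
    using assms by (intro rank_fun_mono[of G r]) auto
  ultimately show ?thesis by simp
next
  case False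
  have "r (insert y A \<union> B) + r (insert y A \<inter> B) \<le> r (insert y A) + r B"
    by (rule rank_fun_submodular[OF assms(1)]) (use assms in auto)
  moreover have "insert y A \<union> B = insert y B" "insert y A \<inter> B = A"
    using assms False by auto
  ultimately show ?thesis by simp
qed

text \<open>Monotonicity of the closure operator: the last hypothesis says that y lies in the
  closure of A.\<close>

lemma rank_fun_closure_mono:
  assumes "rank_fun G r" "A \<subseteq> B" "insert y B \<subseteq> G" "r (insert y A) = r A"
  shows "r (insert y B) = r B"
  using rank_fun_diminishing[OF assms(1-3)] rank_fun_mono[OF assms(1) subset_insertI[of B y] assms(3)]
    assms(4) by linarith

section \<open>Collapse of the weighted sum over all orderings\<close>

fun head_val :: "('a \<Rightarrow> 'k::field) \<Rightarrow> 'a list \<Rightarrow> 'k" where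
  "head_val x [] = 0"
| "head_val x (c # cs) = x c"

text \<open>The product of \<open>1 / (1 - x\<^sub>b / x\<^sub>a)\<close> over the pairs of consecutive entries; the value \<open>0\<close> of
  \<^const>\<open>head_val\<close> on the empty list makes the factor of the last entry equal to \<open>1\<close>.\<close>

fun braid_weight :: "('a \<Rightarrow> 'k::field) \<Rightarrow> 'a list \<Rightarrow> 'k" where
  "braid_weight x [] = 1"
| "braid_weight x (a # as) = x a / (x a - head_val x as) * braid_weight x as"

definition nonbasis_factor :: "('a \<Rightarrow> 'k::field) \<Rightarrow> ('a set \<Rightarrow> nat) \<Rightarrow> 'a set \<Rightarrow> 'a \<Rightarrow> 'k" where
  "nonbasis_factor x r S y = (if r S < r (insert y S) then 1 else 1 - x y)"

text \<open>For empty S this is the product over the complement of the greedy basis; for general S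
  it is the same product for the contraction by S.\<close>

fun nonbasis_weight :: "('a \<Rightarrow> 'k::field) \<Rightarrow> ('a set \<Rightarrow> nat) \<Rightarrow> 'a set \<Rightarrow> 'a list \<Rightarrow> 'k" where
  "nonbasis_weight x r S [] = 1"
| "nonbasis_weight x r S (y # ys) = nonbasis_factor x r S y * nonbasis_weight x r (insert y S) ys"

fun insertions :: "'a \<Rightarrow> 'a list \<Rightarrow> 'a list list" where
  "insertions y [] = [[y]]"
| "insertions y (a # as) = (y # a # as) # map ((#) a) (insertions y as)"

text \<open>An element of the closure of S has no influence on which later entries raise the
  rank.\<close>

lemma nonbasis_weight_closure:
  assumes "rank_fun G r" "insert y S \<union> set zs \<subseteq> G" "r (insert y S) = r S"
  shows "nonbasis_weight x r (insert y S) zs = nonbasis_weight x r S zs"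
  using assms(2,3)
proof (induction zs arbitrary: S)
  case (Cons z zs)
  have e: "r (insert y (insert z S)) = r (insert z S)"
    by (rule rank_fun_closure_mono[OF assms(1), of S]) (use Cons.prems in auto)
  then have "nonbasis_weight x r (insert y (insert z S)) zs = nonbasis_weight x r (insert z S) zs"
    using Cons by auto
  moreover have "nonbasis_factor x r (insert y S) z = nonbasis_factor x r S z"
    using e Cons.prems by (simp add: nonbasis_factor_def insert_commute)
  ultimately show ?case by (simp add: insert_commute)
qed simp

text \<open>Prepending an entry with value c multiplies by a factor that depends only on the next
  entry. Every insertion except the one in front keeps the head of \<open>as\<close>, so these share
  one factor, and the front insertion is corrected separately. For empty \<open>as\<close> the
  bracket is 0.\<close>

lemma sum_insertions_Cons:
  fixes x :: "'a \<Rightarrow> 'k::field"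
  shows "(\<Sum>zs\<leftarrow>insertions y as. c / (c - head_val x zs) * h zs) =
    c / (c - head_val x as) * ((\<Sum>zs\<leftarrow>insertions y as. h zs) - h (y # as)) + c / (c - x y) * h (y # as)"
proof (cases as)
  case (Cons a list)
  have "(\<Sum>zs\<leftarrow>insertions y list. c / (c - x a) * h (a # zs)) =
      c / (c - x a) * (\<Sum>zs\<leftarrow>insertions y list. h (a # zs))"
    by (rule sum_list_const_mult)
  then show ?thesis by (simp add: Cons comp_def)
qed simp

text \<open>This is 1/(q s) = 1/(p q) + 1/(p s), multiplied by a b. It is applied with p = x_y - c,
  q = x_a - c and s = x_y - x_a.\<close>

lemma partial_fractions:
  fixes a b p q s :: "'k::field"
  assumes "p \<noteq> 0" "q \<noteq> 0" "s \<noteq> 0" "p = q + s"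
  shows "b / p * - (a / s) = b / p * (a / q) - a / q * (b / s)"
proof -
  have "a / q * (b / s) = a * b * p / (p * q * s)" "b / p * (a / q) = a * b * s / (p * q * s)"
    "b / p * (a / s) = a * b * q / (p * q * s)"
    using assms(1-3) by simp_all
  then show ?thesis
    using assms(4) by (simp add: diff_divide_distrib[symmetric] algebra_simps)
qed

text \<open>Summing over all positions of y leaves only the factor that y has in front. The
  induction hypothesis covers the positions behind the head a; the two arrangements with y next to a
  then have to be rebalanced, which depends on how a and y interact in the rank.\<close>

lemma sum_insertions:
  fixes x :: "'a \<Rightarrow> 'k::field"
  assumes r: "rank_fun G r" and x: "inj x" "\<And>a. x a \<noteq> 0"
    and "insert y S \<union> set as \<subseteq> G" "y \<notin> set as" "distinct as"
  shows "(\<Sum>zs\<leftarrow>insertions y as. braid_weight x zs * nonbasis_weight x r S zs) =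
    nonbasis_factor x r S y * (braid_weight x as * nonbasis_weight x r S as)"
  using assms(4-6)
proof (induction as arbitrary: S)
  case Nil
  then show ?case using x by simp
next
  case (Cons a as)
  define n where "n = nonbasis_factor x r"
  define W where "W = braid_weight x as"
  define N where "N = nonbasis_weight x r (insert a S) as"
  define D where "D = nonbasis_weight x r (insert y (insert a S)) as"
  define c where "c = head_val x as"
  have ne: "x a \<noteq> 0" "x y \<noteq> 0" "x a \<noteq> x y" "x a \<noteq> c" "x y \<noteq> c"
    using x Cons.prems unfolding c_def inj_def by (cases as; auto)+
  have IH: "(\<Sum>zs\<leftarrow>insertions y as. braid_weight x zs * nonbasis_weight x r (insert a S) zs) =
      n (insert a S) y * (W * N)"
    using Cons.IH[of "insert a S"] Cons.prems by (auto simp: n_def W_def N_def)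
  \<comment> \<open>The insertion of y directly behind a is the one whose braid factor with a
    differs from the others.\<close>
  have t1: "braid_weight x (y # as) * nonbasis_weight x r (insert a S) (y # as) =
      x y / (x y - c) * W * (n (insert a S) y * D)"
    by (simp add: W_def D_def c_def n_def)
  have "(\<Sum>zs\<leftarrow>insertions y as. braid_weight x (a # zs) * nonbasis_weight x r S (a # zs)) =
     n S a * (\<Sum>zs\<leftarrow>insertions y as. x a / (x a - head_val x zs) *
        (braid_weight x zs * nonbasis_weight x r (insert a S) zs))"
    unfolding sum_list_const_mult[symmetric] by (simp add: n_def algebra_simps)
  also have "\<dots> = n S a * (x a / (x a - c) * (n (insert a S) y * (W * N) -
        x y / (x y - c) * W * (n (insert a S) y * D)) + x a / (x a - x y) *
        (x y / (x y - c) * W * (n (insert a S) y * D)))"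
    unfolding sum_insertions_Cons IH t1 c_def ..
  finally have rest: "(\<Sum>zs\<leftarrow>insertions y as. braid_weight x (a # zs) * nonbasis_weight x r S (a # zs)) = \<dots>" .
  have t0: "braid_weight x (y # a # as) * nonbasis_weight x r S (y # a # as) =
      x y / (x y - x a) * (x a / (x a - c) * W) * (n S y * (n (insert y S) a * D))"
    by (simp add: W_def D_def c_def n_def insert_commute)
  \<comment> \<open>Braid factors of adjacent pairs: P for a before the head of \<open>as\<close>, R
    for y before a, U for y before the head of \<open>as\<close>, V for a before y.\<close>
  define P where "P = x a / (x a - c)"
  define R where "R = x y / (x y - x a)"
  define U where "U = x y / (x y - c)"
  define V where "V = x a / (x a - x y)"
  have V: "V = - (x a / (x y - x a))"
    unfolding V_def by (metis minus_diff_eq minus_divide_right)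
  have key: "U * V = U * P - P * R"
    unfolding U_def V P_def R_def
    by (rule partial_fractions) (use ne in auto)
  \<comment> \<open>Needed when a and y are parallel over S: whichever comes second contributes its
    factor 1 - x, and the two orders together restore 1.\<close>
  have "R * (x y - x a) = x y"
    using ne by (simp add: R_def)
  then have R: "(1 - x a) * R + (1 - x y) * (1 - R) = 1"
    by (simp add: algebra_simps)
  have G: "insert y (insert a S) \<subseteq> G" "insert y S \<subseteq> G" "insert a S \<subseteq> G"
    using Cons.prems by auto
  have m: "r S \<le> r (insert y S)" "r S \<le> r (insert a S)"
     "r (insert a S) \<le> r (insert y (insert a S))" "r (insert y S) \<le> r (insert y (insert a S))"
    by (rule rank_fun_mono[OF r]; use G in auto)+
  have d: "r (insert y (insert a S)) + r S \<le> r (insert y S) + r (insert a S)"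
    using G by (intro rank_fun_diminishing[OF r]) auto
  have u: "r (insert y S) \<le> Suc (r S)" "r (insert a S) \<le> Suc (r S)"
    "r (insert y (insert a S)) \<le> Suc (r (insert a S))"
    using G by (auto intro: rank_fun_insert_le[OF r])
  have DN: "D = N" if "r (insert y (insert a S)) = r (insert a S)"
    unfolding D_def N_def
    by (rule nonbasis_weight_closure[OF r]) (use Cons.prems that in auto)
  have goal: "R * (P * W) * (n S y * (n (insert y S) a * D)) +
     n S a * (P * (n (insert a S) y * (W * N) - U * W * (n (insert a S) y * D)) +
        V * (U * W * (n (insert a S) y * D))) = n S y * (P * W * (n S a * N))"
  proof -
    \<comment> \<open>Either y is in the closure of S, or y is independent of S together with a, or
      a and y are parallel in the contraction by S.\<close>
    consider "r (insert y S) = r S" | "r (insert y (insert a S)) > r (insert a S)"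
      | "r (insert y S) > r S" "r (insert y (insert a S)) = r (insert a S)"
      using m(1,3) le_neq_implies_less by metis
    then show ?thesis
    proof cases
      case 1
      have e: "r (insert y (insert a S)) = r (insert a S)"
        using G by (blast intro: rank_fun_closure_mono[OF r _ _ 1])
      have f: "n S y = 1 - x y" "n (insert a S) y = 1 - x y" "n (insert y S) a = n S a" "D = N"
        unfolding n_def nonbasis_factor_def insert_commute[of a y] using e 1 DN by simp_all
      have "R * (P * W) * (n S y * (n (insert y S) a * D)) +
         n S a * (P * (n (insert a S) y * (W * N) - U * W * (n (insert a S) y * D)) +
         V * (U * W * (n (insert a S) y * D))) =
          n S a * (1 - x y) * N * W * (P * R + P - U * P + U * V)"
        unfolding f by (simp add: algebra_simps)
      then show ?thesis using key \<open>n S y = 1 - x y\<close> by simp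
    next
      case 2
      then have f: "n S y = 1" "n (insert a S) y = 1" "n (insert y S) a = n S a"
        unfolding n_def nonbasis_factor_def insert_commute[of a y] using m d u by simp_all
      have "R * (P * W) * (n S y * (n (insert y S) a * D)) +
         n S a * (P * (n (insert a S) y * (W * N) - U * W * (n (insert a S) y * D)) +
         V * (U * W * (n (insert a S) y * D))) =
          n S a * W * (P * N + D * (P * R - U * P + U * V))"
        unfolding f by (simp add: algebra_simps)
      then show ?thesis using key \<open>n S y = 1\<close> by simp
    next
      case 3
      then have f: "n S y = 1" "n (insert a S) y = 1 - x y" "n (insert y S) a = 1 - x a" "n S a = 1" "D = N"
        unfolding n_def nonbasis_factor_def insert_commute[of a y] using m d u DN by simp_all
      have "R * (P * W) * (n S y * (n (insert y S) a * D)) +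
         n S a * (P * (n (insert a S) y * (W * N) - U * W * (n (insert a S) y * D)) +
         V * (U * W * (n (insert a S) y * D))) =
          W * N * (P * ((1 - x a) * R) + (1 - x y) * (P - U * P + U * V))"
        unfolding f by (simp add: algebra_simps)
      also have "\<dots> = W * N * P * ((1 - x a) * R + (1 - x y) * (1 - R))"
        unfolding key by (simp add: algebra_simps)
      finally show ?thesis using R \<open>n S y = 1\<close> \<open>n S a = 1\<close> by simp
    qed
  qed
  have "(\<Sum>zs\<leftarrow>insertions y (a # as). braid_weight x zs * nonbasis_weight x r S zs) =
     R * (P * W) * (n S y * (n (insert y S) a * D)) +
     n S a * (P * (n (insert a S) y * (W * N) - U * W * (n (insert a S) y * D)) +
        V * (U * W * (n (insert a S) y * D)))"
    unfolding P_def R_def U_def V_def t0[symmetric] rest[symmetric] by (simp add: comp_def)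
  also note goal
  finally show ?case by (simp add: P_def W_def N_def n_def c_def)
qed

section \<open>Orderings of a set as insertions into orderings of a smaller one\<close>

lemma set_insertions: "zs \<in> set (insertions y as) \<Longrightarrow> set zs = insert y (set as)"
  by (induction as arbitrary: zs) auto

lemma distinct_insertions:
  "zs \<in> set (insertions y as) \<Longrightarrow> y \<notin> set as \<Longrightarrow> distinct as \<Longrightarrow> distinct zs"
  by (induction as arbitrary: zs) (auto simp: set_insertions)

lemma remove1_insertions: "zs \<in> set (insertions y as) \<Longrightarrow> y \<notin> set as \<Longrightarrow> remove1 y zs = as"
  by (induction as arbitrary: zs) auto

lemma distinct_insertions_list: "y \<notin> set as \<Longrightarrow> distinct (insertions y as)"
  by (induction as) (auto simp: distinct_map)

lemma mem_insertions: "y \<in> set zs \<Longrightarrow> zs \<in> set (insertions y (remove1 y zs))"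
proof (induction zs)
  case (Cons z zs)
  show ?case by (cases "z = y"; cases zs) (use Cons in auto)
qed simp

text \<open>Removing y recovers the ordering of A, so the families of insertions into different
  orderings are disjoint.\<close>

lemma sum_permutations_insert:
  fixes h :: "'a list \<Rightarrow> 'k::comm_monoid_add"
  assumes "y \<notin> A" "finite A"
  shows "(\<Sum>zs\<in>permutations_of_set (insert y A). h zs) =
    (\<Sum>as\<in>permutations_of_set A. \<Sum>zs\<leftarrow>insertions y as. h zs)"
proof -
  have "(\<Sum>as\<in>permutations_of_set A. \<Sum>zs\<leftarrow>insertions y as. h zs) =
      (\<Sum>as\<in>permutations_of_set A. \<Sum>zs\<in>set (insertions y as). h zs)"
    by (intro sum.cong refl sum_list_distinct_conv_sum_set distinct_insertions_list)
      (use assms in \<open>auto simp: permutations_of_set_def\<close>)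
  also have "\<dots> = (\<Sum>zs\<in>(\<Union>as\<in>permutations_of_set A. set (insertions y as)). h zs)"
  proof (intro sum.UNION_disjoint[symmetric] ballI impI)
    show "finite (permutations_of_set A)" by simp
    fix as bs assume "as \<in> permutations_of_set A" "bs \<in> permutations_of_set A" "as \<noteq> bs"
    then show "set (insertions y as) \<inter> set (insertions y bs) = {}"
      using assms remove1_insertions[of _ y as] remove1_insertions[of _ y bs]
      by (auto simp: permutations_of_set_def)
  qed auto
  also have "(\<Union>as\<in>permutations_of_set A. set (insertions y as)) = permutations_of_set (insert y A)"
  proof (intro subset_antisym subsetI)
    fix zs assume zs: "zs \<in> permutations_of_set (insert y A)"
    then have "remove1 y zs \<in> permutations_of_set A"
      using assms by (auto simp: permutations_of_set_def)
    moreover have "zs \<in> set (insertions y (remove1 y zs))"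
      using zs by (intro mem_insertions) (auto simp: permutations_of_set_def)
    ultimately show "zs \<in> (\<Union>as\<in>permutations_of_set A. set (insertions y as))" by blast
  qed (use assms in \<open>auto simp: permutations_of_set_def set_insertions distinct_insertions\<close>)
  finally show ?thesis ..
qed

text \<open>Orderings of a set with one more element arise by inserting it into the orderings of the
  smaller set, so the sum collapses one element at a time.\<close>

lemma sum_weights:
  fixes x :: "'a \<Rightarrow> 'k::field"
  assumes r: "rank_fun G r" and x: "inj x" "\<And>a. x a \<noteq> 0" and "S \<union> A \<subseteq> G"
  shows "(\<Sum>zs\<in>permutations_of_set A. braid_weight x zs * nonbasis_weight x r S zs) =
    (\<Prod>y\<in>A. nonbasis_factor x r S y)"
proof -
  have "finite A" using r assms(4) finite_subset by (auto simp: rank_fun_def)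
  then show ?thesis
    using assms(4)
  proof (induction A)
    case (insert y A)
    have "(\<Sum>zs\<in>permutations_of_set (insert y A). braid_weight x zs * nonbasis_weight x r S zs) =
       (\<Sum>as\<in>permutations_of_set A. nonbasis_factor x r S y * (braid_weight x as * nonbasis_weight x r S as))"
      unfolding sum_permutations_insert[OF insert.hyps(2,1)]
    proof (rule sum.cong[OF refl])
      fix as assume "as \<in> permutations_of_set A"
      then have "set as = A" "distinct as" by (auto simp: permutations_of_set_def)
      then show "(\<Sum>zs\<leftarrow>insertions y as. braid_weight x zs * nonbasis_weight x r S zs) =
        nonbasis_factor x r S y * (braid_weight x as * nonbasis_weight x r S as)"
        using insert.hyps insert.prems by (intro sum_insertions[OF r x]) auto
    qed
    then show ?case
      using insert by (simp add: sum_distrib_left[symmetric])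
  qed simp
qed

section \<open>Laurent polynomials inside their field of fractions\<close>

lemma to_frac_add: "to_frac (p + q) = to_frac p + to_frac q"
  and to_frac_diff: "to_frac (p - q) = to_frac p - to_frac q"
  and to_frac_mult: "to_frac (p * q) = to_frac p * to_frac q"
  and to_frac_zero: "to_frac 0 = 0"
  and to_frac_one: "to_frac 1 = 1"
  by (simp_all add: to_frac_def Zero_fract_def One_fract_def)

lemma to_frac_eq_iff: "to_frac p = to_frac q \<longleftrightarrow> p = q"
  by (simp add: to_frac_def eq_fract)

lemma to_frac_prod: "to_frac (\<Prod>i\<in>A. f i) = (\<Prod>i\<in>A. to_frac (f i))"
  by (induction A rule: infinite_finite_induct) (auto simp: to_frac_mult to_frac_one)

abbreviation fvar :: "'a \<Rightarrow> 'a laurent fract" where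
  "fvar i \<equiv> to_frac (lvar i)"

lemma inj_fvar: "inj fvar"
proof (rule injI)
  fix a b :: 'a
  assume "fvar a = fvar b"
  then have "Poly_Mapping.single (Var a) (1::int) = Poly_Mapping.single (Var b) 1"
    by (simp add: to_frac_eq_iff lvar_def frag_of_eq)
  then show "a = b" by (simp add: frag_of_eq)
qed

lemma fvar_nonzero: "fvar a \<noteq> 0"
  using to_frac_eq_iff[of "lvar a" 0] by (simp add: to_frac_zero lvar_def)

text \<open>On the cone of an ordering, e_y is the difference of two consecutive indicator vectors.
  Hence the linear function with value a T at e_T for each prefix T has coefficient a (insert y S) -
  a S at y; this is its exponent vector.\<close>

fun flag_exponent :: "('a set \<Rightarrow> int) \<Rightarrow> 'a set \<Rightarrow> 'a list \<Rightarrow> 'a var \<Rightarrow>\<^sub>0 int" where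
  "flag_exponent a S [] = 0"
| "flag_exponent a S (y # ys) =
     Poly_Mapping.single (Var y) (a (insert y S) - a S) + flag_exponent a (insert y S) ys"

lemma flag_exponent_append:
  "flag_exponent a S (us @ vs) = flag_exponent a S us + flag_exponent a (S \<union> set us) vs"
  by (induction us arbitrary: S) (simp_all add: algebra_simps)

text \<open>Only the sets reached along the ordering enter. This is why changing a at T leaves alone
  every ordering that does not begin with T.\<close>

lemma flag_exponent_cong_prefix:
  assumes "\<And>us vs. zs = us @ vs \<Longrightarrow> a (S \<union> set us) = a' (S \<union> set us)"
  shows "flag_exponent a S zs = flag_exponent a' S zs"
  using assms
proof (induction zs arbitrary: S)
  case (Cons z zs)
  have "flag_exponent a (insert z S) zs = flag_exponent a' (insert z S) zs"
  proof (rule Cons.IH)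
    fix us vs assume "zs = us @ vs"
    then show "a (insert z S \<union> set us) = a' (insert z S \<union> set us)"
      using Cons.prems[of "z # us" vs] by simp
  qed
  then show ?case
    using Cons.prems[of "[]" "z # zs"] Cons.prems[of "[z]" zs] by simp
qed simp

lemma flag_exponent_cong:
  assumes "\<And>U. S \<subseteq> U \<Longrightarrow> U \<subseteq> S \<union> set zs \<Longrightarrow> a U = a' U"
  shows "flag_exponent a S zs = flag_exponent a' S zs"
  by (rule flag_exponent_cong_prefix) (use assms in auto)

lemma flag_exponent_shift:
  assumes "\<And>U. U \<subseteq> S' \<union> set zs \<Longrightarrow> a' U = a (F \<union> U) - c"
  shows "flag_exponent a' S' zs = flag_exponent a (F \<union> S') zs"
  using assms
proof (induction zs arbitrary: S')
  case (Cons z zs)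
  have "flag_exponent a' (insert z S') zs = flag_exponent a (F \<union> insert z S') zs"
    by (rule Cons.IH) (use Cons.prems in auto)
  moreover have "a' (insert z S') = a (F \<union> insert z S') - c" "a' S' = a (F \<union> S') - c"
    by (rule Cons.prems; auto)+
  ultimately show ?case by simp
qed simp

lemma flag_exponent_linear:
  assumes "\<And>U. S \<subseteq> U \<Longrightarrow> U \<subseteq> S \<union> set zs \<Longrightarrow> a U = c + (\<Sum>j\<in>U. k j)"
    and "finite S" "distinct zs" "S \<inter> set zs = {}"
  shows "flag_exponent a S zs = (\<Sum>j\<in>set zs. Poly_Mapping.single (Var j) (k j))"
  using assms
proof (induction zs arbitrary: S)
  case (Cons z zs)
  have "a (insert z S) = c + (\<Sum>j\<in>insert z S. k j)" "a S = c + (\<Sum>j\<in>S. k j)"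
    by (rule Cons.prems(1); auto)+
  then have "a (insert z S) - a S = k z"
    using Cons.prems(2-) by simp
  moreover have "flag_exponent a (insert z S) zs = (\<Sum>j\<in>set zs. Poly_Mapping.single (Var j) (k j))"
    by (rule Cons.IH) (use Cons.prems in auto)
  ultimately show ?case using Cons.prems by simp
qed simp

lemma keys_flag_exponent: "Poly_Mapping.keys (flag_exponent a S zs) \<subseteq> Var ` set zs"
proof (induction zs arbitrary: S)
  case (Cons z zs)
  show ?case
    using Poly_Mapping.keys_add[of "Poly_Mapping.single (Var z) (a (insert z S) - a S)" "flag_exponent a (insert z S) zs"]
      Cons[of "insert z S"] by (auto split: if_splits)
qed simp

lemma nonbasis_weight_append:
  "nonbasis_weight x r S (us @ vs) = nonbasis_weight x r S us * nonbasis_weight x r (S \<union> set us) vs"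
  by (induction us arbitrary: S) simp_all

lemma nonbasis_weight_shift:
  assumes "\<And>U y. U \<subseteq> S' \<union> set zs \<Longrightarrow> y \<in> set zs \<Longrightarrow>
      r' U < r' (insert y U) \<longleftrightarrow> r (F \<union> U) < r (insert y (F \<union> U))"
  shows "nonbasis_weight x r' S' zs = nonbasis_weight x r (F \<union> S') zs"
  using assms
proof (induction zs arbitrary: S')
  case (Cons z zs)
  have "nonbasis_weight x r' (insert z S') zs = nonbasis_weight x r (F \<union> insert z S') zs"
    by (rule Cons.IH) (use Cons.prems in auto)
  moreover have "nonbasis_factor x r' S' z = nonbasis_factor x r (F \<union> S') z"
    using Cons.prems[of S' z] by (auto simp: nonbasis_factor_def)
  ultimately show ?case by simp
qed simp

text \<open>The weight splits at any place except for the factor of the pair (l, h). As last entry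
  of its own list, l contributes x l / x l, which is 1 because x l is nonzero.\<close>

lemma braid_weight_append:
  "braid_weight x (us @ [l] @ h # vs) =
    x l / (x l - x h) * (braid_weight x (us @ [l]) * braid_weight x (h # vs))"
  if "x l \<noteq> 0"
proof (induction us)
  case (Cons u us)
  have "head_val x (us @ [l] @ h # vs) = head_val x (us @ [l])" by (cases us) simp_all
  then have "braid_weight x ((u # us) @ [l] @ h # vs) =
      x u / (x u - head_val x (us @ [l])) * braid_weight x (us @ [l] @ h # vs)"
    by simp
  then show ?case
    unfolding Cons by (simp only: append_Cons braid_weight.simps mult_ac)
qed (use that in simp)

text \<open>The sum defining Q for the minor on A of the contraction by S, applied to the
  exponential with flag values a. For empty S and the full ground set it is \<open>Q_frac\<close> of
  an exponential.\<close>

definition flag_sum :: "('a set \<Rightarrow> nat) \<Rightarrow> ('a set \<Rightarrow> int) \<Rightarrow> 'a set \<Rightarrow> 'a set \<Rightarrow> 'a laurent fract" where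
  "flag_sum r a S A = (\<Sum>zs\<in>permutations_of_set A. to_frac (lmon (flag_exponent a S zs)) *
     (braid_weight fvar zs * nonbasis_weight fvar r S zs))"

lemma flag_sum_cong:
  assumes "\<And>U. S \<subseteq> U \<Longrightarrow> U \<subseteq> S \<union> A \<Longrightarrow> a U = a' U"
  shows "flag_sum r a S A = flag_sum r a' S A"
  unfolding flag_sum_def
proof (rule sum.cong[OF refl])
  fix zs assume "zs \<in> permutations_of_set A"
  then have "flag_exponent a S zs = flag_exponent a' S zs"
    using assms by (intro flag_exponent_cong) (auto simp: permutations_of_set_def)
  then show "to_frac (lmon (flag_exponent a S zs)) * (braid_weight fvar zs * nonbasis_weight fvar r S zs) =
      to_frac (lmon (flag_exponent a' S zs)) * (braid_weight fvar zs * nonbasis_weight fvar r S zs)"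
    by simp
qed

text \<open>Only comparisons of ranks and differences of values of a enter a flag sum, so the sum
  for a minor is a sum for r itself. Empty F and c = 0 give the restriction, c = a F the
  contraction.\<close>

lemma flag_sum_shift:
  assumes "\<And>U y. U \<subseteq> A \<Longrightarrow> y \<in> A \<Longrightarrow>
      r' U < r' (insert y U) \<longleftrightarrow> r (F \<union> U) < r (insert y (F \<union> U))"
    and "\<And>U. U \<subseteq> A \<Longrightarrow> a' U = a (F \<union> U) - c"
  shows "flag_sum r' a' {} A = flag_sum r a F A"
  unfolding flag_sum_def
proof (rule sum.cong[OF refl])
  fix zs assume zs: "zs \<in> permutations_of_set A"
  then have "flag_exponent a' {} zs = flag_exponent a (F \<union> {}) zs"
    using assms by (intro flag_exponent_shift) (auto simp: permutations_of_set_def)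
  moreover have "nonbasis_weight fvar r' {} zs = nonbasis_weight fvar r (F \<union> {}) zs"
    using assms zs by (intro nonbasis_weight_shift) (auto simp: permutations_of_set_def)
  ultimately show "to_frac (lmon (flag_exponent a' {} zs)) * (braid_weight fvar zs * nonbasis_weight fvar r' {} zs) =
      to_frac (lmon (flag_exponent a F zs)) * (braid_weight fvar zs * nonbasis_weight fvar r F zs)"
    by simp
qed

text \<open>The value at U enters twice: positively in the exponent of l, which completes U, and
  negatively in that of h, which leaves U. Lowering it trades x_l for x_h.\<close>

lemma flag_exponent_decrease_append:
  assumes "distinct (us @ [l] @ h # vs)" "S \<inter> set (us @ [l] @ h # vs) = {}"
    and U: "U = S \<union> set (us @ [l])"
  shows "flag_exponent (a(U := a U - 1)) S (us @ [l] @ h # vs) + Poly_Mapping.single (Var l) 1 =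
    flag_exponent a S (us @ [l] @ h # vs) + Poly_Mapping.single (Var h) 1"
proof -
  let ?a = "a(U := a U - 1)"
  have 1: "flag_exponent ?a S us = flag_exponent a S us"
    using assms by (intro flag_exponent_cong) auto
  have "insert h U \<noteq> U" using assms by auto
  then have 2: "flag_exponent ?a (insert h U) vs = flag_exponent a (insert h U) vs"
    by (intro flag_exponent_cong) auto
  have 3: "S \<union> set us \<noteq> U" using assms by auto
  have U': "insert l (S \<union> set us) = U" "S \<union> set (us @ [l]) = U" using U by auto
  have e: "flag_exponent b S (us @ [l] @ h # vs) = flag_exponent b S us +
      Poly_Mapping.single (Var l) (b U - b (S \<union> set us)) +
      (Poly_Mapping.single (Var h) (b (insert h U) - b U) + flag_exponent b (insert h U) vs)" for b
    using flag_exponent_append[of b S "us @ [l]" "h # vs"] flag_exponent_append[of b S us "[l]"]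
    unfolding U'(2) by (simp add: U'(1))
  show ?thesis
    unfolding e 1 2 using 3 \<open>insert h U \<noteq> U\<close>
    by (simp add: single_diff single_add algebra_simps)
qed

lemma sum_permutations_split:
  fixes h :: "'a list \<Rightarrow> 'k::comm_monoid_add"
  assumes "finite A" "T \<subseteq> A"
    and "\<And>zs. zs \<in> permutations_of_set A \<Longrightarrow> \<nexists>us vs. zs = us @ vs \<and> set us = T \<Longrightarrow> h zs = 0"
  shows "(\<Sum>zs\<in>permutations_of_set A. h zs) =
    (\<Sum>us\<in>permutations_of_set T. \<Sum>vs\<in>permutations_of_set (A - T). h (us @ vs))"
proof -
  let ?P = "permutations_of_set T \<times> permutations_of_set (A - T)"
  let ?f = "\<lambda>(us, vs). us @ vs"
  \<comment> \<open>All first components have length card T, so concatenation can be undone.\<close>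
  have "inj_on ?f ?P"
    by (auto simp: inj_on_def dest!: length_finite_permutations_of_set)
  then have "(\<Sum>us\<in>permutations_of_set T. \<Sum>vs\<in>permutations_of_set (A - T). h (us @ vs)) =
      (\<Sum>zs\<in>?f ` ?P. h zs)"
    by (simp add: sum.cartesian_product sum.reindex case_prod_unfold)
  also have "\<dots> = (\<Sum>zs\<in>permutations_of_set A. h zs)"
  proof (rule sum.mono_neutral_left)
    show "?f ` ?P \<subseteq> permutations_of_set A"
      using assms(2) by (auto simp: permutations_of_set_def)
    show "\<forall>zs\<in>permutations_of_set A - ?f ` ?P. h zs = 0"
    proof
      fix zs assume zs: "zs \<in> permutations_of_set A - ?f ` ?P"
      have "us @ vs \<in> ?f ` ?P" if "zs = us @ vs" "set us = T" for us vs
        using that zs by (auto simp: permutations_of_set_def image_iff)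
      with zs assms(3)[of zs] show "h zs = 0" by blast
    qed
  qed simp
  finally show ?thesis ..
qed

text \<open>Lowering \<open>a\<close> at \<open>S \<union> T\<close> only affects the orderings in which \<open>T\<close> comes first, and there it
  contributes a factor \<open>1 - x\<^sub>h / x\<^sub>l\<close> that cancels the one in the braid weight between \<open>T\<close> and the
  rest. What remains is a product.\<close>

lemma flag_sum_decrease:
  assumes "finite A" "S \<inter> A = {}" "T \<subseteq> A" "T \<noteq> {}" "T \<noteq> A"
  shows "flag_sum r a S A = flag_sum r (a(S \<union> T := a (S \<union> T) - 1)) S A +
    flag_sum r a S T * flag_sum r a (S \<union> T) (A - T)"
proof -
  let ?a = "a(S \<union> T := a (S \<union> T) - 1)"
  let ?w = "\<lambda>S zs. braid_weight fvar zs * nonbasis_weight fvar r S zs"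
  let ?m = "\<lambda>a S zs. to_frac (lmon (flag_exponent a S zs))"
  have "flag_sum r a S A - flag_sum r ?a S A =
     (\<Sum>zs\<in>permutations_of_set A. (?m a S zs - ?m ?a S zs) * ?w S zs)"
    unfolding flag_sum_def sum_subtractf[symmetric] left_diff_distrib ..
  also have "\<dots> = (\<Sum>us\<in>permutations_of_set T. \<Sum>vs\<in>permutations_of_set (A - T).
      (?m a S (us @ vs) - ?m ?a S (us @ vs)) * ?w S (us @ vs))"
  proof (rule sum_permutations_split[OF assms(1,3)])
    fix zs assume zs: "zs \<in> permutations_of_set A" and no: "\<nexists>us vs. zs = us @ vs \<and> set us = T"
    have "flag_exponent a S zs = flag_exponent ?a S zs"
    proof (rule flag_exponent_cong_prefix)
      fix us vs assume e: "zs = us @ vs"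
      then have "set us \<subseteq> A" using zs by (auto simp: permutations_of_set_def)
      with e no assms have "S \<union> set us \<noteq> S \<union> T" by blast
      then show "a (S \<union> set us) = ?a (S \<union> set us)" by simp
    qed
    then show "(?m a S zs - ?m ?a S zs) * ?w S zs = 0" by simp
  qed
  also have "\<dots> = (\<Sum>us\<in>permutations_of_set T. \<Sum>vs\<in>permutations_of_set (A - T).
      (?m a S us * ?w S us) * (?m a (S \<union> T) vs * ?w (S \<union> T) vs))"
  proof (intro sum.cong refl)
    fix us vs assume us: "us \<in> permutations_of_set T" and vs: "vs \<in> permutations_of_set (A - T)"
    \<comment> \<open>That T is nonempty and proper provides the last entry l of T and the first
      entry h after it.\<close>
    from us assms have "us \<noteq> []" by (auto simp: permutations_of_set_def)
    then obtain us' l where us': "us = us' @ [l]" by (metis rev_exhaust)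
    from vs assms have "vs \<noteq> []" by (auto simp: permutations_of_set_def)
    then obtain h vs' where vs': "vs = h # vs'" by (cases vs) auto
    have T: "set us = T" using us by (simp add: permutations_of_set_def)
    have "l \<noteq> h" using us vs us' vs' by (auto simp: permutations_of_set_def)
    then have lh: "fvar l \<noteq> fvar h" using inj_fvar by (auto dest: injD)
    have "distinct (us' @ [l] @ h # vs')" "S \<inter> set (us' @ [l] @ h # vs') = {}"
      "S \<union> T = S \<union> set (us' @ [l])"
      using us vs assms(2,3) us' vs' by (auto simp: permutations_of_set_def)
    from flag_exponent_decrease_append[OF this, of a]
    have "flag_exponent ?a S (us @ vs) + Poly_Mapping.single (Var l) 1 =
        flag_exponent a S (us @ vs) + Poly_Mapping.single (Var h) 1"
      by (simp add: us' vs')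
    then have "?m ?a S (us @ vs) * fvar l = ?m a S (us @ vs) * fvar h"
      by (simp add: lvar_eq_lmon lmon_add[symmetric] to_frac_mult[symmetric])
    then have "?m a S (us @ vs) - ?m ?a S (us @ vs) = ?m a S (us @ vs) * ((fvar l - fvar h) / fvar l)"
      using fvar_nonzero[of l] by (simp add: field_simps)
    moreover have "?m a S (us @ vs) = ?m a S us * ?m a (S \<union> T) vs"
      using T by (simp add: flag_exponent_append lmon_add to_frac_mult)
    moreover have "?w S (us @ vs) = fvar l / (fvar l - fvar h) * (?w S us * ?w (S \<union> T) vs)"
    proof -
      have "braid_weight fvar (us @ vs) = fvar l / (fvar l - fvar h) * (braid_weight fvar us * braid_weight fvar vs)"
        using braid_weight_append[of fvar l us' h vs'] fvar_nonzero[of l] by (simp add: us' vs')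
      moreover have "nonbasis_weight fvar r S (us @ vs) = nonbasis_weight fvar r S us * nonbasis_weight fvar r (S \<union> T) vs"
        unfolding nonbasis_weight_append T ..
      ultimately show ?thesis by (simp only: mult_ac)
    qed
    ultimately show "(?m a S (us @ vs) - ?m ?a S (us @ vs)) * ?w S (us @ vs) =
        (?m a S us * ?w S us) * (?m a (S \<union> T) vs * ?w (S \<union> T) vs)"
      using lh fvar_nonzero[of l] by simp
  qed
  also have "\<dots> = flag_sum r a S T * flag_sum r a (S \<union> T) (A - T)"
    unfolding flag_sum_def sum_product ..
  finally show ?thesis by (simp add: algebra_simps)
qed

text \<open>For affine a all orderings give the same monomial, which factors out and leaves the sum
  evaluated by \<open>sum_weights\<close>.\<close>

lemma flag_sum_linear:
  assumes "rank_fun G r" "S \<union> A \<subseteq> G" "S \<inter> A = {}"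
    and "\<And>U. S \<subseteq> U \<Longrightarrow> U \<subseteq> S \<union> A \<Longrightarrow> a U = c + (\<Sum>j\<in>U. k j)"
  shows "flag_sum r a S A = to_frac (lmon (\<Sum>j\<in>A. Poly_Mapping.single (Var j) (k j))) *
    (\<Prod>y\<in>A. nonbasis_factor fvar r S y)"
proof -
  have "finite S" using assms by (auto simp: rank_fun_def intro: finite_subset)
  then have "flag_exponent a S zs = (\<Sum>j\<in>A. Poly_Mapping.single (Var j) (k j))"
    if "zs \<in> permutations_of_set A" for zs
    using that assms flag_exponent_linear[of S zs a c k] by (auto simp: permutations_of_set_def)
  then have "flag_sum r a S A = to_frac (lmon (\<Sum>j\<in>A. Poly_Mapping.single (Var j) (k j))) *
     (\<Sum>zs\<in>permutations_of_set A. braid_weight fvar zs * nonbasis_weight fvar r S zs)"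
    by (simp add: flag_sum_def sum_distrib_left)
  then show ?thesis
    using sum_weights[OF assms(1) inj_fvar fvar_nonzero assms(2)] by simp
qed

text \<open>Invariance under lowering one value by 1 can be read in both directions, so each of the
  finitely many values can be moved to any integer.\<close>

lemma eq_if_agree_outside_finite:
  fixes D :: "('b \<Rightarrow> int) \<Rightarrow> 'c"
  assumes "finite \<U>" and step: "\<And>a U. U \<in> \<U> \<Longrightarrow> D (a(U := a U - 1)) = D a"
    and "\<And>U. U \<notin> \<U> \<Longrightarrow> a U = a' U"
  shows "D a = D a'"
  using assms
proof (induction \<U> arbitrary: a)
  case empty
  then have "a = a'" by auto
  then show ?case by simp
next
  case (insert U \<U>)
  have *: "D (a(U := j)) = D (a(U := j - 1))" for a j
  proof -
    have "D ((a(U := j))(U := (a(U := j)) U - 1)) = D (a(U := j))"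
      by (rule insert.prems(1)) simp
    then show ?thesis by (simp only: fun_upd_same fun_upd_upd)
  qed
  have "D (a(U := j)) = D a" for j
  proof (induction j rule: int_induct[where k = "a U"])
    case base
    then show ?case by simp
  next
    case (step1 i)
    then show ?case unfolding *[of a "i + 1"] by (simp only: add_diff_cancel_right')
  next
    case (step2 i)
    show ?case using step2(2) unfolding *[of a i] .
  qed
  moreover have "D (a(U := a' U)) = D a'"
    by (rule insert.IH) (use insert.prems in auto)
  ultimately show ?case by simp
qed

text \<open>Interpolates \<open>a\<close> linearly between its values at \<open>S\<close> and at \<open>S \<union> A\<close>.\<close>

lemma flag_sum_reduce_linear:
  fixes P :: "('a set \<Rightarrow> int) \<Rightarrow> 'c"
  assumes "rank_fun G r" "S \<union> A \<subseteq> G" "S \<inter> A = {}" "A \<noteq> {}"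
    and step: "\<And>a T. T \<subseteq> A \<Longrightarrow> T \<noteq> {} \<Longrightarrow> T \<noteq> A \<Longrightarrow> P (a(S \<union> T := a (S \<union> T) - 1)) = P a"
  obtains a' c k where "P a = P a'" "\<And>U. S \<subseteq> U \<Longrightarrow> U \<subseteq> S \<union> A \<Longrightarrow> a' U = c + (\<Sum>j\<in>U. k j)"
proof -
  from assms(4) obtain i where i: "i \<in> A" by auto
  have fin: "finite A" "finite S" using assms(1,2) by (auto simp: rank_fun_def intro: finite_subset)
  define \<U> where "\<U> = (\<lambda>T. S \<union> T) ` {T. T \<subseteq> A \<and> T \<noteq> {} \<and> T \<noteq> A}"
  \<comment> \<open>The whole increment from S to the union of S and A is placed on the single
    element i; since i is outside S, both end values are kept.\<close>
  define k where "k = (\<lambda>j. if j = i then a (S \<union> A) - a S else 0)"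
  define a' where "a' = (\<lambda>U. if U \<in> \<U> then a S + (\<Sum>j\<in>U. k j) else a U)"
  have "P a = P a'"
  proof (rule eq_if_agree_outside_finite)
    show "finite \<U>" using fin by (simp add: \<U>_def)
    show "P (a(U := a U - 1)) = P a" if "U \<in> \<U>" for a U
      using that step unfolding \<U>_def by blast
  qed (simp add: a'_def)
  moreover have "a' U = a S + (\<Sum>j\<in>U. k j)" if U: "S \<subseteq> U" "U \<subseteq> S \<union> A" for U
  proof -
    have "finite U" using U fin by (meson finite_Un finite_subset)
    then have s: "(\<Sum>j\<in>U. k j) = (if i \<in> U then a (S \<union> A) - a S else 0)"
      by (simp add: k_def)
    consider "U \<in> \<U>" | "U = S" | "U = S \<union> A"
    proof -
      have "U = S \<union> (U \<inter> A)" using U by auto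
      then show ?thesis using that unfolding \<U>_def by blast
    qed
    then show ?thesis
      using i assms(3) s by cases (auto simp: a'_def)
  qed
  ultimately show ?thesis using that by blast
qed

text \<open>Induction on card A. By the recursion, lowering a value changes the sum by a product of
  two sums over smaller sets, so being Laurent is insensitive to it; linear a are explicit.\<close>

lemma flag_sum_Laurent:
  assumes "rank_fun G r" "S \<union> A \<subseteq> G" "S \<inter> A = {}"
  shows "flag_sum r a S A \<in> to_frac ` Laur A"
  using assms(2,3)
proof (induction "card A" arbitrary: A S a rule: less_induct)
  case less
  have fin: "finite A" using less.prems assms(1) by (auto simp: rank_fun_def intro: finite_subset)
  have add: "y + z \<in> to_frac ` Laur B" if "y \<in> to_frac ` Laur B" "z \<in> to_frac ` Laur B" for y z and B :: "'a set"
    using that by (auto simp flip: to_frac_add intro: Laur_add)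
  have diff: "y - z \<in> to_frac ` Laur B" if "y \<in> to_frac ` Laur B" "z \<in> to_frac ` Laur B" for y z and B :: "'a set"
    using that by (auto simp flip: to_frac_diff intro: Laur_diff)
  have lin: "flag_sum r a S A \<in> to_frac ` Laur A"
    if "\<And>U. S \<subseteq> U \<Longrightarrow> U \<subseteq> S \<union> A \<Longrightarrow> a U = c + (\<Sum>j\<in>U. k j)" for a c k
  proof -
    have "lmon (\<Sum>j\<in>A. Poly_Mapping.single (Var j) (k j)) \<in> Laur A"
    proof (rule Laur_lmon)
      show "Poly_Mapping.keys (\<Sum>j\<in>A. Poly_Mapping.single (Var j) (k j)) \<subseteq> Var ` A"
        using keys_sum[of "\<lambda>j. Poly_Mapping.single (Var j) (k j)" A] by (auto split: if_splits)
    qed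
    moreover have "(\<Prod>y\<in>A. if r S < r (insert y S) then 1 else 1 - lvar y) \<in> Laur A"
      by (rule Laur_prod) (auto intro: Laur_diff Laur_lvar)
    moreover have "(\<Prod>y\<in>A. nonbasis_factor fvar r S y) =
        to_frac (\<Prod>y\<in>A. if r S < r (insert y S) then 1 else 1 - lvar y)"
      unfolding to_frac_prod by (intro prod.cong) (auto simp: nonbasis_factor_def to_frac_diff to_frac_one)
    ultimately show ?thesis
      using flag_sum_linear[OF assms(1) less.prems, of a c k] that
      by (auto simp flip: to_frac_mult intro!: imageI Laur_mult)
  qed
  show ?case
  proof (cases "A = {}")
    case True
    then show ?thesis by (intro lin[of a "a S - (\<Sum>j\<in>S. 0)" "\<lambda>_. 0"]) auto
  next
    case False
    \<comment> \<open>Membership itself is the invariant passed to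
      \<open>flag_sum_reduce_linear\<close>, with truth values as its codomain.\<close>
    have step: "(flag_sum r (a(S \<union> T := a (S \<union> T) - 1)) S A \<in> to_frac ` Laur A) =
       (flag_sum r a S A \<in> to_frac ` Laur A)" if T: "T \<subseteq> A" "T \<noteq> {}" "T \<noteq> A" for a T
    proof -
      have "card T < card A" "card (A - T) < card A"
        using T fin by (auto intro!: psubset_card_mono)
      then have "flag_sum r a S T \<in> to_frac ` Laur T" "flag_sum r a (S \<union> T) (A - T) \<in> to_frac ` Laur (A - T)"
        using less.prems T by (auto intro!: less.hyps)
      then have "flag_sum r a S T * flag_sum r a (S \<union> T) (A - T) \<in> to_frac ` Laur A"
        using T Laur_mono[of _ T A] Laur_mono[of _ "A - T" A]
        by (auto simp flip: to_frac_mult intro!: imageI Laur_mult)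
      then show ?thesis
        using flag_sum_decrease[OF fin less.prems(2) T, of r a]
          add[of "flag_sum r (a(S \<union> T := a (S \<union> T) - 1)) S A" A] diff[of "flag_sum r a S A" A]
        by (metis add_diff_cancel_right')
    qed
    obtain a' c k where
      "(flag_sum r a S A \<in> to_frac ` Laur A) = (flag_sum r a' S A \<in> to_frac ` Laur A)"
      "\<And>U. S \<subseteq> U \<Longrightarrow> U \<subseteq> S \<union> A \<Longrightarrow> a' U = c + (\<Sum>j\<in>U. k j)"
      by (rule flag_sum_reduce_linear[OF assms(1) less.prems False,
           where P = "\<lambda>a. flag_sum r a S A \<in> to_frac ` Laur A" and a = a])
        (use step in blast)+
    then show ?thesis using lin by blast
  qed
qed

section \<open>Values at x = 1\<close>

definition frac_value :: "'a laurent fract \<Rightarrow> real" where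
  "frac_value z = leval (\<lambda>_. 1) (THE q. to_frac q = z)"

lemma frac_value_to_frac: "frac_value (to_frac q) = leval (\<lambda>_. 1) q"
  by (simp add: frac_value_def to_frac_eq_iff)

definition flag_value :: "('a set \<Rightarrow> nat) \<Rightarrow> ('a set \<Rightarrow> int) \<Rightarrow> 'a set \<Rightarrow> 'a set \<Rightarrow> real" where
  "flag_value r a S A = frac_value (flag_sum r a S A)"

text \<open>Evaluation is additive and multiplicative only on the image of \<open>to_frac\<close>,
  so all sums involved must be known to be Laurent polynomials.\<close>

lemma flag_value_decrease:
  assumes "rank_fun G r" "S \<union> A \<subseteq> G" "S \<inter> A = {}" "T \<subseteq> A" "T \<noteq> {}" "T \<noteq> A"
  shows "flag_value r a S A = flag_value r (a(S \<union> T := a (S \<union> T) - 1)) S A +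
    flag_value r a S T * flag_value r a (S \<union> T) (A - T)"
proof -
  have fin: "finite A" using assms by (auto simp: rank_fun_def intro: finite_subset)
  obtain q1 q2 q3 where q: "flag_sum r (a(S \<union> T := a (S \<union> T) - 1)) S A = to_frac q1"
    "flag_sum r a S T = to_frac q2" "flag_sum r a (S \<union> T) (A - T) = to_frac q3"
    using flag_sum_Laurent[OF assms(1,2,3), of "a(S \<union> T := a (S \<union> T) - 1)"]
      flag_sum_Laurent[OF assms(1), of S T a] flag_sum_Laurent[OF assms(1), of "S \<union> T" "A - T" a] assms
    by (auto simp: image_iff) blast
  show ?thesis
    unfolding flag_value_def flag_sum_decrease[OF fin assms(3-6), of r a] q
    by (simp add: frac_value_to_frac leval_add leval_mult flip: to_frac_add to_frac_mult)
qed

text \<open>At x = 1 the monomial becomes 1 and every factor 1 - x_y becomes 0.\<close>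

lemma flag_value_linear:
  assumes "rank_fun G r" "S \<union> A \<subseteq> G" "S \<inter> A = {}"
    and "\<And>U. S \<subseteq> U \<Longrightarrow> U \<subseteq> S \<union> A \<Longrightarrow> a U = c + (\<Sum>j\<in>U. k j)"
  shows "flag_value r a S A = (if \<exists>y\<in>A. r (insert y S) = r S then 0 else 1)"
proof -
  let ?f = "\<lambda>y. if r S < r (insert y S) then 1 else 1 - lvar y :: 'a laurent"
  have fin: "finite A" using assms by (auto simp: rank_fun_def intro: finite_subset)
  have p: "leval (\<lambda>_. 1) (\<Prod>y\<in>A. ?f y) = (\<Prod>y\<in>A. leval (\<lambda>_. 1) (?f y))"
    by (induction A rule: infinite_finite_induct) (simp_all add: leval_mult)
  have "(\<Prod>y\<in>A. nonbasis_factor fvar r S y) = to_frac (\<Prod>y\<in>A. ?f y)"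
    unfolding to_frac_prod by (intro prod.cong) (auto simp: nonbasis_factor_def to_frac_diff to_frac_one)
  then have "flag_value r a S A = leval (\<lambda>_. 1) (lmon (\<Sum>j\<in>A. Poly_Mapping.single (Var j) (k j)) * (\<Prod>y\<in>A. ?f y))"
    using flag_sum_linear[OF assms] by (simp add: flag_value_def frac_value_to_frac flip: to_frac_mult)
  also have "\<dots> = (\<Prod>y\<in>A. if r S < r (insert y S) then 1 else 0)"
    unfolding leval_mult[of "\<lambda>_. 1", simplified] leval_lmon mon_eval_ones p
    by (simp, intro prod.cong) (auto simp: leval_diff leval_lvar)
  also have "\<dots> = (if \<exists>y\<in>A. r (insert y S) = r S then 0 else 1)"
  proof -
    have "r S < r (insert y S) \<longleftrightarrow> r (insert y S) \<noteq> r S" if "y \<in> A" for y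
      using rank_fun_mono[OF assms(1) subset_insertI[of S y]] assms(2) that by fastforce
    then show ?thesis using fin by (auto simp: prod_zero_iff)
  qed
  finally show ?thesis .
qed

text \<open>In the product term of the recursion, y lies in T and is a loop for the first factor, or
  it lies in A - T and, closure being monotone, is a loop for the second. By induction the product
  vanishes, and the linear case, where the factor of y is 0, remains.\<close>

lemma flag_value_loop:
  assumes "rank_fun G r" "S \<union> A \<subseteq> G" "S \<inter> A = {}" "y \<in> A" "r (insert y S) = r S"
  shows "flag_value r a S A = 0"
  using assms(2-)
proof (induction "card A" arbitrary: A S a rule: less_induct)
  case less
  have fin: "finite A" using less.prems assms(1) by (auto simp: rank_fun_def intro: finite_subset)
  have step: "flag_value r (a(S \<union> T := a (S \<union> T) - 1)) S A = flag_value r a S A"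
    if T: "T \<subseteq> A" "T \<noteq> {}" "T \<noteq> A" for a T
  proof -
    have c: "card T < card A" "card (A - T) < card A"
      using T fin by (auto intro!: psubset_card_mono)
    have "flag_value r a S T * flag_value r a (S \<union> T) (A - T) = 0"
    proof (cases "y \<in> T")
      case True
      then have "flag_value r a S T = 0"
        using less.prems T c by (intro less.hyps) auto
      then show ?thesis by simp
    next
      case False
      have "r (insert y (S \<union> T)) = r (S \<union> T)"
        by (rule rank_fun_closure_mono[OF assms(1), of S]) (use less.prems T in auto)
      then have "flag_value r a (S \<union> T) (A - T) = 0"
        using less.prems T c False by (intro less.hyps) auto
      then show ?thesis by simp
    qed
    then show ?thesis
      using flag_value_decrease[OF assms(1) less.prems(1,2) T, of a] by simp
  qed
  have "A \<noteq> {}" using less.prems by auto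
  obtain a' c k where
    "flag_value r a S A = flag_value r a' S A"
    "\<And>U. S \<subseteq> U \<Longrightarrow> U \<subseteq> S \<union> A \<Longrightarrow> a' U = c + (\<Sum>j\<in>U. k j)"
    by (rule flag_sum_reduce_linear[OF assms(1) less.prems(1,2) \<open>A \<noteq> {}\<close>,
         where P = "\<lambda>a. flag_value r a S A" and a = a])
      (use step in blast)+
  then show ?case
    using flag_value_linear[OF assms(1) less.prems(1,2), of a' c k] less.prems by auto
qed

text \<open>For T that is not a flat, some y outside T is a loop of the contraction by T, so
  lowering the value at T changes nothing. The empty set has its own hypothesis because the
  recursion only lowers values at nonempty sets.\<close>

lemma flag_value_nonflat:
  assumes "rank_fun A r"
    and "\<And>T. T \<subseteq> A \<Longrightarrow> T \<noteq> {} \<Longrightarrow> (\<And>y. y \<in> A - T \<Longrightarrow> r T < r (insert y T)) \<Longrightarrow> a T = a' T"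
    and "a {} = a' {}"
  shows "flag_value r a {} A = flag_value r a' {} A"
proof -
  define \<U> where "\<U> = {T. T \<subseteq> A \<and> T \<noteq> {} \<and> (\<exists>y\<in>A - T. r (insert y T) = r T)}"
  have fin: "finite A" using assms by (simp add: rank_fun_def)
  have "flag_value r a {} A = flag_value r (\<lambda>U. if U \<in> \<U> then a' U else a U) {} A"
  proof (rule eq_if_agree_outside_finite)
    show "finite \<U>" using fin by (simp add: \<U>_def)
    fix a T assume T: "T \<in> \<U>"
    then obtain y where y: "y \<in> A - T" "r (insert y T) = r T" by (auto simp: \<U>_def)
    then have "flag_value r a T (A - T) = 0"
      using T by (intro flag_value_loop[OF assms(1), of _ _ y]) (auto simp: \<U>_def)
    moreover have "T \<subseteq> A" "T \<noteq> {}" "T \<noteq> A"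
      using T y by (auto simp: \<U>_def)
    ultimately show "flag_value r (a(T := a T - 1)) {} A = flag_value r a {} A"
      using flag_value_decrease[OF assms(1), of "{}" A T a] by simp
  qed auto
  also have "\<dots> = flag_value r a' {} A"
  proof -
    have "(if U \<in> \<U> then a' U else a U) = a' U" if "U \<subseteq> A" for U
    proof (cases "U = {} \<or> U \<in> \<U>")
      case False
      have "a U = a' U"
      proof (rule assms(2))
        fix y assume y: "y \<in> A - U"
        then have "r (insert y U) \<noteq> r U" using False that by (auto simp: \<U>_def)
        then show "r U < r (insert y U)"
          using rank_fun_mono[OF assms(1) subset_insertI[of U y]] y that by fastforce
      qed (use that False in auto)
      then show ?thesis by simp
    qed (use assms(3) in auto)
    then show ?thesis
      unfolding flag_value_def by (intro arg_cong[where f = frac_value] flag_sum_cong) auto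
  qed
  finally show ?thesis .
qed

section \<open>The braid fan\<close>

text \<open>Bijections are handled as duplicate-free lists, which permits recursion along a flag.
  The shift by one is due to the domain starting at 1.\<close>

definition perm_fun :: "'a list \<Rightarrow> nat \<Rightarrow> 'a" where
  "perm_fun xs = (\<lambda>i\<in>{1..length xs}. xs ! (i - 1))"

lemma perm_fun_nth: "i < length xs \<Longrightarrow> perm_fun xs (Suc i) = xs ! i"
  by (simp add: perm_fun_def)

lemma perm_fun_image:
  assumes "k \<le> length xs"
  shows "perm_fun xs ` {1..k} = set (take k xs)"
proof -
  have "perm_fun xs ` {1..k} = (!) xs ` {..<k}"
  proof -
    have "{1..k} = Suc ` {..<k}" by (simp add: lessThan_atLeast0 image_Suc_atLeastLessThan atLeastLessThanSuc_atLeastAtMost)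
    then show ?thesis using assms by (auto simp: image_image perm_fun_nth intro!: image_cong)
  qed
  then show ?thesis using assms by (simp add: nth_image[symmetric] lessThan_atLeast0)
qed

lemma bijs_eq: "bijs E = perm_fun ` permutations_of_set E" if "finite E"
proof (intro subset_antisym subsetI)
  fix \<sigma> assume s: "\<sigma> \<in> bijs E"
  define xs where "xs = map \<sigma> [1..<Suc (card E)]"
  have "bij_betw \<sigma> {1..card E} E" using s by (simp add: bijs_def)
  then have "set xs = E" "distinct xs"
    by (simp_all add: xs_def bij_betw_def distinct_map atLeastLessThanSuc_atLeastAtMost del: upt_Suc)
  moreover have "\<sigma> = perm_fun xs"
  proof
    fix i
    show "\<sigma> i = perm_fun xs i"
      using s by (cases "i \<in> {1..card E}")
        (auto simp: bijs_def perm_fun_def xs_def PiE_def extensional_def nth_append simp del: upt_Suc)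
  qed
  ultimately show "\<sigma> \<in> perm_fun ` permutations_of_set E"
    by (auto simp: permutations_of_set_def)
next
  fix \<sigma> assume "\<sigma> \<in> perm_fun ` permutations_of_set E"
  then obtain xs where xs: "\<sigma> = perm_fun xs" "distinct xs" "set xs = E"
    by (auto simp: permutations_of_set_def)
  then have n: "length xs = card E" by (metis distinct_card)
  have "perm_fun xs ` {1..card E} = E"
    using perm_fun_image[of "card E" xs] n xs by simp
  then have "bij_betw (perm_fun xs) {1..card E} E"
    by (simp add: bij_betw_def eq_card_imp_inj_on)
  then show "\<sigma> \<in> bijs E"
    using xs n by (auto simp: bijs_def perm_fun_def bij_betw_def)
qed

lemma inj_on_perm_fun: "inj_on perm_fun (permutations_of_set E)"
proof (rule inj_onI)
  fix xs ys assume a: "xs \<in> permutations_of_set E" "ys \<in> permutations_of_set E" "perm_fun xs = perm_fun ys"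
  then have "length xs = length ys" by (simp add: length_finite_permutations_of_set)
  then show "xs = ys"
    using a(3) by (metis nth_equalityI perm_fun_nth)
qed

lemma sum_bijs:
  "finite E \<Longrightarrow> (\<Sum>\<sigma>\<in>bijs E. h \<sigma>) = (\<Sum>xs\<in>permutations_of_set E. h (perm_fun xs))"
  by (simp add: bijs_eq sum.reindex[OF inj_on_perm_fun])

definition cone :: "'a set \<Rightarrow> 'a list \<Rightarrow> ('a \<Rightarrow> real) set" where
  "cone E xs = {b \<in> RR E. sorted_wrt (\<lambda>p q. b q \<le> b p) xs}"

lemma braid_max_cone_perm_fun:
  assumes "xs \<in> permutations_of_set E"
  shows "braid_max_cone E (perm_fun xs) = cone E xs"
proof -
  have n: "card E = length xs" using assms by (simp add: length_finite_permutations_of_set)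
  have "(\<forall>i\<in>{1..<card E}. b (perm_fun xs (Suc i)) \<le> b (perm_fun xs i)) \<longleftrightarrow>
      sorted_wrt (\<lambda>p q. b q \<le> b p) xs" for b :: "'a \<Rightarrow> real"
  proof -
    have "sorted_wrt (\<lambda>p q. b q \<le> b p) xs \<longleftrightarrow> (\<forall>i. Suc i < length xs \<longrightarrow> b (xs ! Suc i) \<le> b (xs ! i))"
      by (rule sorted_wrt_iff_nth_Suc_transp) (auto simp: transp_def)
    also have "\<dots> \<longleftrightarrow> (\<forall>i. Suc i < length xs \<longrightarrow> b (perm_fun xs (Suc (Suc i))) \<le> b (perm_fun xs (Suc i)))"
      by (auto simp: perm_fun_nth)
    also have "\<dots> \<longleftrightarrow> (\<forall>i\<in>{1..<card E}. b (perm_fun xs (Suc i)) \<le> b (perm_fun xs i))"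
      unfolding n by (metis One_nat_def Suc_le_eq atLeastLessThan_iff gr0_conv_Suc zero_less_Suc)
    finally show ?thesis ..
  qed
  then show ?thesis by (auto simp: braid_max_cone_def cone_def)
qed

lemma cone_exists:
  assumes "finite E" "b \<in> RR E"
  obtains xs where "xs \<in> permutations_of_set E" "b \<in> cone E xs"
proof -
  obtain ys where ys: "set ys = E" "distinct ys" using assms(1) finite_distinct_list by blast
  define xs where "xs = sort_key (\<lambda>e. - b e) ys"
  have "sorted (map (\<lambda>e. - b e) xs)" by (simp add: xs_def)
  then have "sorted_wrt (\<lambda>p q. b q \<le> b p) xs" by (simp add: sorted_map)
  then show ?thesis
    using that[of xs] ys assms(2) by (auto simp: cone_def permutations_of_set_def xs_def)
qed

lemma sum_mult_evec:
  assumes "finite E" "T \<subseteq> E"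
  shows "(\<Sum>i\<in>E. k i * evec E T i) = (\<Sum>i\<in>T. k i)"
proof -
  have "(\<Sum>i\<in>E. k i * evec E T i) = (\<Sum>i\<in>E. if i \<in> T then k i else 0)"
    by (intro sum.cong) (auto simp: evec_def)
  also have "\<dots> = (\<Sum>i\<in>T. k i)"
    using assms by (simp add: sum.inter_restrict[symmetric] Int_absorb1)
  finally show ?thesis .
qed

lemma evec_RR: "evec E T \<in> RR E" and evec_ZZ: "evec E T \<in> ZZ E"
  by (auto simp: evec_def RR_def ZZ_def)

lemma evec_cone:
  assumes "us @ vs \<in> permutations_of_set E"
  shows "evec E (set us) \<in> cone E (us @ vs)"
proof -
  have "sorted_wrt (\<lambda>p q. evec E (set us) q \<le> evec E (set us) p) us"
    "sorted_wrt (\<lambda>p q. evec E (set us) q \<le> evec E (set us) p) vs"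
    using assms by (auto simp: evec_def permutations_of_set_def sorted_wrt_iff_nth_less disjoint_iff)
  moreover have "\<forall>p\<in>set us. \<forall>q\<in>set vs. evec E (set us) q \<le> evec E (set us) p"
    using assms by (auto simp: evec_def permutations_of_set_def)
  ultimately show ?thesis by (simp add: cone_def evec_RR sorted_wrt_append)
qed

lemma int_linear_eq:
  assumes "finite E"
  shows "int_linear E = range (\<lambda>k::'a \<Rightarrow> int. \<lambda>b\<in>RR E. \<Sum>i\<in>E. of_int (k i) * b i)"
proof (intro subset_antisym subsetI)
  fix m assume m: "m \<in> int_linear E"
  have ext: "m \<in> extensional (RR E)"
    and add: "\<And>a b. a \<in> RR E \<Longrightarrow> b \<in> RR E \<Longrightarrow> m (\<lambda>i\<in>E. a i + b i) = m a + m b"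
    and scale: "\<And>c b. b \<in> RR E \<Longrightarrow> m (\<lambda>i\<in>E. c * b i) = c * m b"
    using m by (auto simp: int_linear_def PiE_def)
  define k where "k = (\<lambda>i. \<lfloor>m (evec E {i})\<rfloor>)"
  have k: "of_int (k i) = m (evec E {i})" if "i \<in> E" for i
  proof -
    have "m (evec E {i}) \<in> \<int>" using m evec_ZZ[of E "{i}"] by (auto simp: int_linear_def)
    then show ?thesis by (simp add: k_def of_int_floor)
  qed
  have part: "m (\<lambda>i\<in>E. if i \<in> A then b i else 0) = (\<Sum>i\<in>A. of_int (k i) * b i)" if "A \<subseteq> E" for A b
    using finite_subset[OF that assms] that
  proof (induction A rule: finite_induct)
    case empty
    have *: "(\<lambda>i\<in>E. if i \<in> {} then b i else 0) = (\<lambda>i\<in>E. 0 * evec E {} i)" by auto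
    show ?case unfolding * scale[OF evec_RR] sum.empty by simp
  next
    case (insert j A)
    let ?u = "\<lambda>i\<in>E. if i \<in> A then b i else 0" and ?v = "\<lambda>i\<in>E. b j * evec E {j} i"
    have *: "(\<lambda>i\<in>E. if i \<in> insert j A then b i else 0) = (\<lambda>i\<in>E. ?u i + ?v i)"
      using insert by (auto simp: fun_eq_iff evec_def)
    have "?u \<in> RR E" "?v \<in> RR E" by (auto simp: RR_def)
    from add[OF this] have "m (\<lambda>i\<in>E. if i \<in> insert j A then b i else 0) = m ?u + m ?v"
      unfolding * .
    moreover have "m ?u = (\<Sum>i\<in>A. of_int (k i) * b i)"
      using insert by blast
    moreover have "m ?v = b j * m (evec E {j})" by (rule scale[OF evec_RR])
    ultimately show ?case
      using insert by (simp only: k sum.insert insert_subset) (simp add: k)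
  qed
  have "m = (\<lambda>b\<in>RR E. \<Sum>i\<in>E. of_int (k i) * b i)"
  proof
    fix b
    show "m b = (\<lambda>b\<in>RR E. \<Sum>i\<in>E. of_int (k i) * b i) b"
    proof (cases "b \<in> RR E")
      case True
      then have "(\<lambda>i\<in>E. if i \<in> E then b i else 0) = b"
        by (auto simp: RR_def PiE_def extensional_def)
      then show ?thesis using part[of E b] True by simp
    qed (use ext in \<open>simp add: extensional_def\<close>)
  qed
  then show "m \<in> range (\<lambda>k::'a \<Rightarrow> int. \<lambda>b\<in>RR E. \<Sum>i\<in>E. of_int (k i) * b i)" by blast
next
  fix m assume "m \<in> range (\<lambda>k::'a \<Rightarrow> int. \<lambda>b\<in>RR E. \<Sum>i\<in>E. of_int (k i) * b i)"
  then obtain k :: "'a \<Rightarrow> int" where k: "m = (\<lambda>b\<in>RR E. \<Sum>i\<in>E. of_int (k i) * b i)" by blast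
  have "(\<Sum>i\<in>E. of_int (k i) * b i) \<in> \<int>" if "b \<in> ZZ E" for b :: "'a \<Rightarrow> real"
    using that by (intro Ints_sum Ints_mult) (auto simp: ZZ_def)
  moreover have "(\<lambda>i\<in>E. c i) \<in> RR E" for c :: "'a \<Rightarrow> real" by (simp add: RR_def)
  moreover have "ZZ E \<subseteq> RR E" by (auto simp: ZZ_def RR_def)
  ultimately show "m \<in> int_linear E"
    unfolding int_linear_def k
    by (auto simp: sum.distrib[symmetric] sum_distrib_left algebra_simps)
qed

text \<open>Every cone of the fan is a face of a maximal one, so testing the maximal cones is
  enough.\<close>

lemma PLin_iff:
  assumes "finite E"
  shows "f \<in> PLin E \<longleftrightarrow> f \<in> extensional (RR E) \<and>
    (\<forall>xs\<in>permutations_of_set E. \<exists>k::'a \<Rightarrow> int. \<forall>b\<in>cone E xs. f b = (\<Sum>i\<in>E. of_int (k i) * b i))"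
proof -
  have RR: "C \<subseteq> RR E" if "C \<in> braid_fan E" for C
    using that by (auto simp: braid_fan_def braid_max_cone_def)
  have lin: "(\<exists>m\<in>int_linear E. \<forall>b\<in>C. f b = m b) \<longleftrightarrow>
      (\<exists>k::'a \<Rightarrow> int. \<forall>b\<in>C. f b = (\<Sum>i\<in>E. of_int (k i) * b i))" if "C \<subseteq> RR E" for C
    unfolding int_linear_eq[OF assms] using that by (auto simp: subset_iff)
  have "cone E xs \<in> braid_fan E" if "xs \<in> permutations_of_set E" for xs
    unfolding braid_fan_def using that assms
    by (auto simp: bijs_eq braid_max_cone_perm_fun[symmetric] intro!: exI[of _ "perm_fun xs"] exI[of _ "{}"])
  moreover have "\<exists>xs\<in>permutations_of_set E. C \<subseteq> cone E xs" if "C \<in> braid_fan E" for C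
    using that assms by (auto simp: braid_fan_def bijs_eq braid_max_cone_perm_fun)
  ultimately have "(\<forall>C\<in>braid_fan E. \<exists>k::'a \<Rightarrow> int. \<forall>b\<in>C. f b = (\<Sum>i\<in>E. of_int (k i) * b i)) \<longleftrightarrow>
    (\<forall>xs\<in>permutations_of_set E. \<exists>k::'a \<Rightarrow> int. \<forall>b\<in>cone E xs. f b = (\<Sum>i\<in>E. of_int (k i) * b i))"
    by (meson subsetD)
  moreover have "(\<forall>C\<in>braid_fan E. \<exists>m\<in>int_linear E. \<forall>b\<in>C. f b = m b) \<longleftrightarrow>
    (\<forall>C\<in>braid_fan E. \<exists>k::'a \<Rightarrow> int. \<forall>b\<in>C. f b = (\<Sum>i\<in>E. of_int (k i) * b i))"
    using lin RR by (intro ball_cong) auto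
  ultimately show ?thesis by (auto simp: PLin_def PiE_def)
qed

section \<open>Piecewise linear functions and their coefficients\<close>

text \<open>The linear function whose exponential is the monomial of
  \<open>flag_exponent\<close>.\<close>

fun flag_linear :: "('a set \<Rightarrow> int) \<Rightarrow> 'a set \<Rightarrow> 'a list \<Rightarrow> ('a \<Rightarrow> real) \<Rightarrow> real" where
  "flag_linear a S [] b = 0"
| "flag_linear a S (y # ys) b = of_int (a (insert y S) - a S) * b y + flag_linear a (insert y S) ys b"

lemma exp_flag_linear: "exp (flag_linear a S xs b) = mon_eval (\<lambda>i. exp (b i)) (flag_exponent a S xs)"
  by (induction xs arbitrary: S)
    (simp_all add: exp_add mon_eval_add mon_eval_single exp_power_int mult.commute)

lemma flag_linear_append:
  "flag_linear a S (us @ vs) b = flag_linear a S us b + flag_linear a (S \<union> set us) vs b"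
  by (induction us arbitrary: S) simp_all

lemma flag_linear_cong_prefix:
  assumes "\<And>us vs. zs = us @ vs \<Longrightarrow> a (S \<union> set us) = a' (S \<union> set us)"
  shows "flag_linear a S zs b = flag_linear a' S zs b"
  using assms
proof (induction zs arbitrary: S)
  case (Cons z zs)
  have "flag_linear a (insert z S) zs b = flag_linear a' (insert z S) zs b"
  proof (rule Cons.IH)
    fix us vs assume "zs = us @ vs"
    then show "a (insert z S \<union> set us) = a' (insert z S \<union> set us)"
      using Cons.prems[of "z # us" vs] by simp
  qed
  then show ?case
    using Cons.prems[of "[]" "z # zs"] Cons.prems[of "[z]" zs] by simp
qed simp

lemma flag_linear_zero [simp]: "flag_linear (\<lambda>_. 0) S zs b = 0"
  by (induction zs arbitrary: S) simp_all

lemma flag_linear_linear: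
  assumes "finite S" "distinct zs" "S \<inter> set zs = {}"
  shows "flag_linear (\<lambda>U. \<Sum>j\<in>U. k j) S zs b = (\<Sum>j\<in>set zs. of_int (k j) * b j)"
  using assms by (induction zs arbitrary: S) auto

lemma flag_linear_combination:
  "flag_linear (\<lambda>U. \<Sum>T\<in>\<T>. c T * a T U) S zs b = (\<Sum>T\<in>\<T>. of_int (c T) * flag_linear (a T) S zs b)"
proof (induction zs arbitrary: S)
  case (Cons z zs)
  have "of_int ((\<Sum>T\<in>\<T>. c T * a T (insert z S)) - (\<Sum>T\<in>\<T>. c T * a T S)) * b z =
      (\<Sum>T\<in>\<T>. of_int (c T) * (of_int (a T (insert z S) - a T S) * b z))"
    by (simp add: sum_subtractf[symmetric] sum_distrib_left algebra_simps)
  then show ?case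
    by (simp add: Cons sum.distrib[symmetric] distrib_left)
qed simp

lemma flag_linear_ex:
  assumes "distinct zs"
  shows "\<exists>k::'a \<Rightarrow> int. \<forall>b. flag_linear a S zs b = (\<Sum>i\<in>set zs. of_int (k i) * b i)"
  using assms
proof (induction zs arbitrary: S)
  case (Cons z zs)
  then obtain k :: "'a \<Rightarrow> int" where
    k: "\<And>b. flag_linear a (insert z S) zs b = (\<Sum>i\<in>set zs. of_int (k i) * b i)" by fastforce
  have "flag_linear a S (z # zs) b =
      (\<Sum>i\<in>set (z # zs). of_int ((k(z := a (insert z S) - a S)) i) * b i)" for b
  proof -
    have "(\<Sum>i\<in>set zs. of_int ((k(z := a (insert z S) - a S)) i) * b i) = (\<Sum>i\<in>set zs. of_int (k i) * b i)"
      using Cons.prems by (intro sum.cong) auto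
    then show ?thesis using Cons.prems k by simp
  qed
  then show ?case by blast
qed simp

lemma flag_linear_ones:
  "(\<And>i. i \<in> set us \<Longrightarrow> b i = 1) \<Longrightarrow> flag_linear a S us b = of_int (a (S \<union> set us) - a S)"
  by (induction us arbitrary: S) simp_all

lemma flag_linear_zeros: "(\<And>i. i \<in> set us \<Longrightarrow> b i = 0) \<Longrightarrow> flag_linear a S us b = 0"
  by (induction us arbitrary: S) simp_all

lemma flag_linear_evec:
  assumes "us @ vs \<in> permutations_of_set E"
  shows "flag_linear a {} (us @ vs) (evec E (set us)) = of_int (a (set us) - a {})"
proof -
  have "flag_linear a {} us (evec E (set us)) = of_int (a ({} \<union> set us) - a {})"
    using assms by (intro flag_linear_ones) (auto simp: evec_def permutations_of_set_def)
  moreover have "flag_linear a ({} \<union> set us) vs (evec E (set us)) = 0"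
    using assms by (intro flag_linear_zeros) (auto simp: evec_def permutations_of_set_def)
  ultimately show ?thesis by (simp add: flag_linear_append)
qed

text \<open>On the cone, f has some coefficient vector k, and its values at the indicator vectors of
  prefixes are the partial sums of k. Flag forms see only these partial sums, so k can be replaced
  by a.\<close>

lemma PLin_flag_linear:
  assumes "finite E" "f \<in> PLin E" "a {} = 0"
    and "\<And>T. T \<in> nonempty_subsets E \<Longrightarrow> f (evec E T) = of_int (a T)"
    and xs: "xs \<in> permutations_of_set E" and "b \<in> cone E xs"
  shows "f b = flag_linear a {} xs b"
proof -
  obtain k :: "'a \<Rightarrow> int" where k: "\<And>b. b \<in> cone E xs \<Longrightarrow> f b = (\<Sum>i\<in>E. of_int (k i) * b i)"
    using assms(2) xs by (auto simp: PLin_iff[OF assms(1)])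
  have "of_int (\<Sum>i\<in>set us. k i) = (of_int (a (set us)) :: real)" if e: "xs = us @ vs" for us vs
  proof (cases "us = []")
    case False
    have u: "set us \<in> nonempty_subsets E"
      using False e xs by (auto simp: nonempty_subsets_def permutations_of_set_def)
    then show ?thesis
      using k[of "evec E (set us)"] evec_cone[of us vs E] assms(4)[OF u] e xs
        sum_mult_evec[OF assms(1), of "set us" "\<lambda>i. of_int (k i)"] by (simp add: nonempty_subsets_def)
  qed (use assms(3) in simp)
  then have "flag_linear a {} xs b = flag_linear (\<lambda>U. \<Sum>i\<in>U. k i) {} xs b"
    by (intro flag_linear_cong_prefix) (metis of_int_eq_iff Un_empty_left)
  also have "\<dots> = f b"
    using xs k[OF assms(6)] by (subst flag_linear_linear) (auto simp: permutations_of_set_def)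
  finally show ?thesis ..
qed

lemma prefix_exists:
  assumes "finite E" "T \<subseteq> E"
  obtains us vs where "us @ vs \<in> permutations_of_set E" "set us = T"
proof -
  obtain us vs where "set us = T" "distinct us" "set vs = E - T" "distinct vs"
    using assms finite_distinct_list[of T] finite_distinct_list[of "E - T"] finite_subset by blast
  then show ?thesis using that[of us vs] assms by (auto simp: permutations_of_set_def)
qed

lemma PLin_evec_int:
  assumes "finite E" "f \<in> PLin E" "T \<subseteq> E"
  shows "f (evec E T) \<in> \<int>"
proof -
  obtain us vs where uv: "us @ vs \<in> permutations_of_set E" "set us = T"
    using prefix_exists[OF assms(1,3)] .
  obtain k :: "'a \<Rightarrow> int" where k: "\<And>b. b \<in> cone E (us @ vs) \<Longrightarrow> f b = (\<Sum>i\<in>E. of_int (k i) * b i)"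
    using assms(2) uv by (auto simp: PLin_iff[OF assms(1)])
  show ?thesis
    using k[OF evec_cone[OF uv(1)]] sum_mult_evec[OF assms(1,3), of "\<lambda>i. of_int (k i)"] uv(2)
    by (simp flip: of_int_sum)
qed

lemma PLin_eqI:
  assumes "finite E" "f \<in> PLin E" "g \<in> PLin E"
    and "\<And>T. T \<in> nonempty_subsets E \<Longrightarrow> f (evec E T) = g (evec E T)"
  shows "f = g"
proof (rule extensionalityI)
  show "f \<in> extensional (RR E)" "g \<in> extensional (RR E)"
    using assms by (simp_all add: PLin_iff)
  fix b assume "b \<in> RR E"
  then obtain xs where xs: "xs \<in> permutations_of_set E" "b \<in> cone E xs"
    using cone_exists[OF assms(1)] by blast
  define a where "a = (\<lambda>T. if T = {} then 0 else \<lfloor>f (evec E T)\<rfloor>)"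
  have a: "f (evec E T) = of_int (a T)" if "T \<in> nonempty_subsets E" for T
    using that PLin_evec_int[OF assms(1,2), of T] by (simp add: a_def nonempty_subsets_def of_int_floor)
  have "a {} = 0" by (simp add: a_def)
  then show "f b = g b"
    using PLin_flag_linear[OF assms(1,2) _ a xs] PLin_flag_linear[OF assms(1,3) _ _ xs, of a] a assms(4) by metis
qed

text \<open>A closed formula for delta_T: the coefficient of e_T when b is written through the
  indicators of its superlevel sets is the gap between the least entry on T and the greatest one off
  T, if positive. The ground set is separate: it has no complement, and its coefficient may be
  negative.\<close>

definition bdelta :: "'a set \<Rightarrow> 'a set \<Rightarrow> ('a \<Rightarrow> real) \<Rightarrow> real" where
  "bdelta E T b = (if T = E then Min (b ` E) else max 0 (Min (b ` T) - Max (b ` (E - T))))"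

lemma bdelta_nonneg: "T \<noteq> E \<Longrightarrow> bdelta E T b \<ge> 0"
  by (simp add: bdelta_def)

text \<open>If T is the initial segment ending in l and h follows, the gap is b l - b h, matching
  the increments 1 at l and -1 at h of the flag form.\<close>

lemma bdelta_prefix:
  assumes "finite E" "us @ vs \<in> permutations_of_set E" "b \<in> cone E (us @ vs)" "set us = T" "T \<noteq> {}"
  shows "bdelta E T b = flag_linear (\<lambda>U. if U = T then 1 else 0) {} (us @ vs) b"
proof -
  from assms have "us \<noteq> []" by auto
  then obtain us' l where us: "us = us' @ [l]" by (metis rev_exhaust)
  have d: "distinct (us @ vs)" "set us \<union> set vs = E" using assms by (auto simp: permutations_of_set_def)
  have s: "sorted_wrt (\<lambda>p q. b q \<le> b p) (us @ vs)" using assms by (simp add: cone_def)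
  have Min: "Min (b ` T) = b l"
    using s us assms(4) by (intro Min_eqI) (auto simp: sorted_wrt_append)
  have us_val: "flag_linear (\<lambda>U. if U = T then 1 else 0) {} us b = b l"
  proof -
    have "l \<notin> set us'" using d us by auto
    have "flag_linear (\<lambda>U. if U = T then 1 else 0) {} us' b = flag_linear (\<lambda>_. 0) {} us' b"
      using \<open>l \<notin> set us'\<close> assms(4) us by (intro flag_linear_cong_prefix) auto
    moreover have "set us' \<noteq> T" "insert l (set us') = T" using \<open>l \<notin> set us'\<close> assms(4) us by auto
    ultimately show ?thesis using us by (simp add: flag_linear_append)
  qed
  show ?thesis
  proof (cases vs)
    case Nil
    then have "T = E" using d assms(4) by auto
    then show ?thesis using Nil us_val Min by (simp add: bdelta_def)
  next
    case (Cons h vs')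
    have "h \<notin> T" "h \<in> E" using d Cons assms(4) by auto
    have "E - T = set vs" using d assms(4) by auto
    then have "Max (b ` (E - T)) = b h"
      using s Cons by (intro Max_eqI) (auto simp: sorted_wrt_append)
    moreover have "b h \<le> b l" using s Cons us by (auto simp: sorted_wrt_append)
    moreover have "flag_linear (\<lambda>U. if U = T then 1 else 0) (insert h T) vs' b = flag_linear (\<lambda>_. 0) (insert h T) vs' b"
      using \<open>h \<notin> T\<close> by (intro flag_linear_cong_prefix) auto
    moreover have "insert h T \<noteq> T" using \<open>h \<notin> T\<close> by auto
    moreover have "T \<noteq> E" using \<open>h \<notin> T\<close> \<open>h \<in> E\<close> by auto
    ultimately show ?thesis
      using Cons us_val Min assms(4) by (simp add: bdelta_def flag_linear_append)
  qed
qed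

lemma bdelta_not_prefix:
  assumes "finite E" "xs \<in> permutations_of_set E" "b \<in> cone E xs" "T \<subseteq> E"
    and no: "\<nexists>us vs. xs = us @ vs \<and> set us = T"
  shows "bdelta E T b = 0"
proof -
  \<comment> \<open>The ordering leaves T at j before T is exhausted, so some i in T comes after j.
    Then b i is at most b j, and the gap of T is not positive.\<close>
  define us where "us = takeWhile (\<lambda>x. x \<in> T) xs"
  define vs where "vs = dropWhile (\<lambda>x. x \<in> T) xs"
  have xs: "xs = us @ vs" by (simp add: us_def vs_def)
  have usT: "set us \<subseteq> T" by (auto simp: us_def dest: set_takeWhileD)
  have E: "set xs = E" using assms(2) by (simp add: permutations_of_set_def)
  have "vs \<noteq> []"
  proof
    assume "vs = []"
    then have "set us = T" using xs E usT assms(4) by auto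
    with no xs show False by blast
  qed
  then obtain j vs' where j: "vs = j # vs'" by (cases vs) auto
  have "j \<notin> T" using hd_dropWhile[of "\<lambda>x. x \<in> T" xs] j unfolding vs_def by (metis list.distinct(1) list.sel(1))
  have "set us \<noteq> T" using no xs by blast
  then obtain i where i: "i \<in> T" "i \<notin> set us" using usT by blast
  then have "i \<in> set vs'" using xs j E assms(4) \<open>j \<notin> T\<close> by auto
  then have ij: "b i \<le> b j" using assms(3) xs j by (auto simp: cone_def sorted_wrt_append)
  have "j \<in> E" using xs j E by auto
  have "Min (b ` T) \<le> b i" "b j \<le> Max (b ` (E - T))"
    using assms(1,4) i(1) \<open>j \<in> E\<close> \<open>j \<notin> T\<close> finite_subset by (auto intro!: Min_le Max_ge)
  moreover have "T \<noteq> E" using \<open>j \<in> E\<close> \<open>j \<notin> T\<close> by auto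
  ultimately show ?thesis using ij by (simp add: bdelta_def)
qed

lemma bdelta_cone:
  assumes "finite E" "xs \<in> permutations_of_set E" "b \<in> cone E xs" "T \<in> nonempty_subsets E"
  shows "bdelta E T b = flag_linear (\<lambda>U. if U = T then 1 else 0) {} xs b"
proof (cases "\<exists>us vs. xs = us @ vs \<and> set us = T")
  case True
  then obtain us vs where xs: "xs = us @ vs" "set us = T" by blast
  have "T \<noteq> {}" using assms(4) by (simp add: nonempty_subsets_def)
  then show ?thesis using bdelta_prefix[OF assms(1) _ _ xs(2), of vs b] assms(2,3) xs(1) by simp
next
  case False
  have "flag_linear (\<lambda>U. if U = T then 1 else 0) {} xs b = flag_linear (\<lambda>_. 0) {} xs b"
    using False by (intro flag_linear_cong_prefix) auto
  then show ?thesis using bdelta_not_prefix[OF assms(1-3) _ False] assms(4) by (simp add: nonempty_subsets_def)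
qed

section \<open>Coordinates with respect to the functions delta_T\<close>

lemma finite_nonempty_subsets: "finite E \<Longrightarrow> finite (nonempty_subsets E)"
  by (simp add: nonempty_subsets_def)

text \<open>The flag starts at the empty set, for which there is no delta; its value has to be 0.
  This is the source of the recurring update \<open>a({} := 0)\<close>.\<close>

lemma sum_bdelta_cone:
  assumes "finite E" "xs \<in> permutations_of_set E" "b \<in> cone E xs"
  shows "(\<Sum>T\<in>nonempty_subsets E. of_int (a T) * bdelta E T b) = flag_linear (a({} := 0)) {} xs b"
proof -
  have "(\<Sum>T\<in>nonempty_subsets E. of_int (a T) * bdelta E T b) =
     flag_linear (\<lambda>U. \<Sum>T\<in>nonempty_subsets E. a T * (if U = T then 1 else 0)) {} xs b"
    using assms by (simp add: flag_linear_combination bdelta_cone)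
  also have "\<dots> = flag_linear (a({} := 0)) {} xs b"
  proof (rule flag_linear_cong_prefix)
    fix us vs assume "xs = us @ vs"
    then have "set us \<subseteq> E" using assms(2) by (auto simp: permutations_of_set_def)
    moreover have "(\<Sum>T\<in>nonempty_subsets E. a T * (if set us = T then 1 else 0)) =
        (if set us \<in> nonempty_subsets E then a (set us) else 0)"
      using finite_nonempty_subsets[OF assms(1)] by (simp add: mult.commute if_distrib[of "(*) _"] cong: if_cong)
    ultimately show "(\<Sum>T\<in>nonempty_subsets E. a T * (if {} \<union> set us = T then 1 else 0)) =
        (a({} := 0)) ({} \<union> set us)"
      by (auto simp: nonempty_subsets_def)
  qed
  finally show ?thesis .
qed

lemma sum_bdelta_PLin:
  assumes "finite E"
  shows "(\<lambda>b\<in>RR E. \<Sum>T\<in>nonempty_subsets E. of_int (a T) * bdelta E T b) \<in> PLin E"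
  unfolding PLin_iff[OF assms]
proof (intro conjI ballI)
  fix xs assume xs: "xs \<in> permutations_of_set E"
  then have "distinct xs" "set xs = E" by (auto simp: permutations_of_set_def)
  then obtain k :: "'a \<Rightarrow> int" where "\<And>b. flag_linear (a({} := 0)) {} xs b = (\<Sum>i\<in>E. of_int (k i) * b i)"
    using flag_linear_ex[of xs "a({} := 0)" "{}"] by auto
  moreover have "b \<in> RR E" if "b \<in> cone E xs" for b using that by (simp add: cone_def)
  ultimately show "\<exists>k::'a \<Rightarrow> int. \<forall>b\<in>cone E xs.
      (\<lambda>b\<in>RR E. \<Sum>T\<in>nonempty_subsets E. of_int (a T) * bdelta E T b) b = (\<Sum>i\<in>E. of_int (k i) * b i)"
    using sum_bdelta_cone[OF assms xs] by (intro exI[of _ k]) auto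
qed simp

lemma sum_bdelta_evec:
  assumes "finite E" "S \<in> nonempty_subsets E"
  shows "(\<Sum>T\<in>nonempty_subsets E. of_int (a T) * bdelta E T (evec E S)) = of_int (a S)"
proof -
  obtain us vs where uv: "us @ vs \<in> permutations_of_set E" "set us = S"
    using prefix_exists[OF assms(1), of S] assms(2) by (auto simp: nonempty_subsets_def)
  show ?thesis
    using sum_bdelta_cone[OF assms(1) uv(1) evec_cone[OF uv(1)], of a] flag_linear_evec[OF uv(1), of "a({} := 0)"]
      uv(2) assms(2) by (simp add: nonempty_subsets_def)
qed

lemma pdelta_eq:
  assumes "finite E" "T \<in> nonempty_subsets E"
  shows "pdelta E T = restrict (bdelta E T) (RR E)"
proof -
  let ?a = "\<lambda>U. if U = T then 1 else 0 :: int"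
  let ?d = "\<lambda>b\<in>RR E. \<Sum>U\<in>nonempty_subsets E. of_int (?a U) * bdelta E U b"
  have d: "?d = restrict (bdelta E T) (RR E)"
  proof -
    have "of_int (?a U) * bdelta E U b = (if U = T then bdelta E T b else 0)" for U b by simp
    then show ?thesis
      using finite_nonempty_subsets[OF assms(1)] assms(2) by (simp add: fun_eq_iff del: of_int_eq_iff)
  qed
  have ev: "?d (evec E S) = of_int (?a S)" if "S \<in> nonempty_subsets E" for S
    using sum_bdelta_evec[OF assms(1) that, of ?a] by (simp add: evec_RR)
  show ?thesis
    unfolding pdelta_def d[symmetric]
  proof (rule the_equality)
    show "?d \<in> PLin E \<and> ?d (evec E T) = 1 \<and> (\<forall>S\<in>nonempty_subsets E. S \<noteq> T \<longrightarrow> ?d (evec E S) = 0)"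
      using sum_bdelta_PLin[OF assms(1), of ?a] ev assms(2) by auto
    fix e assume e: "e \<in> PLin E \<and> e (evec E T) = 1 \<and> (\<forall>S\<in>nonempty_subsets E. S \<noteq> T \<longrightarrow> e (evec E S) = 0)"
    show "e = ?d"
    proof (rule PLin_eqI[OF assms(1)])
      fix S assume S: "S \<in> nonempty_subsets E"
      show "e (evec E S) = ?d (evec E S)" unfolding ev[OF S] using e S by (cases "S = T") auto
    qed (use e sum_bdelta_PLin[OF assms(1), of ?a] in auto)
  qed
qed

lemma plin_of_coeffs_eq:
  assumes "finite E"
  shows "plin_of_coeffs E a = (\<lambda>b\<in>RR E. \<Sum>T\<in>nonempty_subsets E. of_int (a T) * bdelta E T b)"
  unfolding plin_of_coeffs_def by (intro restrict_ext sum.cong) (auto simp: pdelta_eq[OF assms])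

lemma plin_of_coeffs_cone:
  assumes "finite E" "xs \<in> permutations_of_set E" "b \<in> cone E xs"
  shows "plin_of_coeffs E a b = flag_linear (a({} := 0)) {} xs b"
  using sum_bdelta_cone[OF assms] assms(3) by (simp add: plin_of_coeffs_eq[OF assms(1)] cone_def)

lemma plin_of_coeffs_PLin: "finite E \<Longrightarrow> plin_of_coeffs E a \<in> PLin E"
  using sum_bdelta_PLin plin_of_coeffs_eq by metis

lemma plin_of_coeffs_evec:
  "finite E \<Longrightarrow> S \<in> nonempty_subsets E \<Longrightarrow> plin_of_coeffs E a (evec E S) = of_int (a S)"
  using sum_bdelta_evec[of E S a] by (simp add: plin_of_coeffs_eq evec_RR)

lemma plin_of_plin_coeffs:
  assumes "finite E" "f \<in> PLin E"
  shows "plin_of_coeffs E (plin_coeffs E f) = f"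
proof -
  define a where "a = (\<lambda>T\<in>nonempty_subsets E. \<lfloor>f (evec E T)\<rfloor>)"
  have "f = plin_of_coeffs E a"
  proof (rule PLin_eqI[OF assms plin_of_coeffs_PLin[OF assms(1)]])
    fix T assume "T \<in> nonempty_subsets E"
    then show "f (evec E T) = plin_of_coeffs E a (evec E T)"
      using PLin_evec_int[OF assms, of T]
      by (simp add: plin_of_coeffs_evec[OF assms(1)] a_def nonempty_subsets_def of_int_floor)
  qed
  moreover have "a \<in> nonempty_subsets E \<rightarrow>\<^sub>E UNIV" by (simp add: a_def)
  moreover have "a' = a" if "a' \<in> nonempty_subsets E \<rightarrow>\<^sub>E UNIV" "f = plin_of_coeffs E a'" for a'
  proof (rule extensionalityI[of _ "nonempty_subsets E"])
    fix T assume "T \<in> nonempty_subsets E"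
    then show "a' T = a T"
      using plin_of_coeffs_evec[OF assms(1)] that(2) \<open>f = plin_of_coeffs E a\<close> by (metis of_int_eq_iff)
  qed (use that in \<open>auto simp: a_def PiE_def\<close>)
  ultimately have "plin_coeffs E f = a"
    unfolding plin_coeffs_def by (intro the_equality) auto
  then show ?thesis using \<open>f = plin_of_coeffs E a\<close> by simp
qed

lemma plin_diff_pdelta:
  assumes "finite E" "F \<in> nonempty_subsets E"
  shows "plin_diff E (plin_of_coeffs E a) (pdelta E F) = plin_of_coeffs E (a(F := a F - 1))"
proof -
  have "(\<Sum>T\<in>nonempty_subsets E. of_int (a T) * bdelta E T b) - bdelta E F b =
      (\<Sum>T\<in>nonempty_subsets E. of_int ((a(F := a F - 1)) T) * bdelta E T b)" for b
  proof -
    note r = sum.remove[OF finite_nonempty_subsets[OF assms(1)] assms(2)]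
    show ?thesis
      unfolding r[of "\<lambda>T. of_int (a T) * bdelta E T b"] r[of "\<lambda>T. of_int ((a(F := a F - 1)) T) * bdelta E T b"]
      by (simp add: algebra_simps)
  qed
  then show ?thesis
    by (simp add: plin_diff_def plin_of_coeffs_eq[OF assms(1)] pdelta_eq[OF assms] fun_eq_iff)
qed

lemma plin_zero_eq: "finite E \<Longrightarrow> plin_zero E = plin_of_coeffs E (\<lambda>_. 0)"
  by (simp add: plin_zero_def plin_of_coeffs_def)

lemma sum_bdelta_linear:
  assumes "finite E" "b \<in> RR E"
  shows "(\<Sum>T\<in>nonempty_subsets E. of_int (\<Sum>j\<in>T. k j) * bdelta E T b) = (\<Sum>j\<in>E. of_int (k j) * b j)"
proof -
  obtain xs where xs: "xs \<in> permutations_of_set E" "b \<in> cone E xs" using cone_exists[OF assms] .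
  have "(\<lambda>T. \<Sum>j\<in>T. k j)({} := 0) = (\<lambda>T. \<Sum>j\<in>T. k j)" by auto
  then show ?thesis
    using sum_bdelta_cone[OF assms(1) xs, of "\<lambda>T. \<Sum>j\<in>T. k j"] flag_linear_linear[of "{}" xs k b] xs(1)
    by (simp add: permutations_of_set_def)
qed

text \<open>The expansion of b as the sum of the delta_T(b) e_T, obtained by applying
  \<open>sum_bdelta_linear\<close> to the i-th coordinate function.\<close>

lemma coordinate_bdelta:
  assumes "finite E" "b \<in> RR E" "i \<in> E"
  shows "(\<Sum>T\<in>nonempty_subsets E. bdelta E T b * evec E T i) = b i"
proof -
  have "(\<Sum>T\<in>nonempty_subsets E. bdelta E T b * evec E T i) =
     (\<Sum>T\<in>nonempty_subsets E. of_int (\<Sum>j\<in>T. if j = i then 1 else 0) * bdelta E T b)"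
  proof (rule sum.cong[OF refl])
    fix T assume "T \<in> nonempty_subsets E"
    then have "finite T" using assms(1) by (auto simp: nonempty_subsets_def intro: finite_subset)
    then show "bdelta E T b * evec E T i = of_int (\<Sum>j\<in>T. if j = i then 1 else 0) * bdelta E T b"
      using assms(3) by (simp add: evec_def)
  qed
  also have "\<dots> = (\<Sum>j\<in>E. of_int (if j = i then 1 else 0) * b j)"
    by (rule sum_bdelta_linear[OF assms(1,2)])
  also have "\<dots> = (\<Sum>j\<in>E. if j = i then b i else 0)" by (intro sum.cong) auto
  finally show ?thesis using assms(1,3) by simp
qed

section \<open>Piecewise Laurent polynomials\<close>

lemma exponential_independence:
  fixes c r :: "'b \<Rightarrow> real"
  assumes "finite ms" "inj_on r ms" and zero: "\<And>s::nat. (\<Sum>m\<in>ms. c m * r m ^ s) = 0" and "m \<in> ms"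
  shows "c m = 0"
proof -
  \<comment> \<open>Up to scaling the Lagrange polynomial of r m: it vanishes at all other nodes, so
    the vanishing power sums isolate c m.\<close>
  define q where "q = (\<Prod>m'\<in>ms - {m}. [:- r m', 1:])"
  have "(\<Sum>k\<in>ms. c k * poly q (r k)) = (\<Sum>k\<in>ms. \<Sum>s\<le>degree q. coeff q s * (c k * r k ^ s))"
    by (simp add: poly_altdef sum_distrib_left algebra_simps)
  also have "\<dots> = (\<Sum>s\<le>degree q. coeff q s * (\<Sum>k\<in>ms. c k * r k ^ s))"
    by (subst sum.swap) (simp add: sum_distrib_left)
  finally have "(\<Sum>k\<in>ms. c k * poly q (r k)) = 0" by (simp add: zero)
  moreover have "poly q (r k) = 0" if "k \<in> ms - {m}" for k
    using that assms(1) by (auto simp: q_def poly_prod)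
  then have "(\<Sum>k\<in>ms. c k * poly q (r k)) = c m * poly q (r m)"
    by (subst sum.remove[OF assms(1,4)]) simp
  moreover have "poly q (r m) \<noteq> 0"
    using assms(1,2,4) by (auto simp: q_def poly_prod inj_on_def)
  ultimately show ?thesis by simp
qed

lemma sum_scaled_exponents: "(\<Sum>i\<in>E. of_int (Poly_Mapping.lookup m (Var i)) * (s * b i)) =
    s * (\<Sum>i\<in>E. of_int (Poly_Mapping.lookup m (Var i)) * b i)" for b :: "'a \<Rightarrow> real"
  by (simp add: sum_distrib_left algebra_simps)

text \<open>Along a generic ray of the cone distinct monomials become distinct exponentials, which are
  linearly independent.\<close>

lemma Laur_eq_0_if_vanishing:
  fixes p :: "'a laurent"
  assumes "finite E" "p \<in> Laur E" "xs \<in> permutations_of_set E"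
    and zero: "\<And>b. b \<in> cone E xs \<Longrightarrow> (\<And>i. i \<in> E \<Longrightarrow> b i \<ge> 0) \<Longrightarrow> leval (\<lambda>i. exp (b i)) p = 0"
  shows "p = 0"
proof -
  define ms where "ms = Poly_Mapping.keys p"
  have xs: "distinct xs" "set xs = E" using assms(3) by (auto simp: permutations_of_set_def)
  define idx where "idx = inv_into {..<length xs} ((!) xs)"
  have inj: "inj_on ((!) xs) {..<length xs}" using xs(1) by (simp add: inj_on_nth)
  have idx: "idx (xs ! j) = j" if "j < length xs" for j
    unfolding idx_def by (rule inv_into_f_f[OF inj]) (use that in simp)
  \<comment> \<open>Distinct exponents that decrease along \<open>xs\<close>. For N at least 1 the
    vector of the powers N ^ pos i is nonnegative and lies in the cone.\<close>
  define pos where "pos = (\<lambda>i. length xs - idx i)"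
  have inj_pos: "inj_on pos E"
  proof (rule inj_onI)
    fix i j assume "i \<in> E" "j \<in> E" "pos i = pos j"
    then obtain i' j' where "i = xs ! i'" "j = xs ! j'" "i' < length xs" "j' < length xs"
      using xs(2) by (metis in_set_conv_nth)
    then have "length xs - i' = length xs - j'"
      using \<open>pos i = pos j\<close> by (simp add: pos_def idx)
    then have "i' = j'" using \<open>i' < length xs\<close> \<open>j' < length xs\<close> by linarith
    then show "i = j" using \<open>i = xs ! i'\<close> \<open>j = xs ! j'\<close> by simp
  qed
  \<comment> \<open>The pairing of the exponent vector m with that vector, as a polynomial in
    N.\<close>
  define P where "P = (\<lambda>m. \<Sum>i\<in>E. monom (real_of_int (Poly_Mapping.lookup m (Var i))) (pos i))"
  have coeff_P: "coeff (P m) (pos i) = of_int (Poly_Mapping.lookup m (Var i))" if "i \<in> E" for m i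
  proof -
    have "coeff (P m) (pos i) = (\<Sum>j\<in>E. if j = i then of_int (Poly_Mapping.lookup m (Var i)) else 0)"
      unfolding P_def coeff_sum using inj_pos that by (intro sum.cong) (auto simp: inj_on_def)
    then show ?thesis using that assms(1) by simp
  qed
  have P_inj: "m = m'" if "P m = P m'" "m \<in> ms" "m' \<in> ms" for m m'
  proof (rule poly_mapping_eqI)
    fix v
    show "Poly_Mapping.lookup m v = Poly_Mapping.lookup m' v"
    proof (cases "v \<in> Var ` E")
      case True
      then show ?thesis using coeff_P[of _ m] coeff_P[of _ m'] that(1) by auto
    next
      case False
      then have "v \<notin> Poly_Mapping.keys m" "v \<notin> Poly_Mapping.keys m'"
        using that(2,3) assms(2) by (auto simp: ms_def Laur_def)
      then show ?thesis by (simp add: in_keys_iff)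
    qed
  qed
  \<comment> \<open>The finitely many N at which two monomials of p take the same value on the ray.
    Any other N makes the numbers r m distinct, and the multiples s * b turn them into s-th
    powers.\<close>
  define bad where "bad = (\<Union>m\<in>ms. \<Union>m'\<in>ms - {m}. {x. poly (P m - P m') x = 0})"
  have "finite bad"
    unfolding bad_def using P_inj by (intro finite_UN_I poly_roots_finite) (auto simp: ms_def)
  then have "infinite ({1::real..} - bad)"
    by (simp add: infinite_Ici)
  then obtain N where N: "N \<ge> 1" "N \<notin> bad" by (metis Diff_iff atLeast_iff finite.emptyI ex_in_conv)
  define b where "b = (\<lambda>i\<in>E. N ^ pos i)"
  have scaled: "(\<lambda>i\<in>E. real s * b i) \<in> cone E xs" for s :: nat
  proof -
    have "b (xs ! j) \<le> b (xs ! i)" if "i < j" "j < length xs" for i j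
    proof -
      have "xs ! i \<in> E" "xs ! j \<in> E" using xs(2) that by auto
      then show ?thesis using that N(1) by (simp add: b_def pos_def idx power_increasing)
    qed
    then show ?thesis
      using xs(2) by (auto simp: cone_def RR_def sorted_wrt_iff_nth_less mult_left_mono)
  qed
  define r where "r = (\<lambda>m. exp (\<Sum>i\<in>E. of_int (Poly_Mapping.lookup m (Var i)) * b i))"
  have dot: "(\<Sum>i\<in>E. of_int (Poly_Mapping.lookup m (Var i)) * b i) = poly (P m) N" for m
    by (simp add: P_def poly_sum poly_monom b_def)
  have "inj_on r ms"
  proof (rule inj_onI, rule ccontr)
    fix m m' assume m: "m \<in> ms" "m' \<in> ms" "r m = r m'" "m \<noteq> m'"
    then have "poly (P m - P m') N = 0" by (simp add: r_def dot)
    then show False using m N(2) by (auto simp: bad_def)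
  qed
  moreover have "(\<Sum>m\<in>ms. of_int (Poly_Mapping.lookup p m) * r m ^ s) = 0" for s :: nat
  proof -
    let ?b = "\<lambda>i\<in>E. real s * b i"
    have "leval (\<lambda>i. exp (?b i)) p = 0"
      by (rule zero[OF scaled]) (use N(1) in \<open>simp add: b_def\<close>)
    moreover have "mon_eval (\<lambda>i. exp (?b i)) m = r m ^ s" if "m \<in> ms" for m
    proof -
      have "Poly_Mapping.keys m \<subseteq> Var ` E" using that assms(2) by (auto simp: ms_def Laur_def)
      then have "mon_eval (\<lambda>i. exp (?b i)) m = exp (\<Sum>i\<in>E. of_int (Poly_Mapping.lookup m (Var i)) * ?b i)"
        by (rule mon_eval_exp[OF assms(1)])
      also have "(\<Sum>i\<in>E. of_int (Poly_Mapping.lookup m (Var i)) * ?b i) =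
          real s * (\<Sum>i\<in>E. of_int (Poly_Mapping.lookup m (Var i)) * b i)"
        by (simp add: sum_scaled_exponents[symmetric])
      finally show ?thesis by (simp add: r_def exp_of_nat_mult)
    qed
    ultimately show ?thesis by (simp add: leval_alt ms_def)
  qed
  ultimately have "of_int (Poly_Mapping.lookup p m) = (0::real)" if "m \<in> ms" for m
    using exponential_independence[of ms r "\<lambda>m. of_int (Poly_Mapping.lookup p m)" m] that by (simp add: ms_def)
  then have "Poly_Mapping.lookup p m = 0" for m
    by (cases "m \<in> ms") (simp_all add: ms_def in_keys_iff)
  then show ?thesis by (intro poly_mapping_eqI) simp
qed

section \<open>Adjacent swaps and divisibility\<close>

lemma perm_fun_swap:
  "perm_fun (us @ p # q # vs) \<circ> transpose (Suc (length us)) (Suc (Suc (length us))) =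
    perm_fun (us @ q # p # vs)"
proof
  fix i
  have "i < Suc (length us) \<or> i = Suc (length us) \<or> i = Suc (Suc (length us)) \<or> i > Suc (Suc (length us))"
    by linarith
  then show "(perm_fun (us @ p # q # vs) \<circ> transpose (Suc (length us)) (Suc (Suc (length us)))) i =
      perm_fun (us @ q # p # vs) i"
    by (elim disjE) (auto simp: perm_fun_def nth_append nth_Cons' transpose_apply_other)
qed

lemma PLaur_iff:
  assumes "finite E"
  shows "f \<in> PLaur E \<longleftrightarrow> f \<in> bijs E \<rightarrow>\<^sub>E Laur E \<and>
    (\<forall>us p q vs. us @ p # q # vs \<in> permutations_of_set E \<longrightarrow>
      (\<exists>g\<in>Laur E. f (perm_fun (us @ p # q # vs)) - f (perm_fun (us @ q # p # vs)) = (lvar p - lvar q) * g))"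
    (is "_ \<longleftrightarrow> _ \<and> ?R")
proof -
  have "(\<forall>\<sigma>\<in>bijs E. \<forall>i\<in>{1..<card E}. \<exists>g\<in>Laur E.
       f \<sigma> - f (\<sigma> \<circ> transpose i (Suc i)) = (lvar (\<sigma> i) - lvar (\<sigma> (Suc i))) * g) \<longleftrightarrow> ?R" (is "?L \<longleftrightarrow> _")
  proof
    assume L: ?L
    show ?R
    proof (intro allI impI)
      fix us p q vs assume xs: "us @ p # q # vs \<in> permutations_of_set E"
      define i where "i = Suc (length us)"
      have "perm_fun (us @ p # q # vs) \<in> bijs E" using xs by (simp add: bijs_eq[OF assms])
      moreover have "i \<in> {1..<card E}" using length_finite_permutations_of_set[OF xs] by (simp add: i_def)
      ultimately obtain g where "g \<in> Laur E" "f (perm_fun (us @ p # q # vs)) -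
          f (perm_fun (us @ p # q # vs) \<circ> transpose i (Suc i)) =
          (lvar (perm_fun (us @ p # q # vs) i) - lvar (perm_fun (us @ p # q # vs) (Suc i))) * g"
        using L by blast
      moreover have "perm_fun (us @ p # q # vs) i = p" "perm_fun (us @ p # q # vs) (Suc i) = q"
        by (simp_all add: i_def perm_fun_nth nth_append)
      ultimately show "\<exists>g\<in>Laur E. f (perm_fun (us @ p # q # vs)) - f (perm_fun (us @ q # p # vs)) = (lvar p - lvar q) * g"
        using perm_fun_swap[of us p q vs] by (auto simp: i_def)
    qed
  next
    assume R: ?R
    show ?L
    proof (intro ballI)
      fix \<sigma> i assume "\<sigma> \<in> bijs E" and i: "i \<in> {1..<card E}"
      then obtain xs where xs: "xs \<in> permutations_of_set E" "\<sigma> = perm_fun xs" by (auto simp: bijs_eq[OF assms])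
      have n: "length xs = card E" by (rule length_finite_permutations_of_set[OF xs(1)])
      define us where "us = take (i - 1) xs"
      have l: "length us = i - 1" using i n by (auto simp: us_def)
      have e: "xs = us @ xs ! (i - 1) # xs ! i # drop (Suc i) xs"
      proof -
        have "i - 1 < length xs" "i < length xs" "Suc (i - 1) = i" using i n by auto
        then have "xs = take (i - 1) xs @ xs ! (i - 1) # drop i xs"
          by (metis id_take_nth_drop)
        then show ?thesis
          unfolding us_def using Cons_nth_drop_Suc[OF \<open>i < length xs\<close>] by simp
      qed
      obtain p q vs where e: "xs = us @ p # q # vs" using e by blast
      have il: "i = Suc (length us)" using i l by simp
      then have "\<sigma> i = p" "\<sigma> (Suc i) = q"
        unfolding il xs(2) e by (simp_all add: perm_fun_nth nth_append)
      moreover have "\<sigma> \<circ> transpose i (Suc i) = perm_fun (us @ q # p # vs)"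
        using perm_fun_swap[of us p q vs] unfolding il xs(2) e .
      ultimately show "\<exists>g\<in>Laur E. f \<sigma> - f (\<sigma> \<circ> transpose i (Suc i)) = (lvar (\<sigma> i) - lvar (\<sigma> (Suc i))) * g"
        using R xs e by metis
    qed
  qed
  then show ?thesis by (simp add: PLaur_def)
qed

lemma PLaur_mem_Laur: "finite E \<Longrightarrow> f \<in> PLaur E \<Longrightarrow> xs \<in> permutations_of_set E \<Longrightarrow> f (perm_fun xs) \<in> Laur E"
  by (auto simp: PLaur_def bijs_eq PiE_def)

lemma PLaur_add:
  assumes "finite E" "f \<in> PLaur E" "g \<in> PLaur E"
  shows "(\<lambda>\<sigma>\<in>bijs E. f \<sigma> + g \<sigma>) \<in> PLaur E"
  unfolding PLaur_iff[OF assms(1)]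
proof (intro conjI allI impI)
  show "(\<lambda>\<sigma>\<in>bijs E. f \<sigma> + g \<sigma>) \<in> bijs E \<rightarrow>\<^sub>E Laur E"
    using assms by (auto simp: PLaur_def PiE_def intro!: Laur_add)
  fix us p q vs assume xs: "us @ p # q # vs \<in> permutations_of_set E"
  then have xs': "us @ q # p # vs \<in> permutations_of_set E" by (auto simp: permutations_of_set_def)
  obtain h k where "h \<in> Laur E" "k \<in> Laur E"
    "f (perm_fun (us @ p # q # vs)) - f (perm_fun (us @ q # p # vs)) = (lvar p - lvar q) * h"
    "g (perm_fun (us @ p # q # vs)) - g (perm_fun (us @ q # p # vs)) = (lvar p - lvar q) * k"
    using assms(2,3) xs unfolding PLaur_iff[OF assms(1)] by blast
  moreover from this have "f (perm_fun (us @ p # q # vs)) + g (perm_fun (us @ p # q # vs)) -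
      (f (perm_fun (us @ q # p # vs)) + g (perm_fun (us @ q # p # vs))) = (lvar p - lvar q) * (h + k)"
    unfolding distrib_left by (metis add_diff_add)
  ultimately show "\<exists>l\<in>Laur E. (\<lambda>\<sigma>\<in>bijs E. f \<sigma> + g \<sigma>) (perm_fun (us @ p # q # vs)) -
      (\<lambda>\<sigma>\<in>bijs E. f \<sigma> + g \<sigma>) (perm_fun (us @ q # p # vs)) = (lvar p - lvar q) * l"
    using xs xs' by (intro bexI[of _ "h + k"]) (auto simp: bijs_eq[OF assms(1)] Laur_add)
qed

lemma PLaur_scale:
  assumes "finite E" "f \<in> PLaur E" "c \<in> Laur E"
  shows "(\<lambda>\<sigma>\<in>bijs E. c * f \<sigma>) \<in> PLaur E"
  unfolding PLaur_iff[OF assms(1)]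
proof (intro conjI allI impI)
  show "(\<lambda>\<sigma>\<in>bijs E. c * f \<sigma>) \<in> bijs E \<rightarrow>\<^sub>E Laur E"
    using assms by (auto simp: PLaur_def PiE_def intro!: Laur_mult)
  fix us p q vs assume xs: "us @ p # q # vs \<in> permutations_of_set E"
  then have xs': "us @ q # p # vs \<in> permutations_of_set E" by (auto simp: permutations_of_set_def)
  obtain h where "h \<in> Laur E"
    "f (perm_fun (us @ p # q # vs)) - f (perm_fun (us @ q # p # vs)) = (lvar p - lvar q) * h"
    using assms(2) xs unfolding PLaur_iff[OF assms(1)] by blast
  moreover from this have "c * f (perm_fun (us @ p # q # vs)) - c * f (perm_fun (us @ q # p # vs)) =
      (lvar p - lvar q) * (c * h)"
    by (metis mult.left_commute right_diff_distrib)
  ultimately show "\<exists>l\<in>Laur E. (\<lambda>\<sigma>\<in>bijs E. c * f \<sigma>) (perm_fun (us @ p # q # vs)) -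
      (\<lambda>\<sigma>\<in>bijs E. c * f \<sigma>) (perm_fun (us @ q # p # vs)) = (lvar p - lvar q) * l"
    using xs xs' assms(3) by (intro bexI[of _ "c * h"]) (auto simp: bijs_eq[OF assms(1)] Laur_mult)
qed

text \<open>Moving one unit of exponent from p to q changes a monomial by x_p - x_q times a
  monomial; k such steps telescope, and negative k runs them backwards.\<close>

lemma lmon_swap_divisible:
  assumes "p \<in> E" "q \<in> E" "Poly_Mapping.keys m \<subseteq> Var ` E"
  shows "\<exists>g\<in>Laur E. lmon m - lmon (m + Poly_Mapping.single (Var q) k + Poly_Mapping.single (Var p) (- k)) =
    (lvar p - lvar q) * g"
proof -
  define d where "d = (\<lambda>k::int. Poly_Mapping.single (Var q) k + Poly_Mapping.single (Var p) (- k))"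
  have keys_d: "Poly_Mapping.keys (d k) \<subseteq> Var ` E" for k
    using assms(1,2) Poly_Mapping.keys_add[of "Poly_Mapping.single (Var q) k" "Poly_Mapping.single (Var p) (- k)"]
    by (auto simp: d_def split: if_splits)
  have step: "lmon (m + d k) - lmon (m + d (k + 1)) =
      (lvar p - lvar q) * lmon (m + d k + Poly_Mapping.single (Var p) (- 1))" for k
  proof -
    have e: "lvar p * lmon (Poly_Mapping.single (Var p) (- 1)) = 1"
      by (simp add: lvar_eq_lmon lmon_add[symmetric] single_add[symmetric] lmon_zero)
    have "d (k + 1) = d k + Poly_Mapping.single (Var q) 1 + Poly_Mapping.single (Var p) (- 1)"
      by (simp add: d_def single_add single_diff single_uminus algebra_simps)
    then have "lmon (m + d (k + 1)) = lmon (m + d k) * (lvar q * lmon (Poly_Mapping.single (Var p) (- 1)))"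
      by (simp add: lmon_add lvar_eq_lmon algebra_simps)
    moreover have "lmon (m + d k) = lmon (m + d k) * (lvar p * lmon (Poly_Mapping.single (Var p) (- 1)))"
      by (simp add: e)
    ultimately show ?thesis
      unfolding lmon_add[of "m + d k" "Poly_Mapping.single (Var p) (- 1)"] left_diff_distrib
      by (simp only: ac_simps)
  qed
  have step_L: "lmon (m + d k + Poly_Mapping.single (Var p) (- 1)) \<in> Laur E" for k
  proof (rule Laur_lmon)
    have "Poly_Mapping.keys (m + d k) \<subseteq> Var ` E"
      using Poly_Mapping.keys_add[of m "d k"] keys_d[of k] assms(3) by (meson Un_least order_trans)
    moreover have "Poly_Mapping.keys (Poly_Mapping.single (Var p) (- 1 :: int)) \<subseteq> Var ` E"
      using assms(1) by simp
    ultimately show "Poly_Mapping.keys (m + d k + Poly_Mapping.single (Var p) (- 1)) \<subseteq> Var ` E"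
      using Poly_Mapping.keys_add[of "m + d k" "Poly_Mapping.single (Var p) (- 1)"] by (meson Un_least order_trans)
  qed
  have "\<exists>g\<in>Laur E. lmon m - lmon (m + d k) = (lvar p - lvar q) * g"
  proof (induction k rule: int_induct[where k = 0])
    case base
    then show ?case by (intro bexI[of _ 0]) (auto simp: d_def)
  next
    case (step1 i)
    then obtain g where g: "g \<in> Laur E" "lmon m - lmon (m + d i) = (lvar p - lvar q) * g" by blast
    have "lmon m - lmon (m + d (i + 1)) =
        (lmon m - lmon (m + d i)) + (lmon (m + d i) - lmon (m + d (i + 1)))" by simp
    also have "\<dots> = (lvar p - lvar q) * (g + lmon (m + d i + Poly_Mapping.single (Var p) (- 1)))"
      unfolding g(2) step by (simp only: distrib_left)
    finally show ?case using Laur_add[OF g(1) step_L] by blast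
  next
    case (step2 i)
    then obtain g where g: "g \<in> Laur E" "lmon m - lmon (m + d i) = (lvar p - lvar q) * g" by blast
    have "lmon m - lmon (m + d (i - 1)) =
        (lmon m - lmon (m + d i)) - (lmon (m + d (i - 1)) - lmon (m + d (i - 1 + 1)))" by simp
    also have "\<dots> = (lvar p - lvar q) * (g - lmon (m + d (i - 1) + Poly_Mapping.single (Var p) (- 1)))"
      unfolding g(2) step by (simp only: right_diff_distrib)
    finally show ?case using Laur_diff[OF g(1) step_L] by blast
  qed
  then show ?thesis by (simp add: d_def add.assoc)
qed

definition perm_list :: "'a set \<Rightarrow> (nat \<Rightarrow> 'a) \<Rightarrow> 'a list" where
  "perm_list E \<sigma> = map \<sigma> [1..<Suc (card E)]"

lemma perm_list_perm_fun:
  assumes "xs \<in> permutations_of_set E"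
  shows "perm_list E (perm_fun xs) = xs"
  using length_finite_permutations_of_set[OF assms]
  by (intro nth_equalityI) (auto simp: perm_list_def perm_fun_def simp del: upt_Suc)

text \<open>The piecewise Laurent polynomial \<open>e\<^sup>f\<close> for \<open>f = \<Sum>\<^sub>T a\<^sub>T \<delta>\<^sub>T\<close>.\<close>

definition plaur_exp :: "'a set \<Rightarrow> ('a set \<Rightarrow> int) \<Rightarrow> (nat \<Rightarrow> 'a) \<Rightarrow> 'a laurent" where
  "plaur_exp E a = (\<lambda>\<sigma>\<in>bijs E. lmon (flag_exponent (a({} := 0)) {} (perm_list E \<sigma>)))"

lemma plaur_exp_perm_fun:
  assumes "finite E" "xs \<in> permutations_of_set E"
  shows "plaur_exp E a (perm_fun xs) = lmon (flag_exponent (a({} := 0)) {} xs)"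
  using assms by (simp add: plaur_exp_def bijs_eq perm_list_perm_fun)

lemma flag_exponent_swap:
  obtains k where "flag_exponent a S (us @ q # p # vs) =
    flag_exponent a S (us @ p # q # vs) + Poly_Mapping.single (Var q) k + Poly_Mapping.single (Var p) (- k)"
proof -
  let ?A = "S \<union> set us"
  \<comment> \<open>The mixed second difference of a at ?A in the directions p and q: of the sets
    along the flag, the swap only changes the middle one.\<close>
  define k where "k = (a (insert q ?A) - a ?A) - (a (insert q (insert p ?A)) - a (insert p ?A))"
  have e: "flag_exponent a S (us @ p # q # vs) = flag_exponent a S us +
     (Poly_Mapping.single (Var p) (a (insert p ?A) - a ?A) +
     (Poly_Mapping.single (Var q) (a (insert q (insert p ?A)) - a (insert p ?A)) +
       flag_exponent a (insert q (insert p ?A)) vs))" for p q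
    by (simp add: flag_exponent_append)
  have 1: "Poly_Mapping.single (Var q) (a (insert q ?A) - a ?A) =
      Poly_Mapping.single (Var q) (a (insert q (insert p ?A)) - a (insert p ?A)) + Poly_Mapping.single (Var q) k"
    by (simp add: k_def single_add[symmetric])
  have 2: "Poly_Mapping.single (Var p) (a (insert p (insert q ?A)) - a (insert q ?A)) =
      Poly_Mapping.single (Var p) (a (insert p ?A) - a ?A) + Poly_Mapping.single (Var p) (- k)"
    by (simp add: k_def single_add[symmetric] insert_commute)
  have "flag_exponent a S (us @ q # p # vs) =
    flag_exponent a S (us @ p # q # vs) + Poly_Mapping.single (Var q) k + Poly_Mapping.single (Var p) (- k)"
    unfolding e[of q p] e[of p q] 1 2 by (simp add: insert_commute ac_simps)
  then show ?thesis by (rule that)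
qed

lemma plaur_exp_PLaur:
  assumes "finite E"
  shows "plaur_exp E a \<in> PLaur E"
  unfolding PLaur_iff[OF assms]
proof (intro conjI allI impI)
  have "plaur_exp E a (perm_fun xs) \<in> Laur E" if "xs \<in> permutations_of_set E" for xs
    using that keys_flag_exponent[of "a({} := 0)" "{}" xs]
    by (simp add: plaur_exp_perm_fun[OF assms that] Laur_lmon permutations_of_set_def)
  then show "plaur_exp E a \<in> bijs E \<rightarrow>\<^sub>E Laur E"
    using bijs_eq[OF assms] by (auto simp: PiE_def plaur_exp_def)
  fix us p q vs assume xs: "us @ p # q # vs \<in> permutations_of_set E"
  then have xs': "us @ q # p # vs \<in> permutations_of_set E" by (auto simp: permutations_of_set_def)
  obtain k where k: "flag_exponent (a({} := 0)) {} (us @ q # p # vs) =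
    flag_exponent (a({} := 0)) {} (us @ p # q # vs) + Poly_Mapping.single (Var q) k + Poly_Mapping.single (Var p) (- k)"
    using flag_exponent_swap .
  have "p \<in> E" "q \<in> E" "Poly_Mapping.keys (flag_exponent (a({} := 0)) {} (us @ p # q # vs)) \<subseteq> Var ` E"
    using xs keys_flag_exponent[of "a({} := 0)" "{}" "us @ p # q # vs"] by (auto simp: permutations_of_set_def)
  from lmon_swap_divisible[OF this, of k]
  show "\<exists>g\<in>Laur E. plaur_exp E a (perm_fun (us @ p # q # vs)) - plaur_exp E a (perm_fun (us @ q # p # vs)) =
      (lvar p - lvar q) * g"
    by (simp add: plaur_exp_perm_fun[OF assms xs] plaur_exp_perm_fun[OF assms xs'] k)
qed

section \<open>Integer combinations of exponentials and the associated functions\<close>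

definition plaur_comb :: "'a set \<Rightarrow> (int \<times> ('a set \<Rightarrow> int)) list \<Rightarrow> (nat \<Rightarrow> 'a) \<Rightarrow> 'a laurent" where
  "plaur_comb E cs = (\<lambda>\<sigma>\<in>bijs E. \<Sum>(c, a)\<leftarrow>cs. of_int c * plaur_exp E a \<sigma>)"

lemma plaur_comb_Nil: "plaur_comb E [] = (\<lambda>\<sigma>\<in>bijs E. 0)"
  and plaur_comb_Cons: "plaur_comb E ((c, a) # cs) =
    (\<lambda>\<sigma>\<in>bijs E. (\<lambda>\<sigma>\<in>bijs E. of_int c * plaur_exp E a \<sigma>) \<sigma> + plaur_comb E cs \<sigma>)"
  by (auto simp: plaur_comb_def fun_eq_iff)

lemma plaur_comb_PLaur:
  assumes "finite E"
  shows "plaur_comb E cs \<in> PLaur E"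
proof (induction cs)
  case Nil
  show ?case
    unfolding plaur_comb_Nil using PLaur_scale[OF assms plaur_exp_PLaur[OF assms], of 0]
    unfolding mult_zero_left using Laur_zero by blast
next
  case (Cons ca cs)
  obtain c a where "ca = (c, a)" by (cases ca)
  then show ?case
    using Cons by (simp only: plaur_comb_Cons)
      (intro PLaur_add PLaur_scale plaur_exp_PLaur assms Laur_of_int)
qed

text \<open>Two orderings sorted by b differ only in the order of ties. Everything before y in the
  other list ties with y, so y can be moved to the front by swaps of equal values.\<close>

lemma swap_invariant_sorted:
  fixes b :: "'a \<Rightarrow> real"
  assumes swap: "\<And>us p q vs. us @ p # q # vs \<in> permutations_of_set E \<Longrightarrow> b p = b q \<Longrightarrow>
      F (us @ p # q # vs) = F (us @ q # p # vs)"
    and "pre @ xs \<in> permutations_of_set E" "pre @ ys \<in> permutations_of_set E"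
    and "sorted_wrt (\<lambda>p q. b q \<le> b p) xs" "sorted_wrt (\<lambda>p q. b q \<le> b p) ys"
  shows "F (pre @ xs) = F (pre @ ys)"
  using assms(2-)
proof (induction ys arbitrary: pre xs)
  case Nil
  then show ?case
    using length_finite_permutations_of_set[OF Nil.prems(1)] length_finite_permutations_of_set[OF Nil.prems(2)]
    by simp
next
  case (Cons y ys)
  have set: "set xs = set (y # ys)" using Cons.prems by (auto simp: permutations_of_set_def)
  then obtain us vs where xs: "xs = us @ y # vs" by (metis list.set_intros(1) split_list)
  have eq: "b u = b y" if "u \<in> set us" for u
  proof (rule antisym)
    show "b u \<le> b y" using that set xs Cons.prems(4) by auto
    show "b y \<le> b u" using that xs Cons.prems(3) by (auto simp: sorted_wrt_append)
  qed
  have "F (pre @ us @ y # vs) = F (pre @ y # us @ vs)"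
    using eq Cons.prems(1)[unfolded xs]
  proof (induction us arbitrary: vs rule: rev_induct)
    case (snoc u us)
    have "F ((pre @ us) @ u # y # vs) = F ((pre @ us) @ y # u # vs)"
      using snoc.prems by (intro swap) auto
    moreover have "F (pre @ us @ y # (u # vs)) = F (pre @ y # us @ (u # vs))"
      by (rule snoc.IH) (use snoc.prems in \<open>auto simp: permutations_of_set_def\<close>)
    ultimately show ?case by simp
  qed simp
  moreover have "F ((pre @ [y]) @ us @ vs) = F ((pre @ [y]) @ ys)"
  proof (rule Cons.IH)
    show "(pre @ [y]) @ us @ vs \<in> permutations_of_set E" "(pre @ [y]) @ ys \<in> permutations_of_set E"
      using Cons.prems(1,2) xs by (auto simp: permutations_of_set_def)
    show "sorted_wrt (\<lambda>p q. b q \<le> b p) (us @ vs)" "sorted_wrt (\<lambda>p q. b q \<le> b p) ys"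
      using Cons.prems(3,4) xs by (auto simp: sorted_wrt_append)
  qed
  ultimately show ?case using xs by simp
qed

text \<open>Well-definedness on overlaps: at a point with b p = b q the divisor x_p - x_q evaluates
  to 0, so swapping p and q does not change the value.\<close>

lemma plaur_fun_cone:
  assumes "finite E" "f \<in> PLaur E" "xs \<in> permutations_of_set E" "b \<in> cone E xs"
  shows "plaur_fun E f b = leval (\<lambda>i. exp (b i)) (f (perm_fun xs))"
proof -
  let ?e = "leval (\<lambda>i. exp (b i))"
  have "b \<in> RR E" using assms(4) by (simp add: cone_def)
  have same: "?e (f (perm_fun ys)) = ?e (f (perm_fun xs))"
    if "ys \<in> permutations_of_set E" "b \<in> cone E ys" for ys
  proof -
    have "(\<lambda>zs. ?e (f (perm_fun zs))) ([] @ ys) = (\<lambda>zs. ?e (f (perm_fun zs))) ([] @ xs)"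
    proof (rule swap_invariant_sorted[where b = b and E = E])
      fix us p q vs assume zs: "us @ p # q # vs \<in> permutations_of_set E" and pq: "b p = b q"
      then obtain g where "f (perm_fun (us @ p # q # vs)) - f (perm_fun (us @ q # p # vs)) = (lvar p - lvar q) * g"
        using assms(2) unfolding PLaur_iff[OF assms(1)] by blast
      then have "?e (f (perm_fun (us @ p # q # vs))) - ?e (f (perm_fun (us @ q # p # vs))) =
          ?e (lvar p - lvar q) * ?e g"
        by (simp flip: leval_diff leval_mult)
      then show "?e (f (perm_fun (us @ p # q # vs))) = ?e (f (perm_fun (us @ q # p # vs)))"
        using pq by (simp add: leval_diff leval_lvar)
    qed (use that assms in \<open>auto simp: cone_def\<close>)
    then show ?thesis by simp
  qed
  have "(THE y. \<forall>\<sigma>\<in>bijs E. b \<in> braid_max_cone E \<sigma> \<longrightarrow> y = ?e (f \<sigma>)) = ?e (f (perm_fun xs))"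
  proof (rule the_equality)
    show "\<forall>\<sigma>\<in>bijs E. b \<in> braid_max_cone E \<sigma> \<longrightarrow> ?e (f (perm_fun xs)) = ?e (f \<sigma>)"
      using same by (auto simp: bijs_eq[OF assms(1)] braid_max_cone_perm_fun)
    fix y assume "\<forall>\<sigma>\<in>bijs E. b \<in> braid_max_cone E \<sigma> \<longrightarrow> y = ?e (f \<sigma>)"
    then show "y = ?e (f (perm_fun xs))"
      using assms(3,4) by (auto simp: bijs_eq[OF assms(1)] braid_max_cone_perm_fun)
  qed
  then show ?thesis using \<open>b \<in> RR E\<close> by (simp add: plaur_fun_def)
qed

lemma exp_plin_of_coeffs:
  assumes "finite E" "xs \<in> permutations_of_set E" "b \<in> cone E xs"
  shows "leval (\<lambda>i. exp (b i)) (plaur_exp E a (perm_fun xs)) = exp (plin_of_coeffs E a b)"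
  using assms by (simp add: plaur_exp_perm_fun plin_of_coeffs_cone exp_flag_linear leval_lmon)

lemma plaur_fun_comb:
  assumes "finite E" "b \<in> RR E"
  shows "plaur_fun E (plaur_comb E cs) b = (\<Sum>(c, a)\<leftarrow>cs. of_int c * exp (plin_of_coeffs E a b))"
proof -
  obtain xs where xs: "xs \<in> permutations_of_set E" "b \<in> cone E xs" using cone_exists[OF assms] .
  have "leval (\<lambda>i. exp (b i)) (\<Sum>(c, a)\<leftarrow>cs. of_int c * plaur_exp E a (perm_fun xs)) =
      (\<Sum>(c, a)\<leftarrow>cs. of_int c * exp (plin_of_coeffs E a b))"
    by (induction cs) (auto simp: leval_add leval_mult leval_of_int exp_plin_of_coeffs[OF assms(1) xs])
  moreover have "plaur_comb E cs (perm_fun xs) = (\<Sum>(c, a)\<leftarrow>cs. of_int c * plaur_exp E a (perm_fun xs))"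
    using xs(1) by (simp add: plaur_comb_def bijs_eq[OF assms(1)])
  ultimately show ?thesis
    by (simp add: plaur_fun_cone[OF assms(1) plaur_comb_PLaur[OF assms(1)] xs])
qed

text \<open>Nonnegative points suffice because each maximal cone contains generic nonnegative rays.
  Comparison through the matroid fan yields only such points.\<close>

lemma PLaur_eqI:
  assumes "finite E" "f \<in> PLaur E" "g \<in> PLaur E"
    and "\<And>b. b \<in> RR E \<Longrightarrow> (\<And>i. i \<in> E \<Longrightarrow> b i \<ge> 0) \<Longrightarrow> plaur_fun E f b = plaur_fun E g b"
  shows "f = g"
proof (rule extensionalityI)
  show "f \<in> extensional (bijs E)" "g \<in> extensional (bijs E)"
    using assms by (auto simp: PLaur_def PiE_def)
  fix \<sigma> assume "\<sigma> \<in> bijs E"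
  then obtain xs where xs: "\<sigma> = perm_fun xs" "xs \<in> permutations_of_set E" by (auto simp: bijs_eq[OF assms(1)])
  have "f (perm_fun xs) - g (perm_fun xs) = 0"
  proof (rule Laur_eq_0_if_vanishing[OF assms(1) _ xs(2)])
    show "f (perm_fun xs) - g (perm_fun xs) \<in> Laur E"
      using assms xs(2) by (intro Laur_diff PLaur_mem_Laur)
    fix b assume "b \<in> cone E xs" "\<And>i. i \<in> E \<Longrightarrow> b i \<ge> 0"
    then show "leval (\<lambda>i. exp (b i)) (f (perm_fun xs) - g (perm_fun xs)) = 0"
      using assms(4)[of b] plaur_fun_cone[OF assms(1,2) xs(2)] plaur_fun_cone[OF assms(1,3) xs(2)]
      by (simp add: leval_diff cone_def)
  qed
  then show "f \<sigma> = g \<sigma>" by (simp add: xs)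
qed

section \<open>Spanning by exponentials of piecewise linear functions\<close>

text \<open>Truncates the expansion of b in the e_T to T in S. The result depends piecewise linearly
  on b.\<close>

definition coord_proj :: "'a set \<Rightarrow> 'a set set \<Rightarrow> ('a \<Rightarrow> real) \<Rightarrow> ('a \<Rightarrow> real)" where
  "coord_proj E S b = (\<lambda>i\<in>E. \<Sum>T\<in>S. bdelta E T b * evec E T i)"

lemma coord_proj_RR: "coord_proj E S b \<in> RR E"
  by (simp add: coord_proj_def RR_def)

lemma coord_proj_all:
  assumes "finite E" "b \<in> RR E"
  shows "coord_proj E (nonempty_subsets E) b = b"
  using assms coordinate_bdelta[OF assms]
  by (auto simp: coord_proj_def fun_eq_iff RR_def PiE_def extensional_def)

lemma coord_proj_remove_zero:
  assumes "finite S" "bdelta E T b = 0"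
  shows "coord_proj E (S - {T}) b = coord_proj E S b"
  unfolding coord_proj_def
proof (intro restrict_ext)
  fix i
  show "(\<Sum>U\<in>S - {T}. bdelta E U b * evec E U i) = (\<Sum>U\<in>S. bdelta E U b * evec E U i)"
    using assms by (intro sum.mono_neutral_left) auto
qed

lemma coord_proj_superset:
  assumes "finite S" "S' \<subseteq> S" "\<And>T. T \<in> S - S' \<Longrightarrow> bdelta E T b = 0"
  shows "coord_proj E S' b = coord_proj E S b"
  unfolding coord_proj_def
proof (intro restrict_ext)
  fix i
  show "(\<Sum>U\<in>S'. bdelta E U b * evec E U i) = (\<Sum>U\<in>S. bdelta E U b * evec E U i)"
    using assms by (intro sum.mono_neutral_left) auto
qed

text \<open>Sets with nonzero coordinate at b are initial segments of one common ordering, hence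
  nested.\<close>

lemma bdelta_incomparable:
  assumes "finite E" "b \<in> RR E" "T \<subseteq> E" "U \<subseteq> E" "\<not> T \<subseteq> U" "\<not> U \<subseteq> T"
  shows "bdelta E T b = 0 \<or> bdelta E U b = 0"
proof (rule ccontr)
  assume no: "\<not> ?thesis"
  obtain xs where xs: "xs \<in> permutations_of_set E" "b \<in> cone E xs" using cone_exists[OF assms(1,2)] .
  obtain us vs where 1: "xs = us @ vs" "set us = T"
    using bdelta_not_prefix[OF assms(1) xs assms(3)] no by blast
  obtain us' vs' where 2: "xs = us' @ vs'" "set us' = U"
    using bdelta_not_prefix[OF assms(1) xs assms(4)] no by blast
  have "us @ vs = us' @ vs'" using 1 2 by simp
  then have "set us \<subseteq> set us' \<or> set us' \<subseteq> set us"
    unfolding append_eq_append_conv2 by auto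
  then show False using 1 2 assms by simp
qed

lemma leval_exp_sum:
  assumes "finite E" "p \<in> Laur E"
  shows "leval (\<lambda>i. exp (b i)) p = (\<Sum>m\<in>Poly_Mapping.keys p. of_int (Poly_Mapping.lookup p m) *
    exp (\<Sum>i\<in>E. of_int (Poly_Mapping.lookup m (Var i)) * b i))"
  unfolding leval_alt
proof (rule sum.cong[OF refl])
  fix m assume "m \<in> Poly_Mapping.keys p"
  then have "Poly_Mapping.keys m \<subseteq> Var ` E" using assms(2) by (auto simp: Laur_def)
  then show "of_int (Poly_Mapping.lookup p m) * mon_eval (\<lambda>i. exp (b i)) m = of_int (Poly_Mapping.lookup p m) *
    exp (\<Sum>i\<in>E. of_int (Poly_Mapping.lookup m (Var i)) * b i)"
    by (simp add: mon_eval_exp[OF assms(1)])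
qed

definition exp_comb :: "'a set \<Rightarrow> (int \<times> ('a set \<Rightarrow> int)) list \<Rightarrow> ('a \<Rightarrow> real) \<Rightarrow> real" where
  "exp_comb E cs b = (\<Sum>(c, a)\<leftarrow>cs. of_int c * exp (plin_of_coeffs E a b))"

lemma exp_comb_append: "exp_comb E (cs @ ds) b = exp_comb E cs b + exp_comb E ds b"
  by (simp add: exp_comb_def)

lemma exp_comb_uminus: "exp_comb E (map (\<lambda>(c, a). (- c, a)) cs) b = - exp_comb E cs b"
  by (induction cs) (auto simp: exp_comb_def)

lemma chain_span:
  assumes "finite E" "S \<subseteq> nonempty_subsets E" "p \<in> Laur E"
  shows "\<exists>cs. (\<forall>(c, a)\<in>set cs. \<forall>T. T \<notin> S \<longrightarrow> a T = 0) \<and>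
    (\<forall>b\<in>RR E. leval (\<lambda>i. exp (coord_proj E S b i)) p = exp_comb E cs b)"
proof -
  obtain ms where ms: "set ms = Poly_Mapping.keys p" "distinct ms"
    using finite_distinct_list[OF finite_keys[of p]] by blast
  \<comment> \<open>Pairing the exponent m with e_T gives the sum of m over T; truncating the point
    to S amounts to dropping the other coefficients.\<close>
  define a where "a = (\<lambda>m T. if T \<in> S then (\<Sum>i\<in>T. Poly_Mapping.lookup m (Var i)) else 0 :: int)"
  define cs where "cs = map (\<lambda>m. (Poly_Mapping.lookup p m, a m)) ms"
  have "leval (\<lambda>i. exp (coord_proj E S b i)) p = exp_comb E cs b" if b: "b \<in> RR E" for b
  proof -
    have "(\<Sum>i\<in>E. of_int (Poly_Mapping.lookup m (Var i)) * coord_proj E S b i) = plin_of_coeffs E (a m) b" for m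
    proof -
      have "(\<Sum>i\<in>E. of_int (Poly_Mapping.lookup m (Var i)) * coord_proj E S b i) =
         (\<Sum>T\<in>S. bdelta E T b * (\<Sum>i\<in>E. of_int (Poly_Mapping.lookup m (Var i)) * evec E T i))"
      proof -
        have "(\<Sum>i\<in>E. of_int (Poly_Mapping.lookup m (Var i)) * coord_proj E S b i) =
            (\<Sum>i\<in>E. \<Sum>T\<in>S. bdelta E T b * (of_int (Poly_Mapping.lookup m (Var i)) * evec E T i))"
          by (intro sum.cong) (simp_all add: coord_proj_def sum_distrib_left mult.left_commute)
        then show ?thesis unfolding sum_distrib_left by (simp only: sum.swap[of _ S E])
      qed
      also have "\<dots> = (\<Sum>T\<in>S. of_int (a m T) * bdelta E T b)"
        using assms(2) by (intro sum.cong refl)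
          (subst sum_mult_evec[OF assms(1)], auto simp: a_def nonempty_subsets_def)
      also have "\<dots> = (\<Sum>T\<in>nonempty_subsets E. of_int (a m T) * bdelta E T b)"
        using assms(2) finite_nonempty_subsets[OF assms(1)]
        by (intro sum.mono_neutral_left) (auto simp: a_def)
      finally show ?thesis using b by (simp add: plin_of_coeffs_eq[OF assms(1)])
    qed
    then have "leval (\<lambda>i. exp (coord_proj E S b i)) p =
        (\<Sum>m\<in>set ms. of_int (Poly_Mapping.lookup p m) * exp (plin_of_coeffs E (a m) b))"
      by (simp add: leval_exp_sum[OF assms(1,3)] ms(1))
    also have "\<dots> = exp_comb E cs b"
      by (simp add: exp_comb_def cs_def comp_def sum_list_distinct_conv_sum_set[OF ms(2)])
    finally show ?thesis .
  qed
  moreover have "\<forall>(c, a)\<in>set cs. \<forall>T. T \<notin> S \<longrightarrow> a T = 0"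
    by (auto simp: cs_def a_def)
  ultimately show ?thesis by blast
qed

text \<open>If \<open>T\<close> and \<open>U\<close> are incomparable, at every point one of the coordinates \<open>\<delta>\<^sub>T\<close> and \<open>\<delta>\<^sub>U\<close> vanishes.
  Hence \<open>f\<close> composed with the projection to \<open>S\<close> can be expressed through the projections to the
  smaller families without \<open>T\<close>, without \<open>U\<close>, and without both.\<close>

lemma exp_span:
  assumes E: "finite E" and D: "D \<subseteq> RR E" and "S \<subseteq> nonempty_subsets E"
    and "\<And>C. C \<subseteq> S \<Longrightarrow> chain\<^sub>\<subseteq> C \<Longrightarrow>
      \<exists>p\<in>Laur E. \<forall>b\<in>D. f (coord_proj E C b) = leval (\<lambda>i. exp (coord_proj E C b i)) p"
  shows "\<exists>cs. (\<forall>(c, a)\<in>set cs. \<forall>T. T \<notin> S \<longrightarrow> a T = 0) \<and> (\<forall>b\<in>D. f (coord_proj E S b) = exp_comb E cs b)"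
proof -
  have "finite S" using assms(3) finite_nonempty_subsets[OF E] finite_subset by blast
  then show ?thesis
    using assms(3,4)
  proof (induction S rule: finite_psubset_induct)
    case (psubset S)
    show ?case
    proof (cases "chain\<^sub>\<subseteq> S")
      case True
      then obtain p where "p \<in> Laur E" "\<forall>b\<in>D. f (coord_proj E S b) = leval (\<lambda>i. exp (coord_proj E S b i)) p"
        using psubset.prems(2)[of S] by blast
      moreover from chain_span[OF E psubset.prems(1) this(1)]
      obtain cs where "\<forall>(c, a)\<in>set cs. \<forall>T. T \<notin> S \<longrightarrow> a T = 0"
        "\<forall>b\<in>RR E. leval (\<lambda>i. exp (coord_proj E S b i)) p = exp_comb E cs b" by blast
      ultimately have "\<forall>b\<in>D. f (coord_proj E S b) = exp_comb E cs b" using D by auto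
      then show ?thesis using \<open>\<forall>(c, a)\<in>set cs. \<forall>T. T \<notin> S \<longrightarrow> a T = 0\<close> by blast
    next
      case False
      then obtain T U where TU: "T \<in> S" "U \<in> S" "\<not> T \<subseteq> U" "\<not> U \<subseteq> T"
        by (auto simp: chain_subset_def)
      have sub: "\<exists>cs. (\<forall>(c, a)\<in>set cs. \<forall>T. T \<notin> S \<longrightarrow> a T = 0) \<and>
          (\<forall>b\<in>D. f (coord_proj E S' b) = exp_comb E cs b)" if S': "S' \<subset> S" for S'
      proof -
        have "\<exists>cs. (\<forall>(c, a)\<in>set cs. \<forall>T. T \<notin> S' \<longrightarrow> a T = 0) \<and>
            (\<forall>b\<in>D. f (coord_proj E S' b) = exp_comb E cs b)"
          by (rule psubset.IH[OF S']) (use S' psubset.prems in \<open>auto intro: psubset.prems(2)\<close>)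
        then show ?thesis using S' by blast
      qed
      have s: "S - {T} \<subset> S" "S - {U} \<subset> S" "S - {T} - {U} \<subset> S" using TU by auto
      from sub[OF s(1)] obtain cs1 where
        1: "\<forall>(c, a)\<in>set cs1. \<forall>T. T \<notin> S \<longrightarrow> a T = 0" "\<forall>b\<in>D. f (coord_proj E (S - {T}) b) = exp_comb E cs1 b"
        by blast
      from sub[OF s(2)] obtain cs2 where
        2: "\<forall>(c, a)\<in>set cs2. \<forall>T. T \<notin> S \<longrightarrow> a T = 0" "\<forall>b\<in>D. f (coord_proj E (S - {U}) b) = exp_comb E cs2 b"
        by blast
      from sub[OF s(3)] obtain cs3 where
        3: "\<forall>(c, a)\<in>set cs3. \<forall>T. T \<notin> S \<longrightarrow> a T = 0" "\<forall>b\<in>D. f (coord_proj E (S - {T} - {U}) b) = exp_comb E cs3 b"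
        by blast
      let ?cs = "cs1 @ cs2 @ map (\<lambda>(c, a). (- c, a)) cs3"
      have "f (coord_proj E S b) = exp_comb E ?cs b" if b: "b \<in> D" for b
      proof -
        have "T \<subseteq> E" "U \<subseteq> E" using TU psubset.prems(1) by (auto simp: nonempty_subsets_def)
        then consider "bdelta E T b = 0" | "bdelta E U b = 0"
          using bdelta_incomparable[OF E _ _ _ TU(3,4), of b] b D by blast
        then have "f (coord_proj E S b) = f (coord_proj E (S - {T}) b) + f (coord_proj E (S - {U}) b)
            - f (coord_proj E (S - {T} - {U}) b)"
        proof cases
          case 1
          have "coord_proj E (S - {U} - {T}) b = coord_proj E (S - {U}) b"
            "coord_proj E (S - {T}) b = coord_proj E S b"
            using psubset.hyps by (intro coord_proj_remove_zero 1; simp)+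
          moreover have "S - {T} - {U} = S - {U} - {T}" by blast
          ultimately show ?thesis by simp
        next
          case 2
          have "coord_proj E (S - {T} - {U}) b = coord_proj E (S - {T}) b"
            "coord_proj E (S - {U}) b = coord_proj E S b"
            using psubset.hyps by (intro coord_proj_remove_zero 2; simp)+
          then show ?thesis by simp
        qed
        then show ?thesis
          using 1(2) 2(2) 3(2) b by (simp add: exp_comb_append exp_comb_uminus)
      qed
      moreover have "\<forall>(c, a)\<in>set ?cs. \<forall>T. T \<notin> S \<longrightarrow> a T = 0"
        using 1(1) 2(1) 3(1) by auto
      ultimately show ?thesis by blast
    qed
  qed
qed

lemma chain_common_cone:
  assumes "finite E" "C \<subseteq> nonempty_subsets E" "chain\<^sub>\<subseteq> C"
  shows "\<exists>xs\<in>permutations_of_set E. \<forall>c. (\<forall>T\<in>C. T \<noteq> E \<longrightarrow> c T \<ge> 0) \<longrightarrow>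
    (\<lambda>i\<in>E. \<Sum>T\<in>C. c T * evec E T i) \<in> cone E xs"
proof -
  have fin: "finite C" using assms finite_nonempty_subsets finite_subset by blast
  \<comment> \<open>h i counts the members of the chain that contain i, so every member is an
    initial segment when sorting by h. The indicator of E is constant, which is why its coefficient
    may have any sign.\<close>
  define h where "h = (\<lambda>i\<in>E. real (card {T \<in> C. i \<in> T}))"
  have "h \<in> RR E" by (simp add: h_def RR_def)
  then obtain xs where xs: "xs \<in> permutations_of_set E" "h \<in> cone E xs" using cone_exists[OF assms(1)] by blast
  have sE: "set xs = E" using xs(1) by (simp add: permutations_of_set_def)
  have mem: "p \<in> T" if "T \<in> C" "p \<in> E" "q \<in> E" "h q \<le> h p" "q \<in> T" for p q T
  proof (rule ccontr)
    assume "p \<notin> T"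
    have "{U \<in> C. p \<in> U} \<subset> {U \<in> C. q \<in> U}"
      using that \<open>p \<notin> T\<close> assms(3) unfolding chain_subset_def by blast
    then have "card {U \<in> C. p \<in> U} < card {U \<in> C. q \<in> U}" using fin by (intro psubset_card_mono) auto
    then show False using that by (simp add: h_def)
  qed
  have "(\<lambda>i\<in>E. \<Sum>T\<in>C. c T * evec E T i) \<in> cone E xs"
    if c: "\<forall>T\<in>C. T \<noteq> E \<longrightarrow> c T \<ge> 0" for c
  proof -
    have le: "(\<Sum>T\<in>C. c T * evec E T q) \<le> (\<Sum>T\<in>C. c T * evec E T p)"
      if "p \<in> E" "q \<in> E" "h q \<le> h p" for p q
    proof (rule sum_mono)
      fix T assume T: "T \<in> C"
      show "c T * evec E T q \<le> c T * evec E T p"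
      proof (cases "T = E")
        case False
        have "evec E T q \<le> evec E T p"
          using mem[OF T that] that by (auto simp: evec_def)
        then show ?thesis using c T False by (intro mult_left_mono) auto
      qed (use that in \<open>simp add: evec_def\<close>)
    qed
    have "sorted_wrt (\<lambda>p q. h q \<le> h p) xs" using xs(2) by (simp add: cone_def)
    then have "sorted_wrt (\<lambda>p q. (\<lambda>i\<in>E. \<Sum>T\<in>C. c T * evec E T i) q \<le> (\<lambda>i\<in>E. \<Sum>T\<in>C. c T * evec E T i) p) xs"
      by (rule sorted_wrt_mono_rel[rotated]) (use le sE in auto)
    then show ?thesis by (simp add: cone_def RR_def)
  qed
  then show ?thesis using xs(1) by blast
qed

text \<open>All these combinations lie in one maximal cone, where delta_U is linear; it is therefore
  determined by its values at the e_T with T in C.\<close>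

lemma chain_bdelta:
  assumes "finite E" "C \<subseteq> nonempty_subsets E" "chain\<^sub>\<subseteq> C"
    and "\<And>T. T \<in> C \<Longrightarrow> T \<noteq> E \<Longrightarrow> c T \<ge> 0" and U: "U \<in> nonempty_subsets E"
  shows "bdelta E U (\<lambda>i\<in>E. \<Sum>T\<in>C. c T * evec E T i) = (if U \<in> C then c U else 0)"
proof -
  have fin: "finite C" using assms finite_nonempty_subsets finite_subset by blast
  let ?b = "\<lambda>c. \<lambda>i\<in>E. \<Sum>T\<in>C. c T * evec E T i"
  obtain xs where xs: "xs \<in> permutations_of_set E"
    "\<forall>c. (\<forall>T\<in>C. T \<noteq> E \<longrightarrow> c T \<ge> 0) \<longrightarrow> ?b c \<in> cone E xs"
    using chain_common_cone[OF assms(1-3)] by (elim bexE)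
  have "distinct xs" "set xs = E" using xs(1) by (auto simp: permutations_of_set_def)
  then obtain k :: "'a \<Rightarrow> int" where
    k: "\<And>b. flag_linear (\<lambda>V. if V = U then 1 else 0) {} xs b = (\<Sum>i\<in>E. of_int (k i) * b i)"
    using flag_linear_ex[of xs "\<lambda>V. if V = U then 1 else 0" "{}"] by auto
  have lin: "bdelta E U (?b c) = (\<Sum>T\<in>C. c T * (\<Sum>i\<in>T. of_int (k i)))"
    if "\<And>T. T \<in> C \<Longrightarrow> T \<noteq> E \<Longrightarrow> c T \<ge> 0" for c
  proof -
    have "bdelta E U (?b c) = (\<Sum>i\<in>E. of_int (k i) * ?b c i)"
      using bdelta_cone[OF assms(1) xs(1) _ U, of "?b c"] xs(2) that k by simp
    also have "\<dots> = (\<Sum>T\<in>C. c T * (\<Sum>i\<in>E. of_int (k i) * evec E T i))"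
    proof -
      have "(\<Sum>i\<in>E. of_int (k i) * ?b c i) = (\<Sum>i\<in>E. \<Sum>T\<in>C. c T * (of_int (k i) * evec E T i))"
        by (intro sum.cong) (simp_all add: sum_distrib_left mult.left_commute)
      then show ?thesis unfolding sum_distrib_left by (simp only: sum.swap[of _ C E])
    qed
    also have "\<dots> = (\<Sum>T\<in>C. c T * (\<Sum>i\<in>T. of_int (k i)))"
      using assms(2) by (intro sum.cong refl) (subst sum_mult_evec[OF assms(1)], auto simp: nonempty_subsets_def)
    finally show ?thesis .
  qed
  have "(\<Sum>i\<in>T. of_int (k i)) = (if T = U then 1 else 0::real)" if T: "T \<in> C" for T
  proof -
    have 1: "?b (\<lambda>V. if V = T then 1 else 0) = evec E T"
    proof
      fix i
      have "(\<Sum>V\<in>C. (if V = T then 1 else 0) * evec E V i) = (\<Sum>V\<in>C. if V = T then evec E T i else 0)"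
        by (intro sum.cong) auto
      then show "?b (\<lambda>V. if V = T then 1 else 0) i = evec E T i"
        using T fin by (auto simp: evec_def)
    qed
    have "(\<Sum>V\<in>C. (if V = T then 1 else 0) * (\<Sum>i\<in>V. of_int (k i))) =
        (\<Sum>V\<in>C. if V = T then (\<Sum>i\<in>T. of_int (k i)) else (0::real))"
      by (intro sum.cong) auto
    then have "bdelta E U (evec E T) = (\<Sum>i\<in>T. of_int (k i))"
      using lin[of "\<lambda>V. if V = T then 1 else 0"] T fin unfolding 1 by simp
    moreover have "bdelta E U (evec E T) = (if T = U then 1 else 0)"
    proof -
      have "T \<in> nonempty_subsets E" using T assms(2) by blast
      from sum_bdelta_evec[OF assms(1) this, of "\<lambda>V. if V = U then 1 else 0"]
      have "(\<Sum>V\<in>nonempty_subsets E. if V = U then bdelta E U (evec E T) else 0) = (if T = U then 1 else 0)"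
        by (simp add: if_distrib[of "\<lambda>x. x * _"] if_distrib[of of_int] cong: if_cong)
      then show ?thesis using U finite_nonempty_subsets[OF assms(1)] by simp
    qed
    ultimately show ?thesis by simp
  qed
  then have "bdelta E U (?b c) = (\<Sum>T\<in>C. if T = U then c U else 0)"
    using lin[OF assms(4)] by (auto intro!: sum.cong)
  then show ?thesis using fin by simp
qed

text \<open>Truncation to a chain lands in a single maximal cone, where f is one Laurent polynomial,
  so \<open>exp_span\<close> applies; truncation to all nonempty subsets is the identity.\<close>

lemma PLaur_span:
  assumes "finite E" "f \<in> PLaur E"
  obtains cs where "f = plaur_comb E cs"
proof -
  have "\<exists>cs. (\<forall>(c, a)\<in>set cs. \<forall>T. T \<notin> nonempty_subsets E \<longrightarrow> a T = 0) \<and>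
      (\<forall>b\<in>RR E. plaur_fun E f (coord_proj E (nonempty_subsets E) b) = exp_comb E cs b)"
  proof (rule exp_span[OF assms(1) order_refl order_refl])
    fix C assume C: "C \<subseteq> nonempty_subsets E" "chain\<^sub>\<subseteq> C"
    obtain xs where xs: "xs \<in> permutations_of_set E"
      "\<forall>c. (\<forall>T\<in>C. T \<noteq> E \<longrightarrow> c T \<ge> 0) \<longrightarrow> (\<lambda>i\<in>E. \<Sum>T\<in>C. c T * evec E T i) \<in> cone E xs"
      using chain_common_cone[OF assms(1) C] by (elim bexE)
    have "coord_proj E C b \<in> cone E xs" for b
      unfolding coord_proj_def by (intro xs(2)[rule_format] bdelta_nonneg)
    then show "\<exists>p\<in>Laur E. \<forall>b\<in>RR E. plaur_fun E f (coord_proj E C b) = leval (\<lambda>i. exp (coord_proj E C b i)) p"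
      using plaur_fun_cone[OF assms xs(1)] PLaur_mem_Laur[OF assms xs(1)] by blast
  qed
  then obtain cs where cs: "\<forall>b\<in>RR E. plaur_fun E f (coord_proj E (nonempty_subsets E) b) = exp_comb E cs b"
    by blast
  have "f = plaur_comb E cs"
  proof (rule PLaur_eqI[OF assms plaur_comb_PLaur[OF assms(1)]])
    fix b assume "b \<in> RR E"
    then show "plaur_fun E f b = plaur_fun E (plaur_comb E cs) b"
      using cs by (simp add: coord_proj_all[OF assms(1)] plaur_fun_comb[OF assms(1)] exp_comb_def)
  qed
  then show ?thesis by (rule that)
qed

section \<open>The Bergman fan and piecewise exponential functions\<close>

definition flats :: "'a matroid \<Rightarrow> 'a set set" where
  "flats M = {F. flat M F \<and> F \<noteq> {}}"

lemma flats_nonempty_subsets: "flats M \<subseteq> nonempty_subsets (ground M)"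
  by (auto simp: flats_def flat_def nonempty_subsets_def)

lemma chain_cone_props:
  assumes "finite (ground M)" "\<C> \<in> flat_chains M" "b \<in> chain_cone (ground M) \<C>"
  shows "b \<in> RR (ground M)"
    and "U \<in> nonempty_subsets (ground M) \<Longrightarrow> bdelta (ground M) U b \<ge> 0"
    and "U \<in> nonempty_subsets (ground M) \<Longrightarrow> U \<notin> \<C> \<Longrightarrow> bdelta (ground M) U b = 0"
proof -
  have C: "\<C> \<subseteq> nonempty_subsets (ground M)" "chain\<^sub>\<subseteq> \<C>"
    using assms(2) flats_nonempty_subsets[of M] by (auto simp: flat_chains_def flats_def)
  obtain c where c: "b = (\<lambda>i\<in>ground M. \<Sum>F\<in>\<C>. c F * evec (ground M) F i)" "\<forall>F\<in>\<C>. c F \<ge> 0"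
    using assms(3) unfolding chain_cone_def by blast
  show "b \<in> RR (ground M)" by (simp add: c RR_def)
  show "bdelta (ground M) U b \<ge> 0" if "U \<in> nonempty_subsets (ground M)"
    using chain_bdelta[OF assms(1) C, of c U] c that by auto
  show "bdelta (ground M) U b = 0" if "U \<in> nonempty_subsets (ground M)" "U \<notin> \<C>"
    using chain_bdelta[OF assms(1) C, of c U] c that by auto
qed

lemma fan_support_props:
  assumes "finite (ground M)" "b \<in> fan_support M"
  shows "b \<in> RR (ground M)"
    and "U \<in> nonempty_subsets (ground M) \<Longrightarrow> bdelta (ground M) U b \<ge> 0"
    and "U \<in> nonempty_subsets (ground M) \<Longrightarrow> U \<notin> flats M \<Longrightarrow> bdelta (ground M) U b = 0"
proof -
  obtain \<C> where C: "\<C> \<in> flat_chains M" "b \<in> chain_cone (ground M) \<C>"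
    using assms(2) by (auto simp: fan_support_def matroid_fan_def)
  note p = chain_cone_props[OF assms(1) C]
  show "b \<in> RR (ground M)" by (rule p)
  show "U \<in> nonempty_subsets (ground M) \<Longrightarrow> bdelta (ground M) U b \<ge> 0" by (rule p)
  assume "U \<in> nonempty_subsets (ground M)" "U \<notin> flats M"
  moreover from this have "U \<notin> \<C>" using C(1) by (auto simp: flat_chains_def flats_def)
  ultimately show "bdelta (ground M) U b = 0" by (intro p)
qed

lemma coord_proj_flats:
  assumes "finite (ground M)" "b \<in> fan_support M"
  shows "coord_proj (ground M) (flats M) b = b"
proof -
  have "coord_proj (ground M) (flats M) b = coord_proj (ground M) (nonempty_subsets (ground M)) b"
    using fan_support_props[OF assms] flats_nonempty_subsets finite_nonempty_subsets[OF assms(1)]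
    by (intro coord_proj_superset) auto
  then show ?thesis using coord_proj_all[OF assms(1)] fan_support_props(1)[OF assms] by simp
qed

lemma coord_proj_chain_cone:
  assumes "\<And>F. F \<in> \<C> \<Longrightarrow> bdelta E F b \<ge> 0"
  shows "coord_proj E \<C> b \<in> chain_cone E \<C>"
  unfolding chain_cone_def coord_proj_def using assms
  by (intro CollectI exI[of _ "\<lambda>F. bdelta E F b"]) simp

text \<open>The flats with nonzero coordinate form a chain, so the truncation lies in the cone of
  that chain. Only the coordinate of the ground set can be negative, hence the hypothesis on
  it.\<close>

lemma coord_proj_fan_support:
  assumes "finite (ground M)" "b \<in> RR (ground M)" "bdelta (ground M) (ground M) b \<ge> 0"
  shows "coord_proj (ground M) (flats M) b \<in> fan_support M"
proof -
  define \<C> where "\<C> = {F \<in> flats M. bdelta (ground M) F b \<noteq> 0}"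
  have "chain\<^sub>\<subseteq> \<C>"
    unfolding chain_subset_def
  proof (intro ballI)
    fix T U assume "T \<in> \<C>" "U \<in> \<C>"
    then show "T \<subseteq> U \<or> U \<subseteq> T"
      using bdelta_incomparable[OF assms(1,2), of T U] flats_nonempty_subsets[of M]
      by (auto simp: \<C>_def nonempty_subsets_def)
  qed
  then have "\<C> \<in> flat_chains M" by (auto simp: flat_chains_def \<C>_def flats_def)
  moreover have "coord_proj (ground M) \<C> b \<in> chain_cone (ground M) \<C>"
    using bdelta_nonneg[of _ "ground M" b] assms(3) by (intro coord_proj_chain_cone) metis
  moreover have "coord_proj (ground M) \<C> b = coord_proj (ground M) (flats M) b"
    using flats_nonempty_subsets[of M] finite_nonempty_subsets[OF assms(1)]
    by (intro coord_proj_superset) (auto simp: \<C>_def intro: finite_subset)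
  ultimately show ?thesis by (auto simp: fan_support_def matroid_fan_def)
qed

section \<open>Piecewise exponential functions as Laurent polynomials on cones\<close>

definition laurent_on :: "'a set \<Rightarrow> ('a \<Rightarrow> real) set \<Rightarrow> (('a \<Rightarrow> real) \<Rightarrow> real) \<Rightarrow> bool" where
  "laurent_on E C f \<longleftrightarrow> (\<exists>p\<in>Laur E. \<forall>b\<in>C. f b = leval (\<lambda>i. exp (b i)) p)"

lemma int_linear_lmon:
  assumes "finite E" "m \<in> int_linear E"
  shows "\<exists>k. Poly_Mapping.keys k \<subseteq> Var ` E \<and> (\<forall>b\<in>RR E. exp (m b) = mon_eval (\<lambda>i. exp (b i)) k)"
proof -
  obtain k :: "'a \<Rightarrow> int" where k: "m = (\<lambda>b\<in>RR E. \<Sum>i\<in>E. of_int (k i) * b i)"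
    using assms(2) unfolding int_linear_eq[OF assms(1)] by blast
  let ?k = "\<Sum>j\<in>E. Poly_Mapping.single (Var j) (k j)"
  have keys: "Poly_Mapping.keys ?k \<subseteq> Var ` E"
    using keys_sum[of "\<lambda>j. Poly_Mapping.single (Var j) (k j)" E] by (auto split: if_splits)
  have "Poly_Mapping.lookup ?k (Var i) = k i" if "i \<in> E" for i
    using that assms(1) by (simp add: lookup_sum lookup_single when_def)
  then have "exp (m b) = mon_eval (\<lambda>i. exp (b i)) ?k" if "b \<in> RR E" for b
    using that by (simp add: k mon_eval_exp[OF assms(1) keys])
  then show ?thesis using keys by blast
qed

lemma laurent_on_iff:
  assumes "finite E" "C \<subseteq> RR E"
  shows "laurent_on E C f \<longleftrightarrow> (\<exists>(k::nat) (a :: nat \<Rightarrow> int) m. (\<forall>j\<in>{1..k}. m j \<in> int_linear E) \<and>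
         (\<forall>b\<in>C. f b = (\<Sum>j\<in>{1..k}. of_int (a j) * exp (m j b))))"
proof
  assume "laurent_on E C f"
  then obtain p where p: "p \<in> Laur E" "\<And>b. b \<in> C \<Longrightarrow> f b = leval (\<lambda>i. exp (b i)) p"
    by (auto simp: laurent_on_def)
  obtain h where h: "bij_betw h {1..card (Poly_Mapping.keys p)} (Poly_Mapping.keys p)"
    using ex_bij_betw_nat_finite_1[OF finite_keys] by blast
  define m where "m = (\<lambda>j::nat. \<lambda>b\<in>RR E. \<Sum>i\<in>E. of_int (Poly_Mapping.lookup (h j) (Var i)) * b i)"
  have "m j \<in> int_linear E" for j
    unfolding int_linear_eq[OF assms(1)] m_def
    by (rule image_eqI[where x = "\<lambda>i. Poly_Mapping.lookup (h j) (Var i)"]) simp_all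
  moreover have "f b = (\<Sum>j\<in>{1..card (Poly_Mapping.keys p)}. of_int (Poly_Mapping.lookup p (h j)) * exp (m j b))"
    if "b \<in> C" for b
    using that assms(2) by (subst p(2)[OF that], subst leval_exp_sum[OF assms(1) p(1)],
       subst sum.reindex_bij_betw[OF h, symmetric]) (auto simp: m_def)
  ultimately show "\<exists>(k::nat) (a :: nat \<Rightarrow> int) m. (\<forall>j\<in>{1..k}. m j \<in> int_linear E) \<and>
         (\<forall>b\<in>C. f b = (\<Sum>j\<in>{1..k}. of_int (a j) * exp (m j b)))"
    by (intro exI[of _ "card (Poly_Mapping.keys p)"] exI[of _ "\<lambda>j. Poly_Mapping.lookup p (h j)"] exI[of _ m]) auto
next
  assume "\<exists>(k::nat) (a :: nat \<Rightarrow> int) m. (\<forall>j\<in>{1..k}. m j \<in> int_linear E) \<and>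
         (\<forall>b\<in>C. f b = (\<Sum>j\<in>{1..k}. of_int (a j) * exp (m j b)))"
  then obtain k :: nat and a :: "nat \<Rightarrow> int" and m where m: "\<And>j. j \<in> {1..k} \<Longrightarrow> m j \<in> int_linear E"
    and f: "\<And>b. b \<in> C \<Longrightarrow> f b = (\<Sum>j\<in>{1..k}. of_int (a j) * exp (m j b))" by blast
  have "\<forall>j\<in>{1..k}. \<exists>l. Poly_Mapping.keys l \<subseteq> Var ` E \<and> (\<forall>b\<in>RR E. exp (m j b) = mon_eval (\<lambda>i. exp (b i)) l)"
    using int_linear_lmon[OF assms(1) m] by blast
  then obtain l where l: "\<And>j. j \<in> {1..k} \<Longrightarrow> Poly_Mapping.keys (l j) \<subseteq> Var ` E"
    "\<And>j b. j \<in> {1..k} \<Longrightarrow> b \<in> RR E \<Longrightarrow> exp (m j b) = mon_eval (\<lambda>i. exp (b i)) (l j)"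
    using bchoice[of "{1..k}"] by metis
  define p where "p = (\<Sum>j\<in>{1..k}. of_int (a j) * lmon (l j))"
  have "p \<in> Laur E" unfolding p_def using l(1) by (intro Laur_sum Laur_mult Laur_of_int Laur_lmon) auto
  moreover have "f b = leval (\<lambda>i. exp (b i)) p" if "b \<in> C" for b
    using that assms(2) l(2) by (subst f[OF that]) (auto simp: p_def leval_sum leval_mult leval_of_int leval_lmon)
  ultimately show "laurent_on E C f" by (auto simp: laurent_on_def)
qed

lemma matroid_fan_RR: "C \<in> matroid_fan M \<Longrightarrow> C \<subseteq> RR (ground M)"
  by (auto simp: matroid_fan_def chain_cone_def RR_def)

lemma carrier_PExp:
  assumes "finite (ground M)"
  shows "carrier (PExp M) = {f \<in> extensional (fan_support M). \<forall>C\<in>matroid_fan M. laurent_on (ground M) C f}"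
proof -
  note eq = laurent_on_iff[OF assms matroid_fan_RR]
  show ?thesis by (auto simp: PExp_def PiE_def eq simp del: One_nat_def)
qed

lemma laurent_on_chain_cone:
  assumes "finite (ground M)" "\<C> \<in> flat_chains M" "f \<in> PLaur (ground M)"
  shows "laurent_on (ground M) (chain_cone (ground M) \<C>) (plaur_fun (ground M) f)"
proof -
  have C: "\<C> \<subseteq> nonempty_subsets (ground M)" "chain\<^sub>\<subseteq> \<C>"
    using assms(2) flats_nonempty_subsets[of M] by (auto simp: flat_chains_def flats_def)
  obtain xs where xs: "xs \<in> permutations_of_set (ground M)"
    "\<forall>c. (\<forall>T\<in>\<C>. T \<noteq> ground M \<longrightarrow> c T \<ge> 0) \<longrightarrow>
       (\<lambda>i\<in>ground M. \<Sum>T\<in>\<C>. c T * evec (ground M) T i) \<in> cone (ground M) xs"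
    using chain_common_cone[OF assms(1) C] by (elim bexE)
  have "chain_cone (ground M) \<C> \<subseteq> cone (ground M) xs"
    using xs(2) by (auto simp: chain_cone_def)
  then show ?thesis
    unfolding laurent_on_def
    using plaur_fun_cone[OF assms(1,3) xs(1)] PLaur_mem_Laur[OF assms(1,3) xs(1)] by blast
qed

lemma restrict_plaur_fun_PExp:
  assumes "finite (ground M)" "f \<in> PLaur (ground M)"
  shows "restrict (plaur_fun (ground M) f) (fan_support M) \<in> carrier (PExp M)"
proof -
  have "laurent_on (ground M) C (restrict (plaur_fun (ground M) f) (fan_support M))" if C: "C \<in> matroid_fan M" for C
  proof -
    have "C \<subseteq> fan_support M" using C by (auto simp: fan_support_def)
    moreover have "laurent_on (ground M) C (plaur_fun (ground M) f)"
      using C laurent_on_chain_cone[OF assms(1) _ assms(2)] by (auto simp: matroid_fan_def)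
    ultimately show ?thesis unfolding laurent_on_def by (metis restrict_apply' subsetD)
  qed
  then show ?thesis by (simp add: carrier_PExp[OF assms(1)])
qed

text \<open>Points of the support have nonzero coordinates at flats only, so truncation to the flats
  fixes them and \<open>exp_span\<close> yields exponents supported on flats.\<close>

lemma PExp_span:
  assumes "finite (ground M)" "h \<in> carrier (PExp M)"
  obtains cs where "\<And>c a T. (c, a) \<in> set cs \<Longrightarrow> T \<notin> flats M \<Longrightarrow> a T = 0"
    "\<And>b. b \<in> fan_support M \<Longrightarrow> h b = exp_comb (ground M) cs b"
proof -
  have "\<exists>cs. (\<forall>(c, a)\<in>set cs. \<forall>T. T \<notin> flats M \<longrightarrow> a T = 0) \<and>
      (\<forall>b\<in>fan_support M. h (coord_proj (ground M) (flats M) b) = exp_comb (ground M) cs b)"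
  proof (rule exp_span[OF assms(1) _ flats_nonempty_subsets])
    show "fan_support M \<subseteq> RR (ground M)" using fan_support_props[OF assms(1)] by blast
    fix C assume C: "C \<subseteq> flats M" "chain\<^sub>\<subseteq> C"
    then have fc: "C \<in> flat_chains M" by (auto simp: flat_chains_def flats_def)
    then have "laurent_on (ground M) (chain_cone (ground M) C) h"
      using assms(2) by (auto simp: carrier_PExp[OF assms(1)] matroid_fan_def)
    moreover have "coord_proj (ground M) C b \<in> chain_cone (ground M) C" if "b \<in> fan_support M" for b
      using fan_support_props(2)[OF assms(1) that] C(1) flats_nonempty_subsets by (intro coord_proj_chain_cone) blast
    ultimately show "\<exists>p\<in>Laur (ground M). \<forall>b\<in>fan_support M.
        h (coord_proj (ground M) C b) = leval (\<lambda>i. exp (coord_proj (ground M) C b i)) p"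
      by (auto simp: laurent_on_def)
  qed
  then obtain cs where "\<forall>(c, a)\<in>set cs. \<forall>T. T \<notin> flats M \<longrightarrow> a T = 0"
    "\<forall>b\<in>fan_support M. h (coord_proj (ground M) (flats M) b) = exp_comb (ground M) cs b" by blast
  then show ?thesis
    using that[of cs] coord_proj_flats[OF assms(1)] by auto
qed

section \<open>The function Q\<close>

lemma braid_weight_prod:
  assumes "\<And>a. x a \<noteq> 0"
  shows "braid_weight x xs = (\<Prod>i<length xs - 1. 1 / (1 - x (xs ! Suc i) / x (xs ! i)))"
proof (induction xs)
  case (Cons a as)
  show ?case
  proof (cases as)
    case (Cons c cs)
    have "x a / (x a - x c) = 1 / (1 - x c / x a)"
      using assms[of a] by (simp add: divide_simps)
    then show ?thesis
      using Cons.IH by (simp add: Cons prod.lessThan_Suc_shift del: prod.lessThan_Suc)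
  qed (use assms in simp)
qed simp

lemma nonbasis_weight_prod:
  "nonbasis_weight x r S zs = (\<Prod>i<length zs. nonbasis_factor x r (S \<union> set (take i zs)) (zs ! i))"
proof (induction zs arbitrary: S)
  case (Cons z zs)
  then show ?case by (simp add: prod.lessThan_Suc_shift del: prod.lessThan_Suc)
qed simp

lemma nonbasis_weight_greedy_basis:
  assumes "xs \<in> permutations_of_set (ground M)"
  shows "nonbasis_weight x (rk M) {} xs = (\<Prod>i\<in>ground M - greedy_basis M (perm_fun xs). 1 - x i)"
proof -
  have xs: "distinct xs" "set xs = ground M" and n: "card (ground M) = length xs"
    using assms length_finite_permutations_of_set[OF assms] by (auto simp: permutations_of_set_def)
  have img: "perm_fun xs ` {1..Suc i} = insert (xs ! i) (set (take i xs))"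
    "perm_fun xs ` {1..<Suc i} = set (take i xs)" if "i < length xs" for i
    using that perm_fun_image[of "Suc i" xs] perm_fun_image[of i xs]
    by (simp_all add: take_Suc_conv_app_nth atLeastLessThanSuc_atLeastAtMost)
  have mem: "xs ! i \<in> greedy_basis M (perm_fun xs) \<longleftrightarrow>
      rk M (set (take i xs)) < rk M (insert (xs ! i) (set (take i xs)))" (is "?L \<longleftrightarrow> ?R") if i: "i < length xs" for i
  proof
    assume ?L
    then obtain j where j: "xs ! i = perm_fun xs j" "j \<in> {1..length xs}"
      "rk M (perm_fun xs ` {1..<j}) < rk M (perm_fun xs ` {1..j})"
      by (auto simp: greedy_basis_def n)
    then obtain j' where "j = Suc j'" "j' < length xs" by (cases j) auto
    moreover from this have "j' = i" using j(1) i xs(1) by (simp add: perm_fun_nth nth_eq_iff_index_eq)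
    ultimately show ?R using j(3) img[OF i] by simp
  next
    assume ?R
    then have "rk M (perm_fun xs ` {1..<Suc i}) < rk M (perm_fun xs ` {1..Suc i})" using img[OF i] by simp
    moreover have "xs ! i = perm_fun xs (Suc i)" "Suc i \<in> {1..card (ground M)}"
      using i n by (simp_all add: perm_fun_nth)
    ultimately show ?L unfolding greedy_basis_def by blast
  qed
  have "nonbasis_weight x (rk M) {} xs =
     (\<Prod>i<length xs. if xs ! i \<in> greedy_basis M (perm_fun xs) then 1 else 1 - x (xs ! i))"
    unfolding nonbasis_weight_prod by (intro prod.cong) (auto simp: nonbasis_factor_def mem)
  also have "\<dots> = (\<Prod>e\<in>set xs. if e \<in> greedy_basis M (perm_fun xs) then 1 else 1 - x e)"
    by (rule prod.reindex_bij_betw[OF bij_betw_nth]) (use xs in auto)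
  also have "\<dots> = (\<Prod>e\<in>ground M - greedy_basis M (perm_fun xs). 1 - x e)"
    unfolding xs(2)[symmetric] by (rule prod.mono_neutral_cong_right) auto
  finally show ?thesis .
qed

lemma Q_frac_eq:
  assumes "finite (ground M)"
  shows "Q_frac M f = (\<Sum>xs\<in>permutations_of_set (ground M). to_frac (f (perm_fun xs)) *
     (braid_weight fvar xs * nonbasis_weight fvar (rk M) {} xs))"
  unfolding Q_frac_def sum_bijs[OF assms]
proof (rule sum.cong[OF refl])
  fix xs assume xs: "xs \<in> permutations_of_set (ground M)"
  have n: "card (ground M) = length xs" using length_finite_permutations_of_set[OF xs] by simp
  have "(\<Prod>i\<in>{1..<length xs}. 1 - fvar (perm_fun xs (Suc i)) / fvar (perm_fun xs i)) =
     (\<Prod>i<length xs - 1. 1 - fvar (xs ! Suc i) / fvar (xs ! i))"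
  proof -
    have "{1..<length xs} = Suc ` {..<length xs - 1}"
      by (cases xs) (simp_all add: lessThan_atLeast0 image_Suc_atLeastLessThan)
    then show ?thesis by (simp add: prod.reindex perm_fun_nth)
  qed
  then have "1 / (\<Prod>i\<in>{1..<length xs}. 1 - fvar (perm_fun xs (Suc i)) / fvar (perm_fun xs i)) = braid_weight fvar xs"
    by (simp add: braid_weight_prod[OF fvar_nonzero] prod_dividef)
  then show "to_frac (f (perm_fun xs)) *
     (1 / (\<Prod>i\<in>{1..<card (ground M)}. 1 - fvar (perm_fun xs (Suc i)) / fvar (perm_fun xs i))) *
     (\<Prod>i\<in>ground M - greedy_basis M (perm_fun xs). 1 - fvar i) = to_frac (f (perm_fun xs)) *
     (braid_weight fvar xs * nonbasis_weight fvar (rk M) {} xs)"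
    by (simp add: n nonbasis_weight_greedy_basis[OF xs] mult.assoc)
qed

lemma Q_frac_add:
  assumes "finite (ground M)"
  shows "Q_frac M (\<lambda>\<sigma>\<in>bijs (ground M). f \<sigma> + g \<sigma>) = Q_frac M f + Q_frac M g"
  unfolding Q_frac_eq[OF assms] sum.distrib[symmetric]
  by (intro sum.cong) (simp_all add: bijs_eq[OF assms] to_frac_add distrib_right)

lemma Q_frac_scale:
  assumes "finite (ground M)"
  shows "Q_frac M (\<lambda>\<sigma>\<in>bijs (ground M). c * f \<sigma>) = to_frac c * Q_frac M f"
  unfolding Q_frac_eq[OF assms] sum_distrib_left
  by (intro sum.cong) (simp_all add: bijs_eq[OF assms] to_frac_mult mult.assoc)

lemma Q_frac_plaur_exp:
  assumes "finite (ground M)"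
  shows "Q_frac M (plaur_exp (ground M) a) = flag_sum (rk M) (a({} := 0)) {} (ground M)"
  unfolding Q_frac_eq[OF assms] flag_sum_def
  by (intro sum.cong) (simp_all add: plaur_exp_perm_fun[OF assms])

definition Q_value :: "'a matroid \<Rightarrow> ((nat \<Rightarrow> 'a) \<Rightarrow> 'a laurent) \<Rightarrow> real" where
  "Q_value M f = frac_value (Q_frac M f)"

text \<open>Sums of exponentials reduce the claim to flag sums.\<close>

lemma Q_frac_Laurent:
  assumes "matroid M" "f \<in> PLaur (ground M)"
  shows "Q_frac M f \<in> to_frac ` Laur (ground M)"
proof -
  have fin: "finite (ground M)" using assms(1) by (simp add: matroid_def)
  have "Q_frac M (plaur_comb (ground M) cs) \<in> to_frac ` Laur (ground M)" for cs
  proof (induction cs)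
    case Nil
    have "Q_frac M (plaur_comb (ground M) []) = to_frac 0"
      unfolding Q_frac_eq[OF fin] by (simp add: plaur_comb_Nil bijs_eq[OF fin] to_frac_zero)
    then show ?case by auto
  next
    case (Cons ca cs)
    obtain c a where ca: "ca = (c, a)" by (cases ca)
    obtain p where p: "p \<in> Laur (ground M)" "Q_frac M (plaur_comb (ground M) cs) = to_frac p"
      using Cons by auto
    obtain q where q: "q \<in> Laur (ground M)" "flag_sum (rk M) (a({} := 0)) {} (ground M) = to_frac q"
      using flag_sum_Laurent[OF rank_fun_matroid[OF assms(1)], of "{}" "ground M" "a({} := 0)"] by auto
    have "Q_frac M (plaur_comb (ground M) (ca # cs)) = to_frac (of_int c * q + p)"
      by (simp only: ca plaur_comb_Cons Q_frac_add[OF fin] Q_frac_scale[OF fin] Q_frac_plaur_exp[OF fin]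
          p q to_frac_add to_frac_mult)
    then show ?case using p(1) q(1) by (auto intro!: imageI Laur_add Laur_mult Laur_of_int)
  qed
  then show ?thesis using PLaur_span[OF fin assms(2)] by metis
qed

lemma leval_Q:
  assumes "matroid M" "f \<in> PLaur (ground M)"
  shows "leval (\<lambda>_. 1) (Q M f) = Q_value M f"
proof -
  obtain q where q: "q \<in> Laur (ground M)" "Q_frac M f = to_frac q"
    using Q_frac_Laurent[OF assms] by auto
  then have "Q M f = q" unfolding Q_def by (intro the_equality) (auto simp: to_frac_eq_iff)
  then show ?thesis by (simp add: Q_value_def q frac_value_to_frac)
qed

lemma Q_value_int: "matroid M \<Longrightarrow> f \<in> PLaur (ground M) \<Longrightarrow> \<exists>k::int. Q_value M f = of_int k"
  using leval_Q leval_int by metis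

lemma Q_value_add:
  assumes "matroid M" "f \<in> PLaur (ground M)" "g \<in> PLaur (ground M)"
  shows "Q_value M (\<lambda>\<sigma>\<in>bijs (ground M). f \<sigma> + g \<sigma>) = Q_value M f + Q_value M g"
proof -
  have fin: "finite (ground M)" using assms(1) by (simp add: matroid_def)
  obtain p q where "Q_frac M f = to_frac p" "Q_frac M g = to_frac q"
    using Q_frac_Laurent[OF assms(1,2)] Q_frac_Laurent[OF assms(1,3)] by auto
  then show ?thesis
    by (simp add: Q_value_def Q_frac_add[OF fin] frac_value_to_frac leval_add flip: to_frac_add)
qed

lemma Q_value_scale:
  assumes "matroid M" "f \<in> PLaur (ground M)"
  shows "Q_value M (\<lambda>\<sigma>\<in>bijs (ground M). c * f \<sigma>) = leval (\<lambda>_. 1) c * Q_value M f"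
proof -
  have fin: "finite (ground M)" using assms(1) by (simp add: matroid_def)
  obtain p where "Q_frac M f = to_frac p"
    using Q_frac_Laurent[OF assms] by auto
  then show ?thesis
    by (simp add: Q_value_def Q_frac_scale[OF fin] frac_value_to_frac leval_mult flip: to_frac_mult)
qed

lemma Q_value_plaur_exp:
  "matroid M \<Longrightarrow> Q_value M (plaur_exp (ground M) a) = flag_value (rk M) (a({} := 0)) {} (ground M)"
  by (simp add: Q_value_def Q_frac_plaur_exp flag_value_def matroid_def)

lemma Q_value_plaur_comb:
  assumes "matroid M"
  shows "Q_value M (plaur_comb (ground M) cs) =
    (\<Sum>(c, a)\<leftarrow>cs. of_int c * flag_value (rk M) (a({} := 0)) {} (ground M))"
proof (induction cs)
  case Nil
  have fin: "finite (ground M)" using assms by (simp add: matroid_def)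
  have "Q_frac M (plaur_comb (ground M) []) = to_frac 0"
    unfolding Q_frac_eq[OF fin] by (simp add: plaur_comb_Nil bijs_eq[OF fin] to_frac_zero)
  then show ?case by (simp add: Q_value_def frac_value_to_frac)
next
  case (Cons ca cs)
  have fin: "finite (ground M)" using assms by (simp add: matroid_def)
  obtain c a where ca: "ca = (c, a)" by (cases ca)
  have "Q_value M (plaur_comb (ground M) (ca # cs)) =
     leval (\<lambda>_. 1) (of_int c :: 'a laurent) * Q_value M (plaur_exp (ground M) a) + Q_value M (plaur_comb (ground M) cs)"
    unfolding ca plaur_comb_Cons
    by (subst Q_value_add[OF assms PLaur_scale[OF fin plaur_exp_PLaur[OF fin] Laur_of_int] plaur_comb_PLaur[OF fin]],
        subst Q_value_scale[OF assms plaur_exp_PLaur[OF fin]]) (rule refl)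
  then show ?case using Cons by (simp add: ca leval_of_int Q_value_plaur_exp[OF assms] fun_upd_def)
qed

section \<open>The functional on the K-ring\<close>

lemma bdelta_coord_proj:
  assumes "finite E" "b \<in> RR E" "S \<subseteq> nonempty_subsets E" "U \<in> nonempty_subsets E"
  shows "bdelta E U (coord_proj E S b) = (if U \<in> S then bdelta E U b else 0)"
proof -
  \<comment> \<open>S itself is arbitrary, but its members with nonzero coordinate at b form a
    chain, as \<open>chain_bdelta\<close> requires.\<close>
  define C where "C = {T \<in> S. bdelta E T b \<noteq> 0}"
  have "chain\<^sub>\<subseteq> C"
    unfolding chain_subset_def
  proof (intro ballI)
    fix T V assume "T \<in> C" "V \<in> C"
    then show "T \<subseteq> V \<or> V \<subseteq> T"
      using bdelta_incomparable[OF assms(1,2), of T V] assms(3)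
      by (auto simp: C_def nonempty_subsets_def)
  qed
  moreover have "C \<subseteq> nonempty_subsets E" using assms(3) by (auto simp: C_def)
  moreover have "coord_proj E C b = coord_proj E S b"
    using finite_nonempty_subsets[OF assms(1)] assms(3)
    by (intro coord_proj_superset) (auto simp: C_def intro: finite_subset)
  moreover have "bdelta E U (\<lambda>i\<in>E. \<Sum>T\<in>C. bdelta E T b * evec E T i) = (if U \<in> C then bdelta E U b else 0)"
    by (rule chain_bdelta[OF assms(1) calculation(2,1) bdelta_nonneg assms(4)])
  ultimately have "bdelta E U (coord_proj E S b) = (if U \<in> C then bdelta E U b else 0)"
    by (simp add: coord_proj_def)
  then show ?thesis by (auto simp: C_def)
qed

lemma flat_iff_rk:
  "flat M F \<longleftrightarrow> F \<subseteq> ground M \<and> (\<forall>i\<in>ground M - F. rk M F < rk M (insert i F))"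
  by (simp add: flat_def)

lemma flag_value_flats:
  assumes "matroid M"
  shows "flag_value (rk M) ((\<lambda>T. if T \<in> flats M then a T else 0)({} := 0)) {} (ground M) =
    flag_value (rk M) (a({} := 0)) {} (ground M)"
  by (rule flag_value_nonflat[OF rank_fun_matroid[OF assms]]) (auto simp: flats_def flat_iff_rk)

text \<open>Only the coefficients at flats matter for the value of \<open>Q\<close>, and the combination \<open>g\<close> of the
  exponentials with all other coefficients removed is determined by the restriction to the fan.\<close>

lemma Q_value_eq_0:
  assumes "matroid M" "ground M \<noteq> {}" "f \<in> PLaur (ground M)"
    and zero: "\<And>b. b \<in> fan_support M \<Longrightarrow> plaur_fun (ground M) f b = 0"
  shows "Q_value M f = 0"
proof -
  have fin: "finite (ground M)" using assms(1) by (simp add: matroid_def)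
  obtain cs where cs: "f = plaur_comb (ground M) cs" using PLaur_span[OF fin assms(3)] .
  define F where "F = (\<lambda>a T. if T \<in> flats M then a T else 0 :: int)"
  define g where "g = plaur_comb (ground M) (map (\<lambda>(c, a). (c, F a)) cs)"
  have "g = plaur_comb (ground M) []"
  proof (rule PLaur_eqI[OF fin])
    show "g \<in> PLaur (ground M)" "plaur_comb (ground M) [] \<in> PLaur (ground M)"
      by (simp_all add: g_def plaur_comb_PLaur[OF fin])
    fix b assume b: "b \<in> RR (ground M)" "\<And>i. i \<in> ground M \<Longrightarrow> b i \<ge> 0"
    let ?b = "coord_proj (ground M) (flats M) b"
    \<comment> \<open>Here the nonnegativity of b enters: it makes the truncated point land in the
      fan support.\<close>
    have "bdelta (ground M) (ground M) b \<ge> 0"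
      using b(2) fin assms(2) by (simp add: bdelta_def)
    then have "?b \<in> fan_support M" by (rule coord_proj_fan_support[OF fin b(1)])
    \<comment> \<open>Dropping the coefficients off the flats has the same effect at b as keeping
      all of them and truncating b.\<close>
    have "plin_of_coeffs (ground M) (F a) b = plin_of_coeffs (ground M) a ?b" for a
      using b(1) coord_proj_RR
      by (auto simp: plin_of_coeffs_eq[OF fin] F_def bdelta_coord_proj[OF fin b(1) flats_nonempty_subsets]
          intro!: sum.cong)
    then have "plaur_fun (ground M) g b = plaur_fun (ground M) f ?b"
      unfolding g_def cs plaur_fun_comb[OF fin b(1)] plaur_fun_comb[OF fin coord_proj_RR]
      by (simp add: case_prod_unfold comp_def)
    also have "\<dots> = 0" by (rule zero) fact
    also have "\<dots> = plaur_fun (ground M) (plaur_comb (ground M) []) b"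
      by (simp add: plaur_fun_comb[OF fin b(1)])
    finally show "plaur_fun (ground M) g b = plaur_fun (ground M) (plaur_comb (ground M) []) b" .
  qed
  then have "Q_value M g = 0" by (simp add: Q_value_plaur_comb[OF assms(1)])
  moreover have "Q_value M g = Q_value M f"
    unfolding g_def cs Q_value_plaur_comb[OF assms(1)]
    by (simp add: F_def flag_value_flats[OF assms(1)] case_prod_unfold comp_def)
  ultimately show ?thesis by simp
qed

lemma plaur_fun_add:
  assumes "finite E" "f \<in> PLaur E" "g \<in> PLaur E" "b \<in> RR E"
  shows "plaur_fun E (\<lambda>\<sigma>\<in>bijs E. f \<sigma> + g \<sigma>) b = plaur_fun E f b + plaur_fun E g b"
proof -
  obtain xs where xs: "xs \<in> permutations_of_set E" "b \<in> cone E xs" using cone_exists[OF assms(1,4)] .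
  then have "perm_fun xs \<in> bijs E" by (simp add: bijs_eq[OF assms(1)])
  then show ?thesis
    using plaur_fun_cone[OF assms(1) _ xs] PLaur_add[OF assms(1-3)] assms by (simp add: leval_add)
qed

lemma plaur_fun_scale:
  assumes "finite E" "f \<in> PLaur E" "c \<in> Laur E" "b \<in> RR E"
  shows "plaur_fun E (\<lambda>\<sigma>\<in>bijs E. c * f \<sigma>) b = leval (\<lambda>i. exp (b i)) c * plaur_fun E f b"
proof -
  obtain xs where xs: "xs \<in> permutations_of_set E" "b \<in> cone E xs" using cone_exists[OF assms(1,4)] .
  then have "perm_fun xs \<in> bijs E" by (simp add: bijs_eq[OF assms(1)])
  then show ?thesis
    using plaur_fun_cone[OF assms(1) _ xs] PLaur_scale[OF assms(1-3)] assms by (simp add: leval_mult)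
qed

lemma plaur_fun_plaur_exp:
  assumes "finite E" "b \<in> RR E"
  shows "plaur_fun E (plaur_exp E a) b = exp (plin_of_coeffs E a b)"
proof -
  obtain xs where xs: "xs \<in> permutations_of_set E" "b \<in> cone E xs" using cone_exists[OF assms] .
  then show ?thesis
    using plaur_fun_cone[OF assms(1) plaur_exp_PLaur[OF assms(1)] xs] exp_plin_of_coeffs[OF assms(1) xs] by simp
qed

lemma Q_value_cong:
  assumes "matroid M" "ground M \<noteq> {}" "f \<in> PLaur (ground M)" "g \<in> PLaur (ground M)"
    and "\<And>b. b \<in> fan_support M \<Longrightarrow> plaur_fun (ground M) f b = plaur_fun (ground M) g b"
  shows "Q_value M f = Q_value M g"
proof -
  have fin: "finite (ground M)" using assms(1) by (simp add: matroid_def)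
  have m1: "(- 1 :: 'a laurent) \<in> Laur (ground M)" by (rule Laur_uminus[OF Laur_one])
  let ?g = "\<lambda>\<sigma>\<in>bijs (ground M). - 1 * g \<sigma>"
  have g: "?g \<in> PLaur (ground M)" by (rule PLaur_scale[OF fin assms(4) m1])
  have "Q_value M (\<lambda>\<sigma>\<in>bijs (ground M). f \<sigma> + ?g \<sigma>) = 0"
  proof (rule Q_value_eq_0[OF assms(1,2) PLaur_add[OF fin assms(3) g]])
    fix b assume b: "b \<in> fan_support M"
    then have "b \<in> RR (ground M)" by (rule fan_support_props[OF fin])
    then show "plaur_fun (ground M) (\<lambda>\<sigma>\<in>bijs (ground M). f \<sigma> + ?g \<sigma>) b = 0"
      using assms(5)[OF b]
      unfolding plaur_fun_add[OF fin assms(3) g \<open>b \<in> RR (ground M)\<close>]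
        plaur_fun_scale[OF fin assms(4) m1 \<open>b \<in> RR (ground M)\<close>] by (simp add: leval_uminus)
  qed
  then show ?thesis
    unfolding Q_value_add[OF assms(1,3) g] Q_value_scale[OF assms(1,4)] by (simp add: leval_uminus)
qed

section \<open>The ring of piecewise exponential functions and the ideal\<close>

lemma laurent_on_add: "laurent_on E C f \<Longrightarrow> laurent_on E C g \<Longrightarrow> laurent_on E C (\<lambda>b. f b + g b)"
  unfolding laurent_on_def by (metis Laur_add leval_add)

lemma laurent_on_mult:
  assumes "laurent_on E C f" "laurent_on E C g"
  shows "laurent_on E C (\<lambda>b. f b * g b)"
proof -
  obtain p q where "p \<in> Laur E" "\<forall>b\<in>C. f b = leval (\<lambda>i. exp (b i)) p"
    "q \<in> Laur E" "\<forall>b\<in>C. g b = leval (\<lambda>i. exp (b i)) q"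
    using assms unfolding laurent_on_def by blast
  then show ?thesis
    unfolding laurent_on_def by (intro bexI[of _ "p * q"]) (auto simp: leval_mult Laur_mult)
qed

lemma laurent_on_of_int: "laurent_on E C (\<lambda>b. of_int c)"
  unfolding laurent_on_def by (intro bexI[of _ "of_int c"]) (auto simp: leval_of_int Laur_of_int)

lemma laurent_on_cong: "laurent_on E C f \<Longrightarrow> (\<And>b. b \<in> C \<Longrightarrow> f b = g b) \<Longrightarrow> laurent_on E C g"
  unfolding laurent_on_def by auto

lemma PExp_memI:
  assumes "finite (ground M)" "\<And>C. C \<in> matroid_fan M \<Longrightarrow> laurent_on (ground M) C f"
  shows "restrict f (fan_support M) \<in> carrier (PExp M)"
proof -
  have "laurent_on (ground M) C (restrict f (fan_support M))" if "C \<in> matroid_fan M" for C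
    by (rule laurent_on_cong[OF assms(2)[OF that]]) (use that in \<open>auto simp: fan_support_def\<close>)
  then show ?thesis by (simp add: carrier_PExp[OF assms(1)])
qed

lemma PExp_ops:
  "f \<otimes>\<^bsub>PExp M\<^esub> g = (\<lambda>b\<in>fan_support M. f b * g b)"
  "f \<oplus>\<^bsub>PExp M\<^esub> g = (\<lambda>b\<in>fan_support M. f b + g b)"
  "\<one>\<^bsub>PExp M\<^esub> = (\<lambda>b\<in>fan_support M. 1)"
  "\<zero>\<^bsub>PExp M\<^esub> = (\<lambda>b\<in>fan_support M. 0)"
  by (simp_all add: PExp_def)

lemma PExp_extensional: "finite (ground M) \<Longrightarrow> f \<in> carrier (PExp M) \<Longrightarrow> f \<in> extensional (fan_support M)"
  by (simp add: carrier_PExp)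

lemma cring_PExp:
  assumes "finite (ground M)"
  shows "cring (PExp M)"
proof -
  have L: "laurent_on (ground M) C f" if "f \<in> carrier (PExp M)" "C \<in> matroid_fan M" for f C
    using that by (simp add: carrier_PExp[OF assms])
  have add: "x \<oplus>\<^bsub>PExp M\<^esub> y \<in> carrier (PExp M)" if "x \<in> carrier (PExp M)" "y \<in> carrier (PExp M)" for x y
    unfolding PExp_ops by (intro PExp_memI assms laurent_on_add L that)
  have mult: "x \<otimes>\<^bsub>PExp M\<^esub> y \<in> carrier (PExp M)" if "x \<in> carrier (PExp M)" "y \<in> carrier (PExp M)" for x y
    unfolding PExp_ops by (intro PExp_memI assms laurent_on_mult L that)
  have const: "(\<lambda>b\<in>fan_support M. of_int c) \<in> carrier (PExp M)" for c
    by (intro PExp_memI assms laurent_on_of_int)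
  have ext: "x \<in> extensional (fan_support M)" if "x \<in> carrier (PExp M)" for x
    by (rule PExp_extensional[OF assms that])
  show ?thesis
  proof (rule cringI)
    show "abelian_group (PExp M)"
    proof (rule abelian_groupI)
      show "\<zero>\<^bsub>PExp M\<^esub> \<in> carrier (PExp M)" using const[of 0] by (simp add: PExp_ops)
      fix x assume x: "x \<in> carrier (PExp M)"
      show "\<zero>\<^bsub>PExp M\<^esub> \<oplus>\<^bsub>PExp M\<^esub> x = x"
        using ext[OF x] by (auto simp: PExp_ops fun_eq_iff extensional_def)
      have "(\<lambda>b\<in>fan_support M. of_int (- 1)) \<otimes>\<^bsub>PExp M\<^esub> x \<in> carrier (PExp M)"
        by (rule mult[OF const x])
      moreover have "((\<lambda>b\<in>fan_support M. of_int (- 1)) \<otimes>\<^bsub>PExp M\<^esub> x) \<oplus>\<^bsub>PExp M\<^esub> x = \<zero>\<^bsub>PExp M\<^esub>"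
        by (auto simp: PExp_ops fun_eq_iff)
      ultimately show "\<exists>y\<in>carrier (PExp M). y \<oplus>\<^bsub>PExp M\<^esub> x = \<zero>\<^bsub>PExp M\<^esub>" by blast
    qed (auto simp: add, auto simp: PExp_ops fun_eq_iff)
    show "comm_monoid (PExp M)"
    proof (rule comm_monoidI)
      show "\<one>\<^bsub>PExp M\<^esub> \<in> carrier (PExp M)" using const[of 1] by (simp add: PExp_ops)
      show "\<one>\<^bsub>PExp M\<^esub> \<otimes>\<^bsub>PExp M\<^esub> x = x" if "x \<in> carrier (PExp M)" for x
        using ext[OF that] by (auto simp: PExp_ops fun_eq_iff extensional_def)
    qed (auto simp: mult, auto simp: PExp_ops fun_eq_iff)
  qed (auto simp: PExp_ops fun_eq_iff algebra_simps)
qed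

abbreviation plaur_restr :: "'a matroid \<Rightarrow> ((nat \<Rightarrow> 'a) \<Rightarrow> 'a laurent) \<Rightarrow> ('a \<Rightarrow> real) \<Rightarrow> real" where
  "plaur_restr M f \<equiv> restrict (plaur_fun (ground M) f) (fan_support M)"

text \<open>Exponents supported on flats make sense on all of R^E, so the combination from
  \<open>PExp_span\<close> is a lift. This is the surjectivity of \<open>phi\<close> before passing
  to classes.\<close>

lemma PExp_plaur:
  assumes "finite (ground M)" "h \<in> carrier (PExp M)"
  obtains f where "f \<in> PLaur (ground M)" "plaur_restr M f = h"
proof -
  obtain cs where cs: "\<And>b. b \<in> fan_support M \<Longrightarrow> h b = exp_comb (ground M) cs b"
    using PExp_span[OF assms] by metis
  have "plaur_restr M (plaur_comb (ground M) cs) = h"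
  proof (rule extensionalityI)
    show "h \<in> extensional (fan_support M)" using PExp_extensional[OF assms] .
    fix b assume b: "b \<in> fan_support M"
    then show "plaur_restr M (plaur_comb (ground M) cs) b = h b"
      using fan_support_props(1)[OF assms(1) b] cs[OF b] by (simp add: plaur_fun_comb[OF assms(1)] exp_comb_def)
  qed simp
  then show ?thesis using that plaur_comb_PLaur[OF assms(1)] by blast
qed

lemma Q_value_restr_cong:
  assumes "matroid M" "ground M \<noteq> {}" "f \<in> PLaur (ground M)" "g \<in> PLaur (ground M)"
    and "plaur_restr M f = plaur_restr M g"
  shows "Q_value M f = Q_value M g"
  by (rule Q_value_cong[OF assms(1-4)]) (metis assms(5) restrict_apply')

lemma plaur_restr_add:
  assumes "finite (ground M)" "f \<in> PLaur (ground M)" "g \<in> PLaur (ground M)"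
  shows "plaur_restr M (\<lambda>\<sigma>\<in>bijs (ground M). f \<sigma> + g \<sigma>) = plaur_restr M f \<oplus>\<^bsub>PExp M\<^esub> plaur_restr M g"
  unfolding PExp_ops
  by (rule restrict_ext) (simp add: plaur_fun_add[OF assms] fan_support_props(1)[OF assms(1)])

lemma K_generators_subset:
  assumes "finite (ground M)"
  shows "{\<lambda>b\<in>fan_support M. exp (f b) - 1 | f. f \<in> Lin_fan M} \<subseteq> carrier (PExp M)"
proof
  fix h assume "h \<in> {\<lambda>b\<in>fan_support M. exp (f b) - 1 | f. f \<in> Lin_fan M}"
  then obtain m where m: "m \<in> int_linear (ground M)"
    "h = (\<lambda>b\<in>fan_support M. exp (restrict m (fan_support M) b) - 1)"
    by (auto simp: Lin_fan_def)
  obtain k where k: "Poly_Mapping.keys k \<subseteq> Var ` ground M"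
    "\<forall>b\<in>RR (ground M). exp (m b) = mon_eval (\<lambda>i. exp (b i)) k"
    using int_linear_lmon[OF assms m(1)] by blast
  have "h = (\<lambda>b\<in>fan_support M. exp (m b) - 1)" unfolding m(2) by (rule restrict_ext) simp
  moreover have "laurent_on (ground M) C (\<lambda>b. exp (m b) - 1)" if "C \<in> matroid_fan M" for C
    unfolding laurent_on_def
    using k matroid_fan_RR[OF that]
    by (intro bexI[of _ "lmon k - 1"]) (auto simp: leval_diff leval_lmon intro: Laur_diff Laur_lmon)
  ultimately show "h \<in> carrier (PExp M)" using PExp_memI[OF assms] by metis
qed

lemma ideal_K_ideal: "finite (ground M) \<Longrightarrow> ideal (K_ideal M) (PExp M)"
  unfolding K_ideal_def
  by (rule ring.genideal_ideal[OF cring.axioms(1)[OF cring_PExp] K_generators_subset])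

text \<open>Q is linear over Laurent polynomials, so a lift of (e^m - 1) h' has value (1 - 1) times
  the value of a lift of h'.\<close>

lemma K_ideal_annihilated:
  assumes M: "matroid M" and ne: "ground M \<noteq> {}" and "f \<in> PLaur (ground M)" "plaur_restr M f \<in> K_ideal M"
  shows "Q_value M f = 0"
proof -
  have fin: "finite (ground M)" using M by (simp add: matroid_def)
  interpret R: cring "PExp M" by (rule cring_PExp[OF fin])
  \<comment> \<open>Demanding the vanishing for all multiples h h' makes J closed under
    multiplication by construction; it remains to see sums and generators.\<close>
  define J where "J = {h \<in> carrier (PExp M). \<forall>h'\<in>carrier (PExp M). \<forall>f\<in>PLaur (ground M).
     plaur_restr M f = h \<otimes>\<^bsub>PExp M\<^esub> h' \<longrightarrow> Q_value M f = 0}"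
  have zero: "Q_value M f = 0" if f: "f \<in> PLaur (ground M)" "plaur_restr M f = \<zero>\<^bsub>PExp M\<^esub>" for f
    by (rule Q_value_eq_0[OF M ne f(1)]) (metis f(2) PExp_ops(4) restrict_apply')
  have J_mult: "a \<otimes>\<^bsub>PExp M\<^esub> x \<in> J" if a: "a \<in> J" and x: "x \<in> carrier (PExp M)" for a x
    unfolding J_def
  proof (intro CollectI conjI ballI impI)
    show "a \<otimes>\<^bsub>PExp M\<^esub> x \<in> carrier (PExp M)" using a x by (simp add: J_def)
    fix h' f assume "h' \<in> carrier (PExp M)" "f \<in> PLaur (ground M)"
      "plaur_restr M f = a \<otimes>\<^bsub>PExp M\<^esub> x \<otimes>\<^bsub>PExp M\<^esub> h'"
    moreover from this have "plaur_restr M f = a \<otimes>\<^bsub>PExp M\<^esub> (x \<otimes>\<^bsub>PExp M\<^esub> h')"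
      using a x by (simp add: J_def R.m_assoc)
    ultimately show "Q_value M f = 0" using a x unfolding J_def by blast
  qed
  have "ideal J (PExp M)"
  proof (rule idealI)
    show "ring (PExp M)" by (rule R.ring_axioms)
    show "subgroup J (add_monoid (PExp M))"
    proof (rule subgroup.intro)
      show "J \<subseteq> carrier (add_monoid (PExp M))" by (auto simp: J_def)
      show "\<one>\<^bsub>add_monoid (PExp M)\<^esub> \<in> J" using zero by (auto simp: J_def)
      show "x \<otimes>\<^bsub>add_monoid (PExp M)\<^esub> y \<in> J" if x: "x \<in> J" and y: "y \<in> J" for x y
        unfolding J_def monoid.simps
      proof (intro CollectI conjI ballI impI)
        have xy: "x \<in> carrier (PExp M)" "y \<in> carrier (PExp M)" using x y by (auto simp: J_def)
        then show "x \<oplus>\<^bsub>PExp M\<^esub> y \<in> carrier (PExp M)" by simp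
        fix h' f assume h': "h' \<in> carrier (PExp M)" and f: "f \<in> PLaur (ground M)"
          "plaur_restr M f = (x \<oplus>\<^bsub>PExp M\<^esub> y) \<otimes>\<^bsub>PExp M\<^esub> h'"
        have "x \<otimes>\<^bsub>PExp M\<^esub> h' \<in> carrier (PExp M)" "y \<otimes>\<^bsub>PExp M\<^esub> h' \<in> carrier (PExp M)"
          using xy h' by simp_all
        then obtain f1 f2 where f1: "f1 \<in> PLaur (ground M)" "plaur_restr M f1 = x \<otimes>\<^bsub>PExp M\<^esub> h'"
          and f2: "f2 \<in> PLaur (ground M)" "plaur_restr M f2 = y \<otimes>\<^bsub>PExp M\<^esub> h'"
          using PExp_plaur[OF fin] by metis
        have "Q_value M f = Q_value M (\<lambda>\<sigma>\<in>bijs (ground M). f1 \<sigma> + f2 \<sigma>)"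
        proof (rule Q_value_restr_cong[OF M ne f(1) PLaur_add[OF fin f1(1) f2(1)]])
          show "plaur_restr M f = plaur_restr M (\<lambda>\<sigma>\<in>bijs (ground M). f1 \<sigma> + f2 \<sigma>)"
            unfolding plaur_restr_add[OF fin f1(1) f2(1)] f(2) f1(2) f2(2) using xy h' by (simp add: R.l_distr)
        qed
        moreover have "Q_value M f1 = 0" using x h' f1 unfolding J_def by blast
        moreover have "Q_value M f2 = 0" using y h' f2 unfolding J_def by blast
        ultimately show "Q_value M f = 0" by (simp add: Q_value_add[OF M f1(1) f2(1)])
      qed
      show "inv\<^bsub>add_monoid (PExp M)\<^esub> x \<in> J" if x: "x \<in> J" for x
      proof -
        have "x \<in> carrier (PExp M)" using x by (simp add: J_def)
        then have "\<ominus>\<^bsub>PExp M\<^esub> x = x \<otimes>\<^bsub>PExp M\<^esub> (\<ominus>\<^bsub>PExp M\<^esub> \<one>\<^bsub>PExp M\<^esub>)"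
          by (simp add: R.r_minus)
        then have "inv\<^bsub>add_monoid (PExp M)\<^esub> x = x \<otimes>\<^bsub>PExp M\<^esub> (\<ominus>\<^bsub>PExp M\<^esub> \<one>\<^bsub>PExp M\<^esub>)"
          by (simp only: a_inv_def)
        then show ?thesis using J_mult[OF x] by simp
      qed
    qed
    fix a x assume a: "a \<in> J" and x: "x \<in> carrier (PExp M)"
    then show "a \<otimes>\<^bsub>PExp M\<^esub> x \<in> J" by (rule J_mult)
    then show "x \<otimes>\<^bsub>PExp M\<^esub> a \<in> J" using a x by (metis (no_types, lifting) J_def R.m_comm mem_Collect_eq)
  qed
  moreover have "{\<lambda>b\<in>fan_support M. exp (f b) - 1 | f. f \<in> Lin_fan M} \<subseteq> J"
  proof
    fix h assume h: "h \<in> {\<lambda>b\<in>fan_support M. exp (f b) - 1 | f. f \<in> Lin_fan M}"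
    then obtain m where m: "m \<in> int_linear (ground M)"
      "h = (\<lambda>b\<in>fan_support M. exp (restrict m (fan_support M) b) - 1)"
      by (auto simp: Lin_fan_def)
    obtain k where k: "Poly_Mapping.keys k \<subseteq> Var ` ground M"
      "\<forall>b\<in>RR (ground M). exp (m b) = mon_eval (\<lambda>i. exp (b i)) k"
      using int_linear_lmon[OF fin m(1)] by blast
    have c: "lmon k - 1 \<in> Laur (ground M)" by (intro Laur_diff Laur_lmon k Laur_one)
    have c1: "leval (\<lambda>_. 1) (lmon k - 1) = 0" by (simp add: leval_diff leval_lmon)
    show "h \<in> J"
      unfolding J_def
    proof (intro CollectI conjI ballI impI)
      show "h \<in> carrier (PExp M)" using h K_generators_subset[OF fin] by blast
      fix h' f assume h': "h' \<in> carrier (PExp M)" and f: "f \<in> PLaur (ground M)"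
        "plaur_restr M f = h \<otimes>\<^bsub>PExp M\<^esub> h'"
      obtain f' where f': "f' \<in> PLaur (ground M)" "plaur_restr M f' = h'" using PExp_plaur[OF fin h'] .
      have "plaur_restr M f = plaur_restr M (\<lambda>\<sigma>\<in>bijs (ground M). (lmon k - 1) * f' \<sigma>)"
        unfolding f(2) PExp_ops f'(2)[symmetric] m(2)
      proof (rule restrict_ext)
        fix b assume b: "b \<in> fan_support M"
        then have bR: "b \<in> RR (ground M)" by (rule fan_support_props[OF fin])
        show "(\<lambda>b\<in>fan_support M. exp (restrict m (fan_support M) b) - 1) b * plaur_restr M f' b =
            plaur_fun (ground M) (\<lambda>\<sigma>\<in>bijs (ground M). (lmon k - 1) * f' \<sigma>) b"
          unfolding plaur_fun_scale[OF fin f'(1) c bR] using b bspec[OF k(2) bR] by (simp add: leval_diff leval_lmon)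
      qed
      from Q_value_restr_cong[OF M ne f(1) PLaur_scale[OF fin f'(1) c] this]
      show "Q_value M f = 0" by (simp add: Q_value_scale[OF M f'(1)] c1)
    qed
  qed
  ultimately have "K_ideal M \<subseteq> J" unfolding K_ideal_def by (rule R.genideal_minimal)
  then have "plaur_restr M f \<in> J" using assms(4) by blast
  moreover have "plaur_restr M f = plaur_restr M f \<otimes>\<^bsub>PExp M\<^esub> \<one>\<^bsub>PExp M\<^esub>"
    using restrict_plaur_fun_PExp[OF fin assms(3)] by simp
  ultimately show ?thesis using assms(3) unfolding J_def by blast
qed

section \<open>The induced functional on the quotient\<close>

lemma K_class_hom: "finite (ground M) \<Longrightarrow> K_class M \<in> ring_hom (PExp M) (K M)"
  unfolding K_def using ideal.rcos_ring_hom[OF ideal_K_ideal, of M] by (simp add: K_class_def[abs_def])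

lemma carrier_K: "carrier (K M) = K_class M ` carrier (PExp M)"
  by (auto simp: K_def FactRing_def A_RCOSETS_def' K_class_def)

lemma K_class_eq_iff:
  assumes "finite (ground M)" "a \<in> carrier (PExp M)" "b \<in> carrier (PExp M)"
  shows "K_class M a = K_class M b \<longleftrightarrow> a \<ominus>\<^bsub>PExp M\<^esub> b \<in> K_ideal M"
  unfolding K_class_def
  using ring.quotient_eq_iff_same_a_r_cos[OF cring.axioms(1)[OF cring_PExp[OF assms(1)]] ideal_K_ideal[OF assms(1)] assms(2,3)]
  by blast

lemma phi_eq_imp_Q_value_eq:
  assumes M: "matroid M" "ground M \<noteq> {}" and f: "f \<in> PLaur (ground M)" and g: "g \<in> PLaur (ground M)"
    and "phi M f = phi M g"
  shows "Q_value M f = Q_value M g"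
proof -
  have fin: "finite (ground M)" using M by (simp add: matroid_def)
  interpret R: cring "PExp M" by (rule cring_PExp[OF fin])
  note r = restrict_plaur_fun_PExp[OF fin]
  have d: "plaur_restr M f \<ominus>\<^bsub>PExp M\<^esub> plaur_restr M g \<in> K_ideal M"
    using assms(5) K_class_eq_iff[OF fin r[OF f] r[OF g]] by (simp add: phi_def)
  obtain h where h: "h \<in> PLaur (ground M)" "plaur_restr M h = plaur_restr M f \<ominus>\<^bsub>PExp M\<^esub> plaur_restr M g"
    using PExp_plaur[OF fin, of "plaur_restr M f \<ominus>\<^bsub>PExp M\<^esub> plaur_restr M g"] r f g by auto
  have "Q_value M h = 0" using K_ideal_annihilated[OF M h(1)] d h(2) by simp
  moreover have "Q_value M f = Q_value M (\<lambda>\<sigma>\<in>bijs (ground M). h \<sigma> + g \<sigma>)"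
  proof (rule Q_value_restr_cong[OF M f PLaur_add[OF fin h(1) g]])
    show "plaur_restr M f = plaur_restr M (\<lambda>\<sigma>\<in>bijs (ground M). h \<sigma> + g \<sigma>)"
      unfolding plaur_restr_add[OF fin h(1) g] h(2)
      using r[OF f] r[OF g] by (simp add: R.minus_eq R.a_assoc R.l_neg)
  qed
  ultimately show ?thesis by (simp add: Q_value_add[OF M(1) h(1) g])
qed

lemma carrier_K_phi:
  assumes "finite (ground M)" "k \<in> carrier (K M)"
  obtains f where "f \<in> PLaur (ground M)" "k = phi M f"
proof -
  obtain h where h: "h \<in> carrier (PExp M)" "k = K_class M h" using assms(2) by (auto simp: carrier_K)
  obtain f where "f \<in> PLaur (ground M)" "plaur_restr M f = h" using PExp_plaur[OF assms(1) h(1)] .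
  then show ?thesis using that h(2) by (simp add: phi_def)
qed

lemma phi_carrier: "finite (ground M) \<Longrightarrow> f \<in> PLaur (ground M) \<Longrightarrow> phi M f \<in> carrier (K M)"
  unfolding phi_def carrier_K using restrict_plaur_fun_PExp by blast

lemma phi_add:
  assumes "finite (ground M)" "f \<in> PLaur (ground M)" "g \<in> PLaur (ground M)"
  shows "phi M (\<lambda>\<sigma>\<in>bijs (ground M). f \<sigma> + g \<sigma>) = phi M f \<oplus>\<^bsub>K M\<^esub> phi M g"
  unfolding phi_def plaur_restr_add[OF assms]
  by (rule ring_hom_add[OF K_class_hom[OF assms(1)]]) (use restrict_plaur_fun_PExp assms in auto)

lemma represents_Q_unique:
  assumes M: "matroid M" and ne: "ground M \<noteq> {}"
  shows "\<exists>!\<chi>. represents_Q M \<chi>"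
proof -
  have fin: "finite (ground M)" using M by (simp add: matroid_def)
  \<comment> \<open>An arbitrary preimage under \<open>phi\<close>;
    \<open>phi_eq_imp_Q_value_eq\<close> makes the value independent of it. The floor below only
    turns an integral real into an integer.\<close>
  define pre where "pre = (\<lambda>k. SOME f. f \<in> PLaur (ground M) \<and> k = phi M f)"
  have pre: "pre k \<in> PLaur (ground M)" "k = phi M (pre k)" if "k \<in> carrier (K M)" for k
  proof -
    have "\<exists>f. f \<in> PLaur (ground M) \<and> k = phi M f" using carrier_K_phi[OF fin that] by metis
    then have "pre k \<in> PLaur (ground M) \<and> k = phi M (pre k)" unfolding pre_def by (rule someI_ex)
    then show "pre k \<in> PLaur (ground M)" "k = phi M (pre k)" by auto
  qed
  define \<chi> where "\<chi> = (\<lambda>k\<in>carrier (K M). \<lfloor>Q_value M (pre k)\<rfloor>)"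
  have chi: "of_int (\<chi> (phi M f)) = Q_value M f" if f: "f \<in> PLaur (ground M)" for f
  proof -
    note c = phi_carrier[OF fin f]
    have "Q_value M (pre (phi M f)) = Q_value M f"
      using pre[OF c] by (intro phi_eq_imp_Q_value_eq[OF M ne _ f]) simp_all
    moreover obtain j :: int where "Q_value M f = of_int j" using Q_value_int[OF M f] by blast
    ultimately show ?thesis using c by (simp add: \<chi>_def)
  qed
  have "represents_Q M \<chi>"
    unfolding represents_Q_def K_additive_def
  proof (intro conjI CollectI ballI)
    show "\<chi> \<in> carrier (K M) \<rightarrow>\<^sub>E UNIV" by (simp add: \<chi>_def)
    show "of_int (\<chi> (phi M f)) = leval (\<lambda>_. 1) (Q M f)" if "f \<in> PLaur (ground M)" for f
      by (simp add: chi[OF that] leval_Q[OF M that])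
    fix x y assume "x \<in> carrier (K M)" "y \<in> carrier (K M)"
    then obtain f g where f: "f \<in> PLaur (ground M)" "x = phi M f" and g: "g \<in> PLaur (ground M)" "y = phi M g"
      using carrier_K_phi[OF fin] by metis
    have "of_int (\<chi> (x \<oplus>\<^bsub>K M\<^esub> y)) = (of_int (\<chi> x + \<chi> y) :: real)"
      unfolding f(2) g(2) phi_add[OF fin f(1) g(1), symmetric] of_int_add chi[OF f(1)] chi[OF g(1)]
        chi[OF PLaur_add[OF fin f(1) g(1)]] by (rule Q_value_add[OF M f(1) g(1)])
    then show "\<chi> (x \<oplus>\<^bsub>K M\<^esub> y) = \<chi> x + \<chi> y" by (simp only: of_int_eq_iff)
  qed
  moreover have "\<chi>' = \<chi>" if "represents_Q M \<chi>'" for \<chi>'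
  proof (rule extensionalityI)
    show "\<chi>' \<in> extensional (carrier (K M))" "\<chi> \<in> extensional (carrier (K M))"
      using that by (auto simp: represents_Q_def K_additive_def \<chi>_def PiE_def)
    fix k assume "k \<in> carrier (K M)"
    then obtain f where f: "f \<in> PLaur (ground M)" "k = phi M f" using carrier_K_phi[OF fin] by metis
    have "(of_int (\<chi>' k) :: real) = of_int (\<chi> k)"
      using that f(1) unfolding f(2) chi[OF f(1)] by (simp add: represents_Q_def leval_Q[OF M])
    then show "\<chi>' k = \<chi> k" by simp
  qed
  ultimately show ?thesis by blast
qed

lemma chi_tilde_represents: "matroid M \<Longrightarrow> ground M \<noteq> {} \<Longrightarrow> represents_Q M (chi_tilde M)"
  unfolding chi_tilde_def by (rule theI'[OF represents_Q_unique])

lemma chi_tilde_phi: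
  assumes "matroid M" "ground M \<noteq> {}" "f \<in> PLaur (ground M)"
  shows "of_int (chi_tilde M (phi M f)) = Q_value M f"
  using chi_tilde_represents[OF assms(1,2)] leval_Q[OF assms(1,3)] assms(3) by (simp add: represents_Q_def)

lemma psi_eq_phi:
  assumes "finite (ground M)"
  shows "psi M (plin_of_coeffs (ground M) a) = phi M (plaur_exp (ground M) a)"
proof -
  have "(\<lambda>b\<in>fan_support M. exp (plin_of_coeffs (ground M) a b)) = plaur_restr M (plaur_exp (ground M) a)"
    by (rule restrict_ext) (simp add: plaur_fun_plaur_exp[OF assms] fan_support_props(1)[OF assms])
  then show ?thesis by (simp add: psi_def phi_def)
qed

lemma chi_star_chi_tilde:
  assumes "matroid M" "ground M \<noteq> {}"
  shows "of_int (chi_star chi_tilde M (plin_of_coeffs (ground M) a)) = flag_value (rk M) (a({} := 0)) {} (ground M)"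
proof -
  have fin: "finite (ground M)" using assms(1) by (simp add: matroid_def)
  show ?thesis
    unfolding chi_star_def psi_eq_phi[OF fin] chi_tilde_phi[OF assms plaur_exp_PLaur[OF fin]]
    by (rule Q_value_plaur_exp[OF assms(1)])
qed

section \<open>The recursion and uniqueness\<close>

lemma matroid_finite: "matroid M \<Longrightarrow> finite (ground M)"
  by (simp add: matroid_def)

lemma rk_empty: "matroid M \<Longrightarrow> rk M {} = 0"
  using rank_fun_le_card[OF rank_fun_matroid, of M "{}"] by simp

lemma matroid_restrict:
  assumes "matroid M" "F \<subseteq> ground M"
  shows "matroid (matroid_restrict M F)"
proof -
  note r = rank_fun_matroid[OF assms(1)]
  have "finite F" using assms by (auto simp: matroid_def intro: finite_subset)
  moreover have "rk M A \<le> card A" if "A \<subseteq> F" for A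
    using rank_fun_le_card[OF r, of A] that assms(2) by auto
  moreover have "rk M A \<le> rk M B" if "A \<subseteq> B" "B \<subseteq> F" for A B
    using rank_fun_mono[OF r, of A B] that assms(2) by auto
  moreover have "rk M (A \<union> B) + rk M (A \<inter> B) \<le> rk M A + rk M B" if "A \<subseteq> F" "B \<subseteq> F" for A B
    using rank_fun_submodular[OF r, of A B] that assms(2) by auto
  ultimately show ?thesis by (auto simp: matroid_def matroid_restrict_def le_infI1)
qed

lemma matroid_contract:
  assumes "matroid M" "F \<subseteq> ground M"
  shows "matroid (matroid_contract M F)"
proof -
  note r = rank_fun_matroid[OF assms(1)]
  let ?r = "\<lambda>A. rk M (A \<union> F) - rk M F"
  \<comment> \<open>Makes the truncated subtractions of natural numbers exact.\<close>
  have ge: "rk M F \<le> rk M (A \<union> F)" if "A \<subseteq> ground M - F" for A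
    by (rule rank_fun_mono[OF r]) (use that assms(2) in auto)
  have "finite (ground M - F)" using assms by (auto simp: matroid_def)
  moreover have "?r A \<le> card A" if "A \<subseteq> ground M - F" for A
    using rank_fun_le_card[OF r, of A] rank_fun_submodular[OF r, of A F] that assms(2) by fastforce
  moreover have "?r A \<le> ?r B" if "A \<subseteq> B" "B \<subseteq> ground M - F" for A B
  proof -
    have "rk M (A \<union> F) \<le> rk M (B \<union> F)"
      by (rule rank_fun_mono[OF r]) (use that assms(2) in auto)
    then show ?thesis by simp
  qed
  moreover have "?r (A \<union> B) + ?r (A \<inter> B) \<le> ?r A + ?r B"
    if A: "A \<subseteq> ground M - F" and B: "B \<subseteq> ground M - F" for A B
  proof -
    have "rk M ((A \<union> F) \<union> (B \<union> F)) + rk M ((A \<union> F) \<inter> (B \<union> F)) \<le> rk M (A \<union> F) + rk M (B \<union> F)"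
      by (rule rank_fun_submodular[OF r]) (use A B assms(2) in auto)
    moreover have "(A \<union> F) \<union> (B \<union> F) = (A \<union> B) \<union> F" "(A \<union> F) \<inter> (B \<union> F) = (A \<inter> B) \<union> F"
      by auto
    moreover have "rk M F \<le> rk M ((A \<union> B) \<union> F)" "rk M F \<le> rk M ((A \<inter> B) \<union> F)"
      "rk M F \<le> rk M (A \<union> F)" "rk M F \<le> rk M (B \<union> F)"
      using A B by (intro ge; auto)+
    ultimately show ?thesis by simp
  qed
  ultimately show ?thesis by (auto simp: matroid_def matroid_contract_def le_infI1)
qed

lemma ground_minors [simp]:
  "ground (matroid_restrict M F) = F" "ground (matroid_contract M F) = ground M - F"
  by (simp_all add: matroid_restrict_def matroid_contract_def)

lemma loopless_matroids_minors:
  assumes "M \<in> loopless_matroids" "flat M F" "F \<noteq> {}" "F \<noteq> ground M"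
  shows "matroid_restrict M F \<in> loopless_matroids" "matroid_contract M F \<in> loopless_matroids"
proof -
  have M: "matroid M" "loopless M" and F: "F \<subseteq> ground M" using assms by (auto simp: loopless_matroids_def flat_def)
  have "loopless (matroid_restrict M F)"
    using M(2) F by (auto simp: loopless_def matroid_restrict_def)
  then show "matroid_restrict M F \<in> loopless_matroids"
    using matroid_restrict[OF M(1) F] assms(3) by (simp add: loopless_matroids_def)
  have "\<not> rk M (insert i F) \<le> rk M F" if "i \<in> ground M" "i \<notin> F" for i
    using assms(2) that by (auto simp: flat_iff_rk not_le)
  then have "loopless (matroid_contract M F)"
    by (auto simp: loopless_def matroid_contract_def)
  moreover have "ground M - F \<noteq> {}" using F assms(4) by auto
  ultimately show "matroid_contract M F \<in> loopless_matroids"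
    using matroid_contract[OF M(1) F] by (simp add: loopless_matroids_def)
qed

lemma chi_tilde_zero:
  assumes "matroid M" "ground M \<noteq> {}" "loopless M"
  shows "chi_star chi_tilde M (plin_zero (ground M)) = 1"
proof -
  have "flag_value (rk M) ((\<lambda>_. 0)({} := 0)) {} (ground M) =
      (if \<exists>y\<in>ground M. rk M (insert y {}) = rk M {} then 0 else 1)"
    by (rule flag_value_linear[OF rank_fun_matroid[OF assms(1)], where c = 0 and k = "\<lambda>_. 0"]) auto
  moreover have "\<not> (\<exists>y\<in>ground M. rk M (insert y {}) = rk M {})"
    using assms(3) rk_empty[OF assms(1)] by (auto simp: loopless_def)
  ultimately have "flag_value (rk M) ((\<lambda>_. 0)({} := 0)) {} (ground M) = 1" by auto
  then show ?thesis
    using chi_star_chi_tilde[OF assms(1,2), of "\<lambda>_. 0"] plin_zero_eq[OF matroid_finite[OF assms(1)]] by simp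
qed

lemma flag_value_restrict:
  "flag_value (rk (matroid_restrict M F)) a {} F = flag_value (rk M) a {} F"
  unfolding flag_value_def
  by (intro arg_cong[where f = frac_value] flag_sum_shift[where c = 0]) (auto simp: matroid_restrict_def)

lemma flag_value_contract:
  assumes "matroid M" "F \<subseteq> ground M"
  shows "flag_value (rk (matroid_contract M F)) (\<lambda>T. a (F \<union> T) - a F) {} (ground M - F) =
    flag_value (rk M) a F (ground M - F)"
  unfolding flag_value_def
proof (intro arg_cong[where f = frac_value] flag_sum_shift[where c = "a F"])
  fix U y assume U: "U \<subseteq> ground M - F" and y: "y \<in> ground M - F"
  have "rk M F \<le> rk M (F \<union> U)" "rk M F \<le> rk M (insert y (F \<union> U))"
    by (rule rank_fun_mono[OF rank_fun_matroid[OF assms(1)]]; use U y assms(2) in auto)+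
  then show "rk (matroid_contract M F) U < rk (matroid_contract M F) (insert y U) \<longleftrightarrow>
      rk M (F \<union> U) < rk M (insert y (F \<union> U))"
    using U y by (simp add: matroid_contract_def Un_commute) linarith
qed simp

text \<open>This is \<open>flag_value_decrease\<close> for the empty prefix and T = F, with the two
  factors rewritten as values for the restriction and the contraction.\<close>

lemma chi_tilde_recursion:
  assumes M: "matroid M" and F: "F \<subseteq> ground M" "F \<noteq> {}" "F \<noteq> ground M" and f: "f \<in> PLin (ground M)"
  shows "chi_star chi_tilde M f =
     chi_star chi_tilde M (plin_diff (ground M) f (pdelta (ground M) F)) +
     chi_star chi_tilde (matroid_restrict M F) (plin_restrict (ground M) f F) *
     chi_star chi_tilde (matroid_contract M F) (plin_contract (ground M) f F)"
proof -
  have fin: "finite (ground M)" by (rule matroid_finite[OF M])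
  have ne: "ground M \<noteq> {}" and FE: "ground M - F \<noteq> {}" using F by auto
  define a where "a = plin_coeffs (ground M) f"
  have fa: "f = plin_of_coeffs (ground M) a" using plin_of_plin_coeffs[OF fin f] by (simp add: a_def)
  let ?a = "a({} := 0)"
  have "of_int (chi_star chi_tilde M f) = flag_value (rk M) ?a {} (ground M)"
    unfolding fa by (rule chi_star_chi_tilde[OF M ne])
  also have "\<dots> = flag_value (rk M) (?a(F := ?a F - 1)) {} (ground M) +
      flag_value (rk M) ?a {} F * flag_value (rk M) ?a F (ground M - F)"
    using flag_value_decrease[OF rank_fun_matroid[OF M], of "{}" "ground M" F ?a] F by simp
  also have "flag_value (rk M) (?a(F := ?a F - 1)) {} (ground M) =
      of_int (chi_star chi_tilde M (plin_diff (ground M) f (pdelta (ground M) F)))"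
  proof -
    have "?a(F := ?a F - 1) = (a(F := a F - 1))({} := 0)" using F(2) by auto
    moreover have "F \<in> nonempty_subsets (ground M)" using F by (simp add: nonempty_subsets_def)
    ultimately show ?thesis
      unfolding fa using chi_star_chi_tilde[OF M ne] plin_diff_pdelta[OF fin] by metis
  qed
  also have "flag_value (rk M) ?a {} F =
      of_int (chi_star chi_tilde (matroid_restrict M F) (plin_restrict (ground M) f F))"
    using chi_star_chi_tilde[OF matroid_restrict[OF M F(1)], of a] F(2)
    by (simp only: ground_minors flag_value_restrict plin_restrict_def a_def not_False_eq_True)
  also have "flag_value (rk M) ?a F (ground M - F) =
      of_int (chi_star chi_tilde (matroid_contract M F) (plin_contract (ground M) f F))"
  proof -
    \<comment> \<open>At the empty set both sides are 0; elsewhere F nonempty keeps the update of a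
      at the empty set out of sight.\<close>
    have "(\<lambda>T. a (F \<union> T) - a F)({} := 0) = (\<lambda>T. ?a (F \<union> T) - ?a F)" using F(2) by auto
    then show ?thesis
      using chi_star_chi_tilde[OF matroid_contract[OF M F(1)], of "\<lambda>T. a (F \<union> T) - a F"] FE
        flag_value_contract[OF M F(1), of ?a] by (simp only: ground_minors plin_contract_def a_def not_False_eq_True)
  qed
  finally show ?thesis unfolding of_int_mult[symmetric] of_int_add[symmetric] of_int_eq_iff .
qed

text \<open>A loop is an element of the closure of the empty set, so every exponential has value 0,
  and exponentials span.\<close>

lemma chi_tilde_loop:
  assumes M: "matroid M" and "\<not> loopless M" and k: "k \<in> carrier (K M)"
  shows "chi_tilde M k = 0"
proof -
  have fin: "finite (ground M)" by (rule matroid_finite[OF M])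
  obtain y where y: "y \<in> ground M" "rk M {y} = 0" using assms(2) by (auto simp: loopless_def)
  then have ne: "ground M \<noteq> {}" by auto
  obtain f where f: "f \<in> PLaur (ground M)" "k = phi M f" using carrier_K_phi[OF fin k] .
  obtain cs where cs: "f = plaur_comb (ground M) cs" using PLaur_span[OF fin f(1)] .
  have "flag_value (rk M) a {} (ground M) = 0" for a
    by (rule flag_value_loop[OF rank_fun_matroid[OF M], of _ _ y]) (use y rk_empty[OF M] in auto)
  then have "Q_value M f = 0"
    unfolding cs Q_value_plaur_comb[OF M] by (simp add: case_prod_unfold)
  then show ?thesis using chi_tilde_phi[OF M ne f(1)] f(2) by simp
qed

text \<open>Minors at nonempty proper flats are again loopless on nonempty ground sets, so the
  recursion stays inside the domain to which the family is restricted.\<close>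

lemma is_euler_family_chi_tilde: "is_euler_family (restrict chi_tilde loopless_matroids)"
proof -
  let ?\<chi> = "restrict chi_tilde loopless_matroids"
  have star: "chi_star ?\<chi> M f = chi_star chi_tilde M f" if "M \<in> loopless_matroids" for M f
    using that by (simp add: chi_star_def)
  have "?\<chi> M \<in> K_additive M \<and> chi_star ?\<chi> M (plin_zero (ground M)) = 1 \<and> euler_recursion ?\<chi> M"
    if M: "M \<in> loopless_matroids" for M
  proof (intro conjI)
    have m: "matroid M" "ground M \<noteq> {}" "loopless M" using M by (auto simp: loopless_matroids_def)
    show "?\<chi> M \<in> K_additive M"
      using chi_tilde_represents[OF m(1,2)] M by (simp add: represents_Q_def)
    show "chi_star ?\<chi> M (plin_zero (ground M)) = 1"
      unfolding star[OF M] by (rule chi_tilde_zero[OF m])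
    show "euler_recursion ?\<chi> M"
      unfolding euler_recursion_def
    proof (intro allI impI ballI)
      fix F f assume F: "flat M F \<and> F \<noteq> {} \<and> F \<noteq> ground M" and f: "f \<in> PLin (ground M)"
      then have minors: "matroid_restrict M F \<in> loopless_matroids" "matroid_contract M F \<in> loopless_matroids"
        using loopless_matroids_minors[OF M] by auto
      show "chi_star ?\<chi> M f = chi_star ?\<chi> M (plin_diff (ground M) f (pdelta (ground M) F)) +
          chi_star ?\<chi> (matroid_restrict M F) (plin_restrict (ground M) f F) *
          chi_star ?\<chi> (matroid_contract M F) (plin_contract (ground M) f F)"
        unfolding star[OF M] star[OF minors(1)] star[OF minors(2)]
        by (rule chi_tilde_recursion[OF m(1)]) (use F f in \<open>auto simp: flat_def\<close>)
    qed
  qed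
  then show ?thesis unfolding is_euler_family_def by (intro conjI ballI restrict_extensional) blast+
qed

text \<open>Additive maps respect integer multiples, by induction on the multiplier in both
  directions from 0; hence they are determined by the classes of exponentials.\<close>

lemma K_additive_plaur_comb:
  assumes fin: "finite (ground M)" and \<chi>: "\<chi> \<in> K_additive M"
  shows "\<chi> (phi M (plaur_comb (ground M) cs)) = (\<Sum>(c, a)\<leftarrow>cs. c * \<chi> (psi M (plin_of_coeffs (ground M) a)))"
proof -
  let ?E = "ground M"
  have add: "\<chi> (phi M (\<lambda>\<sigma>\<in>bijs ?E. f \<sigma> + g \<sigma>)) = \<chi> (phi M f) + \<chi> (phi M g)"
    if "f \<in> PLaur ?E" "g \<in> PLaur ?E" for f g
    using \<chi> that by (simp add: phi_add[OF fin] K_additive_def phi_carrier[OF fin])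
  have Nil: "\<chi> (phi M (plaur_comb ?E [])) = 0"
  proof -
    have "(\<lambda>\<sigma>\<in>bijs ?E. plaur_comb ?E [] \<sigma> + plaur_comb ?E [] \<sigma>) = plaur_comb ?E []"
      unfolding plaur_comb_Nil by (rule restrict_ext) simp
    then show ?thesis
      using add[OF plaur_comb_PLaur[OF fin, of "[]"] plaur_comb_PLaur[OF fin, of "[]"]] by simp
  qed
  have scale: "\<chi> (phi M (\<lambda>\<sigma>\<in>bijs ?E. of_int c * f \<sigma>)) = c * \<chi> (phi M f)" if f: "f \<in> PLaur ?E" for c f
  proof -
    have S: "(\<lambda>\<sigma>\<in>bijs ?E. of_int c * f \<sigma>) \<in> PLaur ?E" for c by (rule PLaur_scale[OF fin f Laur_of_int])
    have step: "\<chi> (phi M (\<lambda>\<sigma>\<in>bijs ?E. of_int (c + 1) * f \<sigma>)) = \<chi> (phi M (\<lambda>\<sigma>\<in>bijs ?E. of_int c * f \<sigma>)) + \<chi> (phi M f)" for c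
    proof -
      have "(\<lambda>\<sigma>\<in>bijs ?E. of_int (c + 1) * f \<sigma>) = (\<lambda>\<sigma>\<in>bijs ?E. (\<lambda>\<sigma>\<in>bijs ?E. of_int c * f \<sigma>) \<sigma> + f \<sigma>)"
        by (rule restrict_ext) (simp add: distrib_right)
      then show ?thesis using add[OF S f] by simp
    qed
    show ?thesis
    proof (induction c rule: int_induct[where k = 0])
      case base
      have "(\<lambda>\<sigma>\<in>bijs ?E. of_int 0 * f \<sigma>) = plaur_comb ?E []"
        unfolding plaur_comb_Nil by (rule restrict_ext) simp
      then show ?case using Nil by simp
    next
      case (step1 i)
      show ?case by (simp only: step step1(2) distrib_right mult_1)
    next
      case (step2 i)
      have "i * \<chi> (phi M f) = \<chi> (phi M (\<lambda>\<sigma>\<in>bijs ?E. of_int (i - 1) * f \<sigma>)) + \<chi> (phi M f)"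
        using step[of "i - 1"] unfolding diff_add_cancel step2(2) .
      then show ?case unfolding left_diff_distrib mult_1 by linarith
    qed
  qed
  show ?thesis
  proof (induction cs)
    case (Cons ca cs)
    obtain c a where ca: "ca = (c, a)" by (cases ca)
    have "\<chi> (phi M (plaur_comb ?E (ca # cs))) = c * \<chi> (phi M (plaur_exp ?E a)) + \<chi> (phi M (plaur_comb ?E cs))"
      unfolding ca plaur_comb_Cons
        add[OF PLaur_scale[OF fin plaur_exp_PLaur[OF fin] Laur_of_int] plaur_comb_PLaur[OF fin]]
        scale[OF plaur_exp_PLaur[OF fin]] ..
    then show ?case using Cons by (simp add: ca psi_eq_phi[OF fin])
  qed (simp add: Nil)
qed

text \<open>On the support only coordinates at flats are nonzero, so the function agrees there with
  the linear function m with coefficients k. Its exponential differs from 1 by a generator of the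
  ideal.\<close>

lemma psi_linear:
  assumes "finite (ground M)" and lin: "\<And>F. F \<in> flats M \<Longrightarrow> a F = (\<Sum>j\<in>F. k j)"
  shows "psi M (plin_of_coeffs (ground M) a) = psi M (plin_zero (ground M))"
proof -
  let ?E = "ground M"
  let ?m = "\<lambda>b\<in>RR ?E. \<Sum>i\<in>?E. real_of_int (k i) * b i"
  have "?m \<in> int_linear ?E" unfolding int_linear_eq[OF assms(1)] by blast
  then have "restrict ?m (fan_support M) \<in> Lin_fan M" unfolding Lin_fan_def by (rule imageI)
  then have gen: "(\<lambda>b\<in>fan_support M. exp (restrict ?m (fan_support M) b) - 1) \<in>
      {\<lambda>b\<in>fan_support M. exp (f b) - 1 | f. f \<in> Lin_fan M}" by blast
  have val: "plin_of_coeffs ?E a b = ?m b" if b: "b \<in> fan_support M" for b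
  proof -
    note p = fan_support_props[OF assms(1) b]
    have "(\<Sum>T\<in>nonempty_subsets ?E. of_int (a T) * bdelta ?E T b) =
        (\<Sum>T\<in>nonempty_subsets ?E. of_int (\<Sum>j\<in>T. k j) * bdelta ?E T b)"
    proof (rule sum.cong[OF refl])
      fix T assume "T \<in> nonempty_subsets ?E"
      then show "of_int (a T) * bdelta ?E T b = of_int (\<Sum>j\<in>T. k j) * bdelta ?E T b"
        using p(3)[of T] lin[of T] by (cases "T \<in> flats M") auto
    qed
    then show ?thesis
      using p(1) sum_bdelta_linear[OF assms(1) p(1), of k] by (simp add: plin_of_coeffs_eq[OF assms(1)])
  qed
  let ?h = "\<lambda>b\<in>fan_support M. exp (plin_of_coeffs ?E a b)"
  let ?o = "\<lambda>b\<in>fan_support M. exp (plin_zero ?E b)"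
  interpret R: cring "PExp M" by (rule cring_PExp[OF assms(1)])
  have o: "?o = \<one>\<^bsub>PExp M\<^esub>"
    unfolding PExp_ops by (rule restrict_ext) (simp add: plin_zero_def fan_support_props(1)[OF assms(1)])
  have "?h = plaur_restr M (plaur_exp ?E a)"
    by (rule restrict_ext) (simp add: plaur_fun_plaur_exp[OF assms(1)] fan_support_props(1)[OF assms(1)])
  then have h: "?h \<in> carrier (PExp M)"
    using restrict_plaur_fun_PExp[OF assms(1) plaur_exp_PLaur[OF assms(1)]] by metis
  let ?g = "\<lambda>b\<in>fan_support M. exp (restrict ?m (fan_support M) b) - 1"
  have g: "?g \<in> K_ideal M"
    unfolding K_ideal_def using R.genideal_self[OF K_generators_subset[OF assms(1)]] gen by blast
  have gc: "?g \<in> carrier (PExp M)" using K_generators_subset[OF assms(1)] gen by blast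
  have gh: "?g \<oplus>\<^bsub>PExp M\<^esub> \<one>\<^bsub>PExp M\<^esub> = ?h"
    unfolding PExp_ops by (rule restrict_ext) (simp add: val del: restrict_apply, simp add: val)
  have "?h \<ominus>\<^bsub>PExp M\<^esub> \<one>\<^bsub>PExp M\<^esub> = ?g"
    unfolding gh[symmetric] R.minus_eq
    by (subst R.a_assoc[OF gc R.one_closed R.a_inv_closed[OF R.one_closed]])
      (simp only: R.r_neg[OF R.one_closed] R.r_zero[OF gc])
  then have "K_class M ?h = K_class M \<one>\<^bsub>PExp M\<^esub>"
    using g K_class_eq_iff[OF assms(1) h R.one_closed] by simp
  then show ?thesis by (simp add: psi_def o)
qed

text \<open>By the recursion, the difference of two families is invariant under changing the coefficients
  at proper flats. Hence every \<open>f\<close> can be replaced by a linear function, whose class is \<open>1\<close>.\<close>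

lemma euler_family_unique:
  assumes "is_euler_family \<chi>" "is_euler_family \<chi>'"
  shows "\<chi> = \<chi>'"
proof (rule extensionalityI)
  show "\<chi> \<in> extensional loopless_matroids" "\<chi>' \<in> extensional loopless_matroids"
    using assms by (auto simp: is_euler_family_def)
  fix M :: "'a matroid" assume "M \<in> loopless_matroids"
  then show "\<chi> M = \<chi>' M"
  proof (induction "card (ground M)" arbitrary: M rule: less_induct)
    case less
    let ?E = "ground M"
    have m: "matroid M" "?E \<noteq> {}" using less.prems by (auto simp: loopless_matroids_def)
    have fin: "finite ?E" by (rule matroid_finite[OF m(1)])
    have add: "\<chi> M \<in> K_additive M" "\<chi>' M \<in> K_additive M"
      and zero: "chi_star \<chi> M (plin_zero ?E) = 1" "chi_star \<chi>' M (plin_zero ?E) = 1"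
      and rec: "euler_recursion \<chi> M" "euler_recursion \<chi>' M"
      using assms less.prems by (auto simp: is_euler_family_def)
    define D where "D = (\<lambda>a. chi_star \<chi> M (plin_of_coeffs ?E a) - chi_star \<chi>' M (plin_of_coeffs ?E a))"
    have step: "D (a(F := a F - 1)) = D a" if F: "F \<in> flats M - {?E}" for F a
    proof -
      have F': "flat M F" "F \<noteq> {}" "F \<noteq> ?E" "F \<subseteq> ?E" using F by (auto simp: flats_def flat_def)
      have "card F < card ?E" "card (?E - F) < card ?E"
        using F' fin by (auto intro!: psubset_card_mono)
      then have minors: "\<chi> (matroid_restrict M F) = \<chi>' (matroid_restrict M F)"
        "\<chi> (matroid_contract M F) = \<chi>' (matroid_contract M F)"
        using less.hyps loopless_matroids_minors[OF less.prems F'(1-3)] by auto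
      have Fn: "F \<in> nonempty_subsets ?E" using F' by (simp add: nonempty_subsets_def)
      let ?f = "plin_of_coeffs ?E a"
      have "chi_star \<chi> M ?f = chi_star \<chi> M (plin_diff ?E ?f (pdelta ?E F)) +
          chi_star \<chi> (matroid_restrict M F) (plin_restrict ?E ?f F) *
          chi_star \<chi> (matroid_contract M F) (plin_contract ?E ?f F)"
        "chi_star \<chi>' M ?f = chi_star \<chi>' M (plin_diff ?E ?f (pdelta ?E F)) +
          chi_star \<chi>' (matroid_restrict M F) (plin_restrict ?E ?f F) *
          chi_star \<chi>' (matroid_contract M F) (plin_contract ?E ?f F)"
        using rec F' plin_of_coeffs_PLin[OF fin, of a] unfolding euler_recursion_def by blast+
      then show ?thesis
        unfolding D_def plin_diff_pdelta[OF fin Fn] chi_star_def minors by linarith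
    qed
    have D0: "D a = 0" for a
    proof -
      from m(2) obtain i where i: "i \<in> ?E" by blast
      \<comment> \<open>The recursion does not move the value at the ground set, so the linear
        function has to have exactly that value there; one element i carries it.\<close>
      define k where "k = (\<lambda>j. if j = i then a ?E else 0)"
      define a' where "a' = (\<lambda>T. if T \<in> flats M - {?E} then (\<Sum>j\<in>T. k j) else a T)"
      have "D a = D a'"
      proof (rule eq_if_agree_outside_finite[where \<U> = "flats M - {?E}" and D = D and a = a and a' = a'])
        show "finite (flats M - {?E})"
          using finite_nonempty_subsets[OF fin] flats_nonempty_subsets finite_subset by blast
      qed (use step in \<open>auto simp: a'_def\<close>)
      moreover have "a' F = (\<Sum>j\<in>F. k j)" if "F \<in> flats M" for F
        using that i fin by (cases "F = ?E") (simp_all add: a'_def k_def)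
      then have "psi M (plin_of_coeffs ?E a') = psi M (plin_zero ?E)"
        by (rule psi_linear[OF fin])
      then have "D a' = 0" using zero by (simp add: D_def chi_star_def)
      ultimately show ?thesis by simp
    qed
    show ?case
    proof (rule extensionalityI)
      show "\<chi> M \<in> extensional (carrier (K M))" "\<chi>' M \<in> extensional (carrier (K M))"
        using add by (auto simp: K_additive_def PiE_def)
      fix x assume "x \<in> carrier (K M)"
      then obtain f where f: "f \<in> PLaur ?E" "x = phi M f" using carrier_K_phi[OF fin] by metis
      obtain cs where cs: "f = plaur_comb ?E cs" using PLaur_span[OF fin f(1)] .
      have "\<chi> M (psi M (plin_of_coeffs ?E a)) = \<chi>' M (psi M (plin_of_coeffs ?E a))" for a
        using D0[of a] by (simp add: D_def chi_star_def)
      then show "\<chi> M x = \<chi>' M x"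
        unfolding f(2) cs K_additive_plaur_comb[OF fin add(1)] K_additive_plaur_comb[OF fin add(2)] by simp
    qed
  qed
qed

theorem theorem4p3:
  fixes E :: "'a set" and M :: "'a matroid"
  assumes "finite E" and "E \<noteq> {}"
    and "matroid M" and "ground M = E"
  shows "(\<exists>!\<chi>. represents_Q M \<chi>) \<and>
    (\<not> loopless M \<longrightarrow> (\<forall>k\<in>carrier (K M). chi_tilde M k = 0)) \<and>
    (loopless M \<longrightarrow>
      chi_star chi_tilde M (plin_zero E) = 1 \<and>
      (\<forall>F. flat M F \<and> F \<noteq> {} \<and> F \<noteq> E \<longrightarrow> (\<forall>f\<in>PLin E.
         chi_star chi_tilde M f =
           chi_star chi_tilde M (plin_diff E f (pdelta E F)) +
           chi_star chi_tilde (matroid_restrict M F) (plin_restrict E f F) *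
           chi_star chi_tilde (matroid_contract M F) (plin_contract E f F))) \<and>
      (\<exists>!\<chi> :: 'a matroid \<Rightarrow> (('a \<Rightarrow> real) \<Rightarrow> real) set \<Rightarrow> int. is_euler_family \<chi>) \<and>
      chi_tilde M = matroid_euler M)"
proof (intro conjI impI allI ballI)
  have ne: "ground M \<noteq> {}" using assms by simp
  show "\<exists>!\<chi>. represents_Q M \<chi>" by (rule represents_Q_unique[OF assms(3) ne])
  show "chi_tilde M k = 0" if "\<not> loopless M" "k \<in> carrier (K M)" for k
    by (rule chi_tilde_loop[OF assms(3) that])
  show "chi_star chi_tilde M (plin_zero E) = 1" if "loopless M"
    using chi_tilde_zero[OF assms(3) ne that] assms(4) by simp
  show "chi_star chi_tilde M f =
           chi_star chi_tilde M (plin_diff E f (pdelta E F)) +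
           chi_star chi_tilde (matroid_restrict M F) (plin_restrict E f F) *
           chi_star chi_tilde (matroid_contract M F) (plin_contract E f F)"
    if "flat M F \<and> F \<noteq> {} \<and> F \<noteq> E" "f \<in> PLin E" for F f
    using chi_tilde_recursion[OF assms(3), of F f] that assms(4) by (simp add: flat_def)
  have unique: "\<exists>!\<chi> :: 'a matroid \<Rightarrow> (('a \<Rightarrow> real) \<Rightarrow> real) set \<Rightarrow> int. is_euler_family \<chi>"
    using is_euler_family_chi_tilde euler_family_unique by blast
  then show "\<exists>!\<chi> :: 'a matroid \<Rightarrow> (('a \<Rightarrow> real) \<Rightarrow> real) set \<Rightarrow> int. is_euler_family \<chi>" .
  have eq: "matroid_euler = restrict chi_tilde (loopless_matroids :: 'a matroid set)"
    unfolding matroid_euler_def by (rule the1_equality[OF unique]) (rule is_euler_family_chi_tilde)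
  show "chi_tilde M = matroid_euler M" if "loopless M"
    unfolding eq using that assms(3) ne by (simp add: loopless_matroids_def)
qed

end
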